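(* Let $H$ be a finite-dimensional Hopf algebra over a field $k$ with antipode $S$ and dual Hopf algebra $H^*$. The formula $$(\varphi\otimes h)(\varphi'\otimes h')=\varphi'^{(1)}(S^{-1}(h^{(3)}))\,\varphi'^{(3)}(S^2(h^{(1)}))\;\varphi\varphi'^{(2)}\otimes h^{(2)}h'$$ turns the vector space $A(H):=H^*\otimes H$ into an associative algebra with unit $\varepsilon\otimes 1$.
   Context: Sumless Sweedler notation: $\Delta(h)=h^{(1)}\otimes h^{(2)}$, with iterated coproducts $h^{(1)}\otimes h^{(2)}\otimes h^{(3)}$; similarly $\varphi^{(1)}\otimes\varphi^{(2)}\otimes\varphi^{(3)}$ in $H^*$. The dual Hopf algebra $H^*$ has the convolution product $(\varphi\varphi')(h)=\varphi(h^{(1)})\varphi'(h^{(2)})$, unit $\varepsilon$ (the counit of $H$), and coproduct determined by $\varphi^{(1)}(a)\varphi^{(2)}(b)=\varphi(ab)$. The antipode $S$ is bijective. *)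

theory Defs
  imports "HOL-Algebra.Algebraic_Closure_Type" "HOL-Algebra.Module" "HOL-Library.Poly_Mapping"
begin

text \<open>
  The ground field is a type \<open>'k\<close> of class \<open>field\<close>.  A vector space over it is a
  \<open>module\<close> record \<open>V\<close> satisfying \<open>module scalars V\<close>; the fields \<open>mult\<close> and \<open>one\<close> of such a
  record are irrelevant unless an algebra is meant.
\<close>

abbreviation scalars :: "'k::field ring" where
  "scalars \<equiv> ring_of_type_algebra"

definition scalar_space :: "('k::field, 'k) module" where
  "scalar_space = \<lparr>carrier = UNIV, monoid.mult = (*), one = 1, zero = 0, add = (+), module.smult = (*)\<rparr>"

definition linear_map ::
  "('k::field, 'a, 'm) module_scheme \<Rightarrow> ('k, 'b, 'n) module_scheme \<Rightarrow> ('a \<Rightarrow> 'b) \<Rightarrow> bool" where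
  "linear_map V W f \<longleftrightarrow> f \<in> carrier V \<rightarrow> carrier W \<and>
     (\<forall>x\<in>carrier V. \<forall>y\<in>carrier V. f (x \<oplus>\<^bsub>V\<^esub> y) = f x \<oplus>\<^bsub>W\<^esub> f y) \<and>
     (\<forall>c. \<forall>x\<in>carrier V. f (c \<odot>\<^bsub>V\<^esub> x) = c \<odot>\<^bsub>W\<^esub> f x)"

definition finite_dimensional :: "('k::field, 'a, 'm) module_scheme \<Rightarrow> bool" where
  "finite_dimensional V \<longleftrightarrow> (\<exists>B. finite B \<and> B \<subseteq> carrier V \<and>
     (\<forall>v\<in>carrier V. \<exists>c. v = (\<Oplus>\<^bsub>V\<^esub>b\<in>B. c b \<odot>\<^bsub>V\<^esub> b)))"

text \<open>
  Associative unital algebras, not necessarily commutative (unlike the locale \<open>algebra\<close> of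
  HOL-Algebra).
\<close>

locale assoc_algebra = module R A + ring A for R and A +
  assumes smult_mult_left:
      "\<lbrakk>c \<in> carrier R; x \<in> carrier A; y \<in> carrier A\<rbrakk>
        \<Longrightarrow> (c \<odot>\<^bsub>A\<^esub> x) \<otimes>\<^bsub>A\<^esub> y = c \<odot>\<^bsub>A\<^esub> (x \<otimes>\<^bsub>A\<^esub> y)"
    and smult_mult_right:
      "\<lbrakk>c \<in> carrier R; x \<in> carrier A; y \<in> carrier A\<rbrakk>
        \<Longrightarrow> x \<otimes>\<^bsub>A\<^esub> (c \<odot>\<^bsub>A\<^esub> y) = c \<odot>\<^bsub>A\<^esub> (x \<otimes>\<^bsub>A\<^esub> y)"


subsection \<open>Tensor products\<close>

text \<open>
  \<open>V \<otimes> W\<close> is the free vector space on \<open>carrier V \<times> carrier W\<close> modulo the subspace generated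
  by the bilinearity relations; its elements are cosets.
\<close>

definition free_space :: "'x set \<Rightarrow> ('k::field, 'x \<Rightarrow>\<^sub>0 'k) module" where
  "free_space S = \<lparr>carrier = {x. Poly_Mapping.keys x \<subseteq> S}, monoid.mult = undefined, one = undefined,
     zero = 0, add = (+), module.smult = (\<lambda>c. Poly_Mapping.map ((*) c))\<rparr>"

definition generated_subspace :: "('k::field, 'a, 'm) module_scheme \<Rightarrow> 'a set \<Rightarrow> 'a set" where
  "generated_subspace V G = \<Inter> {U. submodule U scalars V \<and> G \<subseteq> U}"

definition quotient_space :: "('k::field, 'a, 'm) module_scheme \<Rightarrow> 'a set \<Rightarrow> ('k, 'a set) module" where
  "quotient_space V N = \<lparr>carrier = a_rcosets\<^bsub>V\<^esub> N, monoid.mult = undefined, one = undefined,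
     zero = N, add = set_add V, module.smult = (\<lambda>c C. \<Union>x\<in>C. N +>\<^bsub>V\<^esub> (c \<odot>\<^bsub>V\<^esub> x))\<rparr>"

type_synonym ('k, 'a, 'b) tensor = "('a \<times> 'b \<Rightarrow>\<^sub>0 'k) set"

definition bilinearity_relations ::
  "('k::field, 'a, 'm) module_scheme \<Rightarrow> ('k, 'b, 'n) module_scheme \<Rightarrow> ('a \<times> 'b \<Rightarrow>\<^sub>0 'k) set" where
  "bilinearity_relations V W =
     (let e = (\<lambda>a b. Poly_Mapping.single (a, b) 1) in
     {e (a \<oplus>\<^bsub>V\<^esub> a') b - e a b - e a' b | a a' b.
        a \<in> carrier V \<and> a' \<in> carrier V \<and> b \<in> carrier W} \<union>
     {e a (b \<oplus>\<^bsub>W\<^esub> b') - e a b - e a b' | a b b'.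
        a \<in> carrier V \<and> b \<in> carrier W \<and> b' \<in> carrier W} \<union>
     {e (c \<odot>\<^bsub>V\<^esub> a) b - Poly_Mapping.single (a, b) c | c a b. a \<in> carrier V \<and> b \<in> carrier W} \<union>
     {e a (c \<odot>\<^bsub>W\<^esub> b) - Poly_Mapping.single (a, b) c | c a b. a \<in> carrier V \<and> b \<in> carrier W})"

definition null_tensors ::
  "('k::field, 'a, 'm) module_scheme \<Rightarrow> ('k, 'b, 'n) module_scheme \<Rightarrow> ('a \<times> 'b \<Rightarrow>\<^sub>0 'k) set" where
  "null_tensors V W =
     generated_subspace (free_space (carrier V \<times> carrier W)) (bilinearity_relations V W)"

definition tensor_product ::
  "('k::field, 'a, 'm) module_scheme \<Rightarrow> ('k, 'b, 'n) module_scheme \<Rightarrow>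
     ('k, ('k, 'a, 'b) tensor) module" where
  "tensor_product V W = quotient_space (free_space (carrier V \<times> carrier W)) (null_tensors V W)"

definition pure_tensor ::
  "('k::field, 'a, 'm) module_scheme \<Rightarrow> ('k, 'b, 'n) module_scheme \<Rightarrow>
     'a \<Rightarrow> 'b \<Rightarrow> ('k, 'a, 'b) tensor" where
  "pure_tensor V W a b =
     null_tensors V W +>\<^bsub>free_space (carrier V \<times> carrier W)\<^esub> Poly_Mapping.single (a, b) 1"

text \<open>
  The linear map \<open>V \<otimes> W \<rightarrow> T\<close> induced by a bilinear map \<open>f\<close>: with \<open>t = \<Sum> c\<^sub>i a\<^sub>i \<otimes> b\<^sub>i\<close> the value is
  \<open>\<Sum> c\<^sub>i f a\<^sub>i b\<^sub>i\<close>, which for bilinear \<open>f\<close> does not depend on the representative of the coset \<open>t\<close>.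
  Sweedler notation is rendered this way: the expression \<open>f h\<^sub>1 h\<^sub>2\<close> in the components \<open>h\<^sub>1 \<otimes> h\<^sub>2\<close>
  of the coproduct of \<open>h\<close> is \<open>lift_bilinear T f (comult H h)\<close>.
\<close>

definition lift_bilinear ::
  "('k::field, 'c, 'm) module_scheme \<Rightarrow> ('a \<Rightarrow> 'b \<Rightarrow> 'c) \<Rightarrow> ('k, 'a, 'b) tensor \<Rightarrow> 'c" where
  "lift_bilinear T f t = (let x = (SOME x. x \<in> t) in
     \<Oplus>\<^bsub>T\<^esub>p\<in>Poly_Mapping.keys x. Poly_Mapping.lookup x p \<odot>\<^bsub>T\<^esub> f (fst p) (snd p))"

definition lift_trilinear ::
  "('k::field, 'd, 'm) module_scheme \<Rightarrow> ('a \<Rightarrow> 'b \<Rightarrow> 'c \<Rightarrow> 'd) \<Rightarrow>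
     ('k, 'a, ('k, 'b, 'c) tensor) tensor \<Rightarrow> 'd" where
  "lift_trilinear T f = lift_bilinear T (\<lambda>a. lift_bilinear T (f a))"

definition tensor_assoc ::
  "('k::field, 'a, 'l) module_scheme \<Rightarrow> ('k, 'b, 'm) module_scheme \<Rightarrow> ('k, 'c, 'n) module_scheme \<Rightarrow>
     ('k, ('k, 'a, 'b) tensor, 'c) tensor \<Rightarrow> ('k, 'a, ('k, 'b, 'c) tensor) tensor" where
  "tensor_assoc U V W =
     (let VW = tensor_product V W; T = tensor_product U VW in
      lift_bilinear T (\<lambda>s w. lift_bilinear T (\<lambda>u v. pure_tensor U VW u (pure_tensor V W v w)) s))"

text \<open>The multiplication \<open>(a \<otimes> b) (a' \<otimes> b') = a a' \<otimes> b b'\<close> on the tensor product of two algebras.\<close>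

definition tensor_mult ::
  "('k::field, 'a, 'm) module_scheme \<Rightarrow> ('k, 'b, 'n) module_scheme \<Rightarrow>
     ('k, 'a, 'b) tensor \<Rightarrow> ('k, 'a, 'b) tensor \<Rightarrow> ('k, 'a, 'b) tensor" where
  "tensor_mult A B s t =
     (let T = tensor_product A B in
      lift_bilinear T (\<lambda>a b. lift_bilinear T
        (\<lambda>a' b'. pure_tensor A B (a \<otimes>\<^bsub>A\<^esub> a') (b \<otimes>\<^bsub>B\<^esub> b')) t) s)"


subsection \<open>Hopf algebras\<close>

record (overloaded) ('k::zero, 'a) hopf_structure = "('k, 'a) module" +
  comult :: "'a \<Rightarrow> ('k, 'a, 'a) tensor"
  counit :: "'a \<Rightarrow> 'k"
  antipode :: "'a \<Rightarrow> 'a"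

definition comult_left ::
  "('k::field, 'a) hopf_structure \<Rightarrow> 'a \<Rightarrow> ('k, ('k, 'a, 'a) tensor, 'a) tensor" where
  "comult_left H h =
     (let HH = tensor_product H H in
      lift_bilinear (tensor_product HH H) (\<lambda>a b. pure_tensor HH H (comult H a) b) (comult H h))"

definition comult_right ::
  "('k::field, 'a) hopf_structure \<Rightarrow> 'a \<Rightarrow> ('k, 'a, ('k, 'a, 'a) tensor) tensor" where
  "comult_right H h =
     (let HH = tensor_product H H in
      lift_bilinear (tensor_product H HH) (\<lambda>a b. pure_tensor H HH a (comult H b)) (comult H h))"

locale hopf_algebra = assoc_algebra scalars H
  for H :: "('k::field, 'a) hopf_structure" (structure) +
  assumes comult_linear: "linear_map H (tensor_product H H) (comult H)"
    and counit_linear: "linear_map H scalar_space (counit H)"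
    and coassoc:
      "h \<in> carrier H \<Longrightarrow> tensor_assoc H H H (comult_left H h) = comult_right H h"
    and counit_left:
      "h \<in> carrier H \<Longrightarrow> lift_bilinear H (\<lambda>a b. counit H a \<odot> b) (comult H h) = h"
    and counit_right:
      "h \<in> carrier H \<Longrightarrow> lift_bilinear H (\<lambda>a b. counit H b \<odot> a) (comult H h) = h"
    and comult_mult:
      "\<lbrakk>g \<in> carrier H; h \<in> carrier H\<rbrakk>
        \<Longrightarrow> comult H (g \<otimes> h) = tensor_mult H H (comult H g) (comult H h)"
    and comult_one: "comult H \<one> = pure_tensor H H \<one> \<one>"
    and counit_mult:
      "\<lbrakk>g \<in> carrier H; h \<in> carrier H\<rbrakk> \<Longrightarrow> counit H (g \<otimes> h) = counit H g * counit H h"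
    and counit_one: "counit H \<one> = 1"
    and antipode_linear: "linear_map H H (antipode H)"
    and antipode_left:
      "h \<in> carrier H \<Longrightarrow>
        lift_bilinear H (\<lambda>a b. antipode H a \<otimes> b) (comult H h) = counit H h \<odot> \<one>"
    and antipode_right:
      "h \<in> carrier H \<Longrightarrow>
        lift_bilinear H (\<lambda>a b. a \<otimes> antipode H b) (comult H h) = counit H h \<odot> \<one>"


subsection \<open>The dual Hopf algebra\<close>

text \<open>
  Functionals are made extensional (\<open>undefined\<close> outside \<open>carrier H\<close>), so that equality of
  elements of the dual is equality on \<open>carrier H\<close>.
\<close>

definition dual_algebra :: "('k::field, 'a) hopf_structure \<Rightarrow> ('k, 'a \<Rightarrow> 'k) module" where
  "dual_algebra H =
     \<lparr>carrier = {f \<in> extensional (carrier H). linear_map H scalar_space f},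
      monoid.mult = (\<lambda>f g. \<lambda>h\<in>carrier H. lift_bilinear scalar_space (\<lambda>a b. f a * g b) (comult H h)),
      one = restrict (counit H) (carrier H),
      zero = (\<lambda>h\<in>carrier H. 0),
      add = (\<lambda>f g. \<lambda>h\<in>carrier H. f h + g h),
      module.smult = (\<lambda>c f. \<lambda>h\<in>carrier H. c * f h)\<rparr>"

text \<open>
  The description below determines an element of \<open>H\<^sup>* \<otimes> H\<^sup>*\<close> uniquely when \<open>H\<close> is finite-dimensional.
\<close>

definition dual_comult ::
  "('k::field, 'a) hopf_structure \<Rightarrow> ('a \<Rightarrow> 'k) \<Rightarrow> ('k, 'a \<Rightarrow> 'k, 'a \<Rightarrow> 'k) tensor" where
  "dual_comult H f =
     (THE t. t \<in> carrier (tensor_product (dual_algebra H) (dual_algebra H)) \<and>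
        (\<forall>a\<in>carrier H. \<forall>b\<in>carrier H.
           lift_bilinear scalar_space (\<lambda>f\<^sub>1 f\<^sub>2. f\<^sub>1 a * f\<^sub>2 b) t = f (a \<otimes>\<^bsub>H\<^esub> b)))"

definition dual_hopf :: "('k::field, 'a) hopf_structure \<Rightarrow> ('k, 'a \<Rightarrow> 'k) hopf_structure" where
  "dual_hopf H = module.extend (dual_algebra H)
     \<lparr>comult = dual_comult H,
      counit = (\<lambda>f. f \<one>\<^bsub>H\<^esub>),
      antipode = (\<lambda>f. \<lambda>h\<in>carrier H. f (antipode H h))\<rparr>"


subsection \<open>The algebra A(H)\<close>

abbreviation antipode_inv :: "('k::field, 'a) hopf_structure \<Rightarrow> 'a \<Rightarrow> 'a" where
  "antipode_inv H \<equiv> inv_into (carrier H) (antipode H)"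

text \<open>
  The right-hand side of the formula for \<open>(f \<otimes> h) (f' \<otimes> h')\<close>, an element of \<open>H\<^sup>* \<otimes> H\<close>; here
  \<open>f\<^sub>i\<close> and \<open>h\<^sub>i\<close> are the Sweedler components of the iterated coproducts of \<open>f'\<close> and \<open>h\<close>.
\<close>

definition A_formula ::
  "('k::field, 'a) hopf_structure \<Rightarrow> ('a \<Rightarrow> 'k) \<Rightarrow> 'a \<Rightarrow> ('a \<Rightarrow> 'k) \<Rightarrow> 'a \<Rightarrow> ('k, 'a \<Rightarrow> 'k, 'a) tensor" where
  "A_formula H f h f' h' =
     (let D = dual_hopf H; T = tensor_product D H in
      lift_trilinear T (\<lambda>f\<^sub>1 f\<^sub>2 f\<^sub>3.
        lift_trilinear T (\<lambda>h\<^sub>1 h\<^sub>2 h\<^sub>3.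
          (f\<^sub>1 (antipode_inv H h\<^sub>3) * f\<^sub>3 (antipode H (antipode H h\<^sub>1)))
            \<odot>\<^bsub>T\<^esub> pure_tensor D H (f \<otimes>\<^bsub>D\<^esub> f\<^sub>2) (h\<^sub>2 \<otimes>\<^bsub>H\<^esub> h'))
        (comult_right H h))
      (comult_right D f'))"

text \<open>
  The vector space \<open>H\<^sup>* \<otimes> H\<close> with the multiplication obtained by extending the formula bilinearly.
\<close>

definition A_algebra ::
  "('k::field, 'a) hopf_structure \<Rightarrow> ('k, ('k, 'a \<Rightarrow> 'k, 'a) tensor) module" where
  "A_algebra H =
     (let D = dual_hopf H; T = tensor_product D H in
      T\<lparr>monoid.mult := (\<lambda>x y. lift_bilinear T (\<lambda>f h. lift_bilinear T (A_formula H f h) y) x),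
        one := pure_tensor D H \<one>\<^bsub>D\<^esub> \<one>\<^bsub>H\<^esub>\<rparr>)"

end

theory Submission
  imports Defs
begin

text \<open>
  Write \<open>f[u, v]\<close> for the functional \<open>x \<mapsto> f (u x v)\<close>.  Since \<open>f\<^sub>1(u) f\<^sub>2(x) f\<^sub>3(v) = f (u x v)\<close>, the
  formula reads \<open>(f \<otimes> h) (f' \<otimes> h') = f f'[S\<inverse>(h\<^sub>3), S\<^sup>2(h\<^sub>1)] \<otimes> h\<^sub>2 h'\<close>.  For associativity, both triple
  products of \<open>f \<otimes> h\<close>, \<open>f' \<otimes> h'\<close> and \<open>f'' \<otimes> h''\<close> become
  \<open>f f'[S\<inverse>(h\<^sub>5), S\<^sup>2(h\<^sub>1)] f''[S\<inverse>(h'\<^sub>3) S\<inverse>(h\<^sub>4), S\<^sup>2(h\<^sub>2) S\<^sup>2(h'\<^sub>1)] \<otimes> h\<^sub>3 h'\<^sub>2 h''\<close>,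
  because \<open>S\<inverse>\<close> reverses products and coproducts while \<open>S\<^sup>2\<close> preserves both.  The two sides are
  compared after pairing with a point of \<open>H\<close> and a functional on \<open>H\<close>, which separates
  \<open>H\<^sup>* \<otimes> H\<close> in finite dimension; all Sweedler sums are therefore sums of scalars.
\<close>

text \<open>That associativity needs no cocommutativity rests on the placement of the antipodes. The
  legs of h reach the functionals in nested pairs: h_1 and h_5 act on f', h_2 and h_4 act on f'',
  and h_3 stays in the middle. One triple product gets this nesting by applying the formula twice.
  In the other, a coproduct is taken of S^-1(v) x S^2(u), and the reversal by S^-1 sends the last
  leg of v to f' together with the first leg of u. So the two sides differ only in the bracketing of
  the legs, never in their order. The formal obstacle is that \<open>lift_bilinear\<close> evaluates
  a map on an arbitrarily chosen representative of a coset. The value is meaningful only once the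
  map is known to be bilinear, and the formula itself nests four such lifts. Hence a functional is
  always pushed inside first, the lifts become the coordinate sums \<open>Sw\<close>, and even the
  bilinearity of the formula is read off from those sums. The rules for S are not axioms of
  \<open>hopf_algebra\<close>: that S reverses products and coproducts is derived from the two
  antipode equations, and then carried over to S^-1 and S^2.\<close>

abbreviation vspace :: "('k::field, 'a, 'm) module_scheme \<Rightarrow> bool" where
  "vspace V \<equiv> module scalars V"

section \<open>Vector spaces over the ground field, linear maps and functionals\<close>

lemma scalars_simps [simp]:
  "carrier (scalars :: 'k::field ring) = UNIV"
  "x \<otimes>\<^bsub>scalars\<^esub> y = x * y"
  "\<one>\<^bsub>scalars\<^esub> = (1 :: 'k)"
  "\<zero>\<^bsub>scalars\<^esub> = (0 :: 'k)"
  "x \<oplus>\<^bsub>scalars\<^esub> y = x + y" for x y :: "'k::field"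
  by (simp_all add: ring_of_type_algebra_def)

text \<open>Negatives need not be supplied: distributivity at \<open>-1 + 1\<close> together with
  the hypothesis on \<open>0 \<odot> x\<close> makes \<open>(-1) \<odot> x\<close> the additive
  inverse of \<open>x\<close>.\<close>

lemma vspaceI:
  fixes V :: "('k::field, 'a, 'm) module_scheme" (structure)
  assumes "\<And>x y. \<lbrakk>x \<in> carrier V; y \<in> carrier V\<rbrakk> \<Longrightarrow> x \<oplus> y \<in> carrier V"
    and "\<zero> \<in> carrier V"
    and sm: "\<And>c x. x \<in> carrier V \<Longrightarrow> c \<odot> x \<in> carrier V"
    and "\<And>x y z. \<lbrakk>x \<in> carrier V; y \<in> carrier V; z \<in> carrier V\<rbrakk> \<Longrightarrow> x \<oplus> y \<oplus> z = x \<oplus> (y \<oplus> z)"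
    and "\<And>x y. \<lbrakk>x \<in> carrier V; y \<in> carrier V\<rbrakk> \<Longrightarrow> x \<oplus> y = y \<oplus> x"
    and "\<And>x. x \<in> carrier V \<Longrightarrow> \<zero> \<oplus> x = x"
    and dl: "\<And>c d x. x \<in> carrier V \<Longrightarrow> (c + d) \<odot> x = c \<odot> x \<oplus> d \<odot> x"
    and "\<And>c x y. \<lbrakk>x \<in> carrier V; y \<in> carrier V\<rbrakk> \<Longrightarrow> c \<odot> (x \<oplus> y) = c \<odot> x \<oplus> c \<odot> y"
    and "\<And>c d x. x \<in> carrier V \<Longrightarrow> (c * d) \<odot> x = c \<odot> (d \<odot> x)"
    and one: "\<And>x. x \<in> carrier V \<Longrightarrow> 1 \<odot> x = x"
    and zero: "\<And>x. x \<in> carrier V \<Longrightarrow> 0 \<odot> x = \<zero>"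
  shows "vspace V"
proof (rule moduleI)
  show "cring (scalars :: 'k ring)" ..
  show "abelian_group V"
  proof (rule abelian_groupI)
    fix x assume x: "x \<in> carrier V"
    have "(-1) \<odot> x \<oplus> x = \<zero>"
      using dl[OF x, of "-1" 1] one[OF x] zero[OF x] by simp
    then show "\<exists>y\<in>carrier V. y \<oplus> x = \<zero>"
      using sm x by blast
  qed (use assms in auto)
qed (use assms in auto)

lemma scalar_space_simps [simp]:
  "carrier (scalar_space :: ('k::field, 'k) module) = UNIV"
  "x \<odot>\<^bsub>scalar_space\<^esub> y = x * y"
  "\<zero>\<^bsub>scalar_space\<^esub> = (0 :: 'k)"
  "x \<oplus>\<^bsub>scalar_space\<^esub> y = x + y" for x y :: "'k::field"
  by (simp_all add: scalar_space_def)

lemma vspace_scalar_space [simp]: "vspace (scalar_space :: ('k::field, 'k) module)"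
  by (rule vspaceI) (auto simp: algebra_simps)

lemma finsum_scalar_space:
  fixes f :: "'x \<Rightarrow> 'k::field"
  shows "finsum scalar_space f A = (if finite A then sum f A else 0)"
proof -
  interpret module scalars "scalar_space :: ('k, 'k) module" by simp
  show ?thesis
  proof (cases "finite A")
    case True
    then show ?thesis by induction auto
  next
    case False
    then show ?thesis by (simp add: finsum_infinite)
  qed
qed

lemma linear_map_closed: "linear_map V W f \<Longrightarrow> x \<in> carrier V \<Longrightarrow> f x \<in> carrier W"
  by (auto simp: linear_map_def)

lemma linear_map_add:
  "\<lbrakk>linear_map V W f; x \<in> carrier V; y \<in> carrier V\<rbrakk> \<Longrightarrow> f (x \<oplus>\<^bsub>V\<^esub> y) = f x \<oplus>\<^bsub>W\<^esub> f y"
  by (auto simp: linear_map_def)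

lemma linear_map_smult:
  "\<lbrakk>linear_map V W f; x \<in> carrier V\<rbrakk> \<Longrightarrow> f (c \<odot>\<^bsub>V\<^esub> x) = c \<odot>\<^bsub>W\<^esub> f x"
  by (auto simp: linear_map_def)

lemma linear_map_zero:
  assumes "vspace V" "vspace W" "linear_map V W f"
  shows "f \<zero>\<^bsub>V\<^esub> = \<zero>\<^bsub>W\<^esub>"
proof -
  interpret V: module scalars V by fact
  interpret W: module scalars W by fact
  have "f (0 \<odot>\<^bsub>V\<^esub> \<zero>\<^bsub>V\<^esub>) = 0 \<odot>\<^bsub>W\<^esub> f \<zero>\<^bsub>V\<^esub>"
    using assms(3) by (rule linear_map_smult) simp
  then show ?thesis
    using V.smult_l_null[of "\<zero>\<^bsub>V\<^esub>"] W.smult_l_null[of "f \<zero>\<^bsub>V\<^esub>"]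
      linear_map_closed[OF assms(3), of "\<zero>\<^bsub>V\<^esub>"] by simp
qed

lemma linear_map_finsum:
  assumes "vspace V" "vspace W" "linear_map V W f" "g \<in> A \<rightarrow> carrier V"
  shows "f (finsum V g A) = finsum W (\<lambda>a. f (g a)) A"
proof -
  interpret V: module scalars V by fact
  interpret W: module scalars W by fact
  have cl: "\<And>x. x \<in> carrier V \<Longrightarrow> f x \<in> carrier W"
    using assms(3) by (rule linear_map_closed)
  show ?thesis
  proof (cases "finite A")
    case True
    then show ?thesis using assms(4)
    proof induction
      case (insert a A)
      then show ?case
        using linear_map_add[OF assms(3), of "g a" "finsum V g A"]
        by (simp add: Pi_iff cl)
    qed (simp add: linear_map_zero[OF assms(1-3)])
  next
    case False
    then show ?thesis
      by (simp add: V.finsum_infinite W.finsum_infinite linear_map_zero[OF assms(1-3)])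
  qed
qed

lemma linear_map_compose:
  "\<lbrakk>linear_map V W f; linear_map U V g\<rbrakk> \<Longrightarrow> linear_map U W (\<lambda>x. f (g x))"
  by (auto simp: linear_map_def Pi_iff)

abbreviation functional :: "('k::field, 'a, 'm) module_scheme \<Rightarrow> ('a \<Rightarrow> 'k) \<Rightarrow> bool" where
  "functional V \<equiv> linear_map V scalar_space"

lemma functional_sum:
  assumes "vspace V" "functional V f" "g \<in> A \<rightarrow> carrier V" "finite A"
  shows "f (finsum V g A) = (\<Sum>a\<in>A. f (g a))"
  using linear_map_finsum[OF assms(1) _ assms(2,3)] assms(4) by (simp add: finsum_scalar_space)

definition bilinear_map ::
  "('k::field, 'a, 'l) module_scheme \<Rightarrow> ('k, 'b, 'm) module_scheme \<Rightarrow> ('k, 'c, 'n) module_scheme \<Rightarrow>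
     ('a \<Rightarrow> 'b \<Rightarrow> 'c) \<Rightarrow> bool" where
  "bilinear_map V W T f \<longleftrightarrow>
     (\<forall>a\<in>carrier V. linear_map W T (f a)) \<and> (\<forall>b\<in>carrier W. linear_map V T (\<lambda>a. f a b))"

subsection \<open>Free spaces and quotients\<close>

lemma lookup_scale [simp]:
  "Poly_Mapping.lookup (Poly_Mapping.map ((*) (c :: 'k::field)) x) p = c * Poly_Mapping.lookup x p"
  by (simp add: Poly_Mapping.map.rep_eq when_def)

lemma keys_scale_subset: "Poly_Mapping.keys (Poly_Mapping.map ((*) (c :: 'k::field)) x) \<subseteq> Poly_Mapping.keys x"
  by (auto simp: in_keys_iff)

lemma free_space_simps [simp]:
  "carrier (free_space S) = {x. Poly_Mapping.keys x \<subseteq> S}"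
  "\<zero>\<^bsub>free_space S\<^esub> = 0"
  "x \<oplus>\<^bsub>free_space S\<^esub> y = x + y"
  "c \<odot>\<^bsub>free_space S\<^esub> x = Poly_Mapping.map ((*) c) x"
  by (simp_all add: free_space_def)

lemma vspace_free_space [simp]: "vspace (free_space S :: ('k::field, 'x \<Rightarrow>\<^sub>0 'k) module)"
proof (rule vspaceI)
  fix c :: 'k and x y z :: "'x \<Rightarrow>\<^sub>0 'k"
  let ?F = "free_space S :: ('k::field, 'x \<Rightarrow>\<^sub>0 'k) module"
  show "x \<oplus>\<^bsub>?F\<^esub> y \<in> carrier ?F" if "x \<in> carrier ?F" "y \<in> carrier ?F"
    using that keys_add[of x y] by auto
  show "c \<odot>\<^bsub>?F\<^esub> x \<in> carrier ?F" if "x \<in> carrier ?F"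
    using that keys_scale_subset[of c x] by auto
qed (auto simp: algebra_simps poly_mapping_eq_iff lookup_add fun_eq_iff)

text \<open>The universal property of the free space, as a function. It is also what
  \<open>lift_bilinear\<close> computes on its chosen representative, so facts about lifts are
  reduced to it.\<close>

definition linear_ext :: "('k::field, 'c, 'm) module_scheme \<Rightarrow> ('x \<Rightarrow> 'c) \<Rightarrow> ('x \<Rightarrow>\<^sub>0 'k) \<Rightarrow> 'c" where
  "linear_ext T f x =
     (\<Oplus>\<^bsub>T\<^esub>p\<in>Poly_Mapping.keys x. Poly_Mapping.lookup x p \<odot>\<^bsub>T\<^esub> f p)"

text \<open>Extra indices have coefficient 0. A common finite index set is needed for additivity,
  because \<open>x\<close>, \<open>y\<close> and \<open>x + y\<close> have different
  supports.\<close>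

lemma linear_ext_superset:
  assumes "vspace T" "finite S" "Poly_Mapping.keys x \<subseteq> S" "f \<in> S \<rightarrow> carrier T"
  shows "linear_ext T f x = (\<Oplus>\<^bsub>T\<^esub>p\<in>S. Poly_Mapping.lookup x p \<odot>\<^bsub>T\<^esub> f p)"
proof -
  interpret T: module scalars T by fact
  have 1: "Poly_Mapping.lookup x i \<odot>\<^bsub>T\<^esub> f i = \<zero>\<^bsub>T\<^esub>" if "i \<in> S - Poly_Mapping.keys x" for i
    using that assms(4) T.smult_l_null[of "f i"] by (auto simp: in_keys_iff)
  show ?thesis unfolding linear_ext_def
    by (rule T.add.finprod_mono_neutral_cong_left)
       (use assms 1 in \<open>auto simp: Pi_iff\<close>)
qed

lemma linear_map_linear_ext:
  fixes T :: "('k::field, 'c, 'm) module_scheme" and S :: "'x set"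
  assumes "vspace T" "f \<in> S \<rightarrow> carrier T"
  shows "linear_map (free_space S) T (linear_ext T f)"
proof -
  interpret T: module scalars T by fact
  have cl: "\<And>p. p \<in> S \<Longrightarrow> f p \<in> carrier T" using assms(2) by auto
  show ?thesis
    unfolding linear_map_def
  proof (intro conjI ballI allI funcsetI)
    fix x :: "'x \<Rightarrow>\<^sub>0 'k" assume "x \<in> carrier (free_space S)"
    then show "linear_ext T f x \<in> carrier T"
      unfolding linear_ext_def by (intro T.finsum_closed funcsetI T.smult_closed) (auto intro: cl)
  next
    fix x y :: "'x \<Rightarrow>\<^sub>0 'k" assume "x \<in> carrier (free_space S)" "y \<in> carrier (free_space S)"
    then have k: "Poly_Mapping.keys x \<subseteq> S" "Poly_Mapping.keys y \<subseteq> S" by auto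
    let ?U = "Poly_Mapping.keys x \<union> Poly_Mapping.keys y"
    have f: "f \<in> ?U \<rightarrow> carrier T" using k cl by auto
    have "linear_ext T f (x + y) = (\<Oplus>\<^bsub>T\<^esub>p\<in>?U. Poly_Mapping.lookup (x + y) p \<odot>\<^bsub>T\<^esub> f p)"
      by (rule linear_ext_superset[OF assms(1) _ _ f]) (auto dest: subsetD[OF keys_add])
    also have "\<dots> = (\<Oplus>\<^bsub>T\<^esub>p\<in>?U. Poly_Mapping.lookup x p \<odot>\<^bsub>T\<^esub> f p \<oplus>\<^bsub>T\<^esub> Poly_Mapping.lookup y p \<odot>\<^bsub>T\<^esub> f p)"
      by (rule T.finsum_cong')
         (use f T.smult_l_distr in \<open>auto simp: lookup_add Pi_iff\<close>)
    also have "\<dots> = (\<Oplus>\<^bsub>T\<^esub>p\<in>?U. Poly_Mapping.lookup x p \<odot>\<^bsub>T\<^esub> f p)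
         \<oplus>\<^bsub>T\<^esub> (\<Oplus>\<^bsub>T\<^esub>p\<in>?U. Poly_Mapping.lookup y p \<odot>\<^bsub>T\<^esub> f p)"
      by (rule T.finsum_addf) (use f in \<open>auto simp: Pi_iff\<close>)
    finally show "linear_ext T f (x \<oplus>\<^bsub>free_space S\<^esub> y) = linear_ext T f x \<oplus>\<^bsub>T\<^esub> linear_ext T f y"
      using linear_ext_superset[OF assms(1) _ _ f, of x] linear_ext_superset[OF assms(1) _ _ f, of y]
      by simp
  next
    fix c and x :: "'x \<Rightarrow>\<^sub>0 'k" assume "x \<in> carrier (free_space S)"
    then have k: "Poly_Mapping.keys x \<subseteq> S" by auto
    then have f: "f \<in> Poly_Mapping.keys x \<rightarrow> carrier T" using cl by auto
    have "linear_ext T f (Poly_Mapping.map ((*) c) x) =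
        (\<Oplus>\<^bsub>T\<^esub>p\<in>Poly_Mapping.keys x. Poly_Mapping.lookup (Poly_Mapping.map ((*) c) x) p \<odot>\<^bsub>T\<^esub> f p)"
      by (rule linear_ext_superset[OF assms(1) _ keys_scale_subset f]) simp
    also have "\<dots> = (\<Oplus>\<^bsub>T\<^esub>p\<in>Poly_Mapping.keys x. c \<odot>\<^bsub>T\<^esub> (Poly_Mapping.lookup x p \<odot>\<^bsub>T\<^esub> f p))"
      by (rule T.finsum_cong')
         (use f T.smult_assoc1 in \<open>auto simp: Pi_iff\<close>)
    also have "\<dots> = c \<odot>\<^bsub>T\<^esub> linear_ext T f x"
      unfolding linear_ext_def
      by (rule T.finsum_smult_ldistr[symmetric]) (use f in \<open>auto simp: Pi_iff\<close>)
    finally show "linear_ext T f (c \<odot>\<^bsub>free_space S\<^esub> x) = c \<odot>\<^bsub>T\<^esub> linear_ext T f x" by simp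
  qed
qed

lemma linear_ext_single:
  assumes "vspace T" "f p \<in> carrier T"
  shows "linear_ext T f (Poly_Mapping.single p c) = c \<odot>\<^bsub>T\<^esub> f p"
proof -
  interpret T: module scalars T by fact
  show ?thesis
    using linear_ext_superset[OF assms(1), of "{p}" "Poly_Mapping.single p c" f] assms(2)
    by (simp add: Pi_iff)
qed

lemma free_space_induct [consumes 1, case_names zero single add]:
  assumes "Poly_Mapping.keys x \<subseteq> S"
    and "P 0"
    and "\<And>c p. p \<in> S \<Longrightarrow> P (Poly_Mapping.single p c)"
    and "\<And>x y. \<lbrakk>Poly_Mapping.keys x \<subseteq> S; Poly_Mapping.keys y \<subseteq> S; P x; P y\<rbrakk> \<Longrightarrow> P (x + y)"
  shows "P x"
  using assms(1)
proof (induction "card (Poly_Mapping.keys x)" arbitrary: x)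
  case 0
  then have "x = 0" by (auto simp: poly_mapping_eq_iff fun_eq_iff in_keys_iff)
  then show ?case using assms(2) by simp
next
  case (Suc n)
  then obtain p where p: "p \<in> Poly_Mapping.keys x" by fastforce
  let ?c = "Poly_Mapping.lookup x p"
  \<comment> \<open>Resetting the coefficient at \<open>p\<close> to 0 removes exactly one key, so
    the induction hypothesis applies to the rest.\<close>
  let ?y = "Poly_Mapping.update p 0 x"
  have k: "Poly_Mapping.keys ?y = Poly_Mapping.keys x - {p}" by (simp add: keys_update)
  have x: "x = Poly_Mapping.single p ?c + ?y"
    by (rule poly_mapping_eqI) (auto simp: lookup_add lookup_update lookup_single when_def)
  have "P ?y" using Suc p k by (intro Suc(1)) auto
  then show ?case
    using Suc.prems p k by (subst x, intro assms(4) assms(3)) auto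
qed

lemma submodule_generated_subspace:
  assumes "vspace V" "G \<subseteq> carrier V"
  shows "submodule (generated_subspace V G) scalars V" "G \<subseteq> generated_subspace V G"
proof -
  interpret V: module scalars V by fact
  have c: "submodule (carrier V) scalars V" by (rule V.carrier_is_submodule)
  show "submodule (generated_subspace V G) scalars V"
  proof (rule V.submoduleI)
    show "generated_subspace V G \<subseteq> carrier V"
      using c assms(2) by (auto simp: generated_subspace_def)
    show "\<zero>\<^bsub>V\<^esub> \<in> generated_subspace V G"
      by (auto simp: generated_subspace_def submodule_def dest: subgroup.one_closed)
  qed (use V.submoduleE in \<open>auto simp: generated_subspace_def\<close>)
  show "G \<subseteq> generated_subspace V G" by (auto simp: generated_subspace_def)
qed

lemma generated_subspace_least:
  "\<lbrakk>submodule U scalars V; G \<subseteq> U\<rbrakk> \<Longrightarrow> generated_subspace V G \<subseteq> U"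
  by (auto simp: generated_subspace_def)

text \<open>Combined with \<open>generated_subspace_least\<close>, this shows that a linear map that
  kills generators kills the subspace that they generate.\<close>

lemma submodule_kernel:
  assumes "vspace V" "vspace W" "linear_map V W f"
  shows "submodule {x \<in> carrier V. f x = \<zero>\<^bsub>W\<^esub>} scalars V"
proof -
  interpret V: module scalars V by fact
  interpret W: module scalars W by fact
  have neg: "f (\<ominus>\<^bsub>V\<^esub> a) = \<zero>\<^bsub>W\<^esub>" if "a \<in> carrier V" "f a = \<zero>\<^bsub>W\<^esub>" for a
    using that linear_map_add[OF assms(3), of a "\<ominus>\<^bsub>V\<^esub> a"] linear_map_zero[OF assms]
      linear_map_closed[OF assms(3), of "\<ominus>\<^bsub>V\<^esub> a"] by (simp add: V.r_neg)
  show ?thesis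
    by (rule V.submoduleI)
       (auto simp: linear_map_zero[OF assms] linear_map_add[OF assms(3)]
          linear_map_smult[OF assms(3)] neg)
qed

context
  fixes V :: "('k::field, 'a, 'm) module_scheme" and N
  assumes V: "vspace V" and N: "submodule N scalars V"
begin

interpretation V: module scalars V by (rule V)

lemma submodule_subgroup: "subgroup N (add_monoid V)"
  using N by (rule submodule.axioms)

lemma submodule_subset: "N \<subseteq> carrier V"
  using V.submoduleE(1)[OF N] .

interpretation N: abelian_subgroup N V
  by (rule abelian_subgroupI3) (auto intro: additive_subgroupI submodule_subgroup V.abelian_group_axioms)

lemma quotient_space_carrier: "carrier (quotient_space V N) = (\<lambda>x. N +>\<^bsub>V\<^esub> x) ` carrier V"
  by (auto simp: quotient_space_def A_RCOSETS_def')

lemma coset_repr: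
  assumes "x \<in> carrier V" "y \<in> N +>\<^bsub>V\<^esub> x"
  shows "y \<in> carrier V" "N +>\<^bsub>V\<^esub> y = N +>\<^bsub>V\<^esub> x"
  using V.a_r_coset_subset_G[OF submodule_subset assms(1)] assms(2) apply blast
  using V.a_repr_independence[OF assms(2,1) submodule_subgroup] by simp

lemma coset_refl: "x \<in> carrier V \<Longrightarrow> x \<in> N +>\<^bsub>V\<^esub> x"
  by (rule N.a_rcos_self)

lemma quotient_space_add:
  "\<lbrakk>x \<in> carrier V; y \<in> carrier V\<rbrakk> \<Longrightarrow>
     (N +>\<^bsub>V\<^esub> x) \<oplus>\<^bsub>quotient_space V N\<^esub> (N +>\<^bsub>V\<^esub> y) = N +>\<^bsub>V\<^esub> (x \<oplus>\<^bsub>V\<^esub> y)"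
  by (simp add: quotient_space_def N.a_rcos_sum)

text \<open>The quotient scales a coset by a union over all of its members; since \<open>N\<close>
  is closed under scaling, every member contributes the same coset.\<close>

lemma quotient_space_smult:
  assumes "x \<in> carrier V"
  shows "c \<odot>\<^bsub>quotient_space V N\<^esub> (N +>\<^bsub>V\<^esub> x) = N +>\<^bsub>V\<^esub> (c \<odot>\<^bsub>V\<^esub> x)"
proof -
  have "N +>\<^bsub>V\<^esub> (c \<odot>\<^bsub>V\<^esub> y) = N +>\<^bsub>V\<^esub> (c \<odot>\<^bsub>V\<^esub> x)" if y: "y \<in> N +>\<^bsub>V\<^esub> x" for y
  proof -
    obtain n where n: "n \<in> N" "y = n \<oplus>\<^bsub>V\<^esub> x" using y by (auto simp: a_r_coset_def')
    have "c \<odot>\<^bsub>V\<^esub> y = c \<odot>\<^bsub>V\<^esub> n \<oplus>\<^bsub>V\<^esub> c \<odot>\<^bsub>V\<^esub> x"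
      using n submodule_subset assms by (auto simp: V.smult_r_distr)
    moreover have "c \<odot>\<^bsub>V\<^esub> n \<in> N" using V.submoduleE(4)[OF N] n by simp
    ultimately have "c \<odot>\<^bsub>V\<^esub> y \<in> N +>\<^bsub>V\<^esub> (c \<odot>\<^bsub>V\<^esub> x)" by (auto simp: a_r_coset_def')
    then show ?thesis using coset_repr(2)[of "c \<odot>\<^bsub>V\<^esub> x"] assms by simp
  qed
  moreover have "x \<in> N +>\<^bsub>V\<^esub> x" using assms by (rule coset_refl)
  ultimately have "(\<Union>y\<in>N +>\<^bsub>V\<^esub> x. N +>\<^bsub>V\<^esub> (c \<odot>\<^bsub>V\<^esub> y)) = N +>\<^bsub>V\<^esub> (c \<odot>\<^bsub>V\<^esub> x)"
    by blast
  then show ?thesis by (simp add: quotient_space_def)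
qed

lemma quotient_space_zero: "\<zero>\<^bsub>quotient_space V N\<^esub> = N +>\<^bsub>V\<^esub> \<zero>\<^bsub>V\<^esub>"
  by (simp add: quotient_space_def V.a_coset_add_zero submodule_subset)

lemma vspace_quotient_space: "vspace (quotient_space V N)"
proof -
  \<comment> \<open>Once every element is presented as \<open>\<pi> x\<close>, the operations move
    inside \<open>\<pi>\<close> and each axiom becomes the same axiom of \<open>V\<close>.\<close>
  define Q where "Q = quotient_space V N"
  define \<pi> where "\<pi> x = N +>\<^bsub>V\<^esub> x" for x
  have q: "carrier Q = \<pi> ` carrier V" "\<zero>\<^bsub>Q\<^esub> = \<pi> \<zero>\<^bsub>V\<^esub>"
    "\<And>x y. \<lbrakk>x \<in> carrier V; y \<in> carrier V\<rbrakk> \<Longrightarrow> \<pi> x \<oplus>\<^bsub>Q\<^esub> \<pi> y = \<pi> (x \<oplus>\<^bsub>V\<^esub> y)"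
    "\<And>c x. x \<in> carrier V \<Longrightarrow> c \<odot>\<^bsub>Q\<^esub> \<pi> x = \<pi> (c \<odot>\<^bsub>V\<^esub> x)"
    unfolding Q_def \<pi>_def
    by (rule quotient_space_carrier quotient_space_zero quotient_space_add quotient_space_smult;
        assumption)+
  have "vspace Q"
    by (rule vspaceI)
       (auto simp: q V.a_ac V.smult_r_distr V.smult_l_distr[simplified]
          V.smult_assoc1[simplified] V.smult_one[simplified] V.smult_l_null[simplified])
  then show ?thesis by (simp add: Q_def)
qed

lemma linear_map_quotient: "linear_map V (quotient_space V N) (\<lambda>x. N +>\<^bsub>V\<^esub> x)"
  by (auto simp: linear_map_def quotient_space_carrier quotient_space_add quotient_space_smult)

end

lemma bilinear_mapI:
  assumes "\<And>a b. \<lbrakk>a \<in> carrier V; b \<in> carrier W\<rbrakk> \<Longrightarrow> f a b \<in> carrier T"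
    and "\<And>a b b'. \<lbrakk>a \<in> carrier V; b \<in> carrier W; b' \<in> carrier W\<rbrakk> \<Longrightarrow> f a (b \<oplus>\<^bsub>W\<^esub> b') = f a b \<oplus>\<^bsub>T\<^esub> f a b'"
    and "\<And>a a' b. \<lbrakk>a \<in> carrier V; a' \<in> carrier V; b \<in> carrier W\<rbrakk> \<Longrightarrow> f (a \<oplus>\<^bsub>V\<^esub> a') b = f a b \<oplus>\<^bsub>T\<^esub> f a' b"
    and "\<And>c a b. \<lbrakk>a \<in> carrier V; b \<in> carrier W\<rbrakk> \<Longrightarrow> f a (c \<odot>\<^bsub>W\<^esub> b) = c \<odot>\<^bsub>T\<^esub> f a b"
    and "\<And>c a b. \<lbrakk>a \<in> carrier V; b \<in> carrier W\<rbrakk> \<Longrightarrow> f (c \<odot>\<^bsub>V\<^esub> a) b = c \<odot>\<^bsub>T\<^esub> f a b"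
  shows "bilinear_map V W T f"
  using assms by (auto simp: bilinear_map_def linear_map_def Pi_iff)

lemma bilinear_mapD:
  assumes "bilinear_map V W T f"
  shows "\<lbrakk>a \<in> carrier V; b \<in> carrier W\<rbrakk> \<Longrightarrow> f a b \<in> carrier T"
    and "\<lbrakk>a \<in> carrier V; b \<in> carrier W; b' \<in> carrier W\<rbrakk> \<Longrightarrow> f a (b \<oplus>\<^bsub>W\<^esub> b') = f a b \<oplus>\<^bsub>T\<^esub> f a b'"
    and "\<lbrakk>a \<in> carrier V; a' \<in> carrier V; b \<in> carrier W\<rbrakk> \<Longrightarrow> f (a \<oplus>\<^bsub>V\<^esub> a') b = f a b \<oplus>\<^bsub>T\<^esub> f a' b"
    and "\<lbrakk>a \<in> carrier V; b \<in> carrier W\<rbrakk> \<Longrightarrow> f a (c \<odot>\<^bsub>W\<^esub> b) = c \<odot>\<^bsub>T\<^esub> f a b"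
    and "\<lbrakk>a \<in> carrier V; b \<in> carrier W\<rbrakk> \<Longrightarrow> f (c \<odot>\<^bsub>V\<^esub> a) b = c \<odot>\<^bsub>T\<^esub> f a b"
  using assms by (auto simp: bilinear_map_def linear_map_def Pi_iff)

lemma bilinear_map_linear:
  assumes "bilinear_map V W T f"
  shows "a \<in> carrier V \<Longrightarrow> linear_map W T (f a)"
    and "b \<in> carrier W \<Longrightarrow> linear_map V T (\<lambda>a. f a b)"
  using assms by (auto simp: bilinear_map_def)

subsection \<open>Tensor products\<close>

lemma lift_bilinear_linear_ext:
  "lift_bilinear T f t = linear_ext T (\<lambda>p. f (fst p) (snd p)) (SOME x. x \<in> t)"
  by (simp add: lift_bilinear_def linear_ext_def Let_def)

lemma lift_bilinear_scalar:
  "lift_bilinear scalar_space f t =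
     (let x = (SOME x. x \<in> t) in
      \<Sum>p\<in>Poly_Mapping.keys x. Poly_Mapping.lookup x p * f (fst p) (snd p))"
  by (simp add: lift_bilinear_def finsum_scalar_space)

text \<open>Both sides use the same chosen representative of \<open>t\<close>, so additivity in the
  integrand is additivity of one finite sum, whatever \<open>f\<close> and \<open>g\<close> are. The
  next two lemmas hold for the same reason.\<close>

lemma lift_scalar_add:
  "lift_bilinear scalar_space (\<lambda>a b. f a b + g a b) t =
     lift_bilinear scalar_space f t + lift_bilinear scalar_space g t"
  by (simp add: lift_bilinear_scalar Let_def algebra_simps sum.distrib)

lemma lift_scalar_mult:
  "lift_bilinear scalar_space (\<lambda>a b. c * f a b) t = c * lift_bilinear scalar_space f t"
  by (simp add: lift_bilinear_scalar Let_def algebra_simps sum_distrib_left)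

lemma lift_scalar_sum:
  "lift_bilinear scalar_space (\<lambda>a b. \<Sum>i\<in>I. f i a b) t =
     (\<Sum>i\<in>I. lift_bilinear scalar_space (f i) t)"
  by (simp add: lift_bilinear_scalar Let_def sum_distrib_left sum.swap[of _ I])

context
  fixes V :: "('k::field, 'a, 'm) module_scheme" and W :: "('k, 'b, 'n) module_scheme"
  assumes V: "vspace V" and W: "vspace W"
begin

interpretation V: module scalars V by (rule V)
interpretation W: module scalars W by (rule W)

abbreviation (input) "free_pairs \<equiv> free_space (carrier V \<times> carrier W) :: ('k, 'a \<times> 'b \<Rightarrow>\<^sub>0 'k) module"

lemma bilinearity_relations_subset: "bilinearity_relations V W \<subseteq> carrier free_pairs"
proof -
  define F where "F = carrier free_pairs"
  have "x - y \<in> F" if "x \<in> F" "y \<in> F" for x y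
    using that keys_diff[of x y] by (auto simp: F_def)
  moreover have "Poly_Mapping.single (a, b) c \<in> F" if "a \<in> carrier V" "b \<in> carrier W" for a b c
    using that by (simp add: F_def)
  ultimately have "bilinearity_relations V W \<subseteq> F"
    unfolding bilinearity_relations_def Let_def by auto
  then show ?thesis by (simp add: F_def)
qed

lemma submodule_null_tensors: "submodule (null_tensors V W) scalars free_pairs"
  and null_tensors_relations: "bilinearity_relations V W \<subseteq> null_tensors V W"
  unfolding null_tensors_def
  by (rule submodule_generated_subspace vspace_free_space bilinearity_relations_subset)+

lemma vspace_tensor_product: "vspace (tensor_product V W)"
  unfolding tensor_product_def by (rule vspace_quotient_space[OF vspace_free_space submodule_null_tensors])

interpretation F: module scalars free_pairs by simp
interpretation T: module scalars "tensor_product V W" by (rule vspace_tensor_product)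

abbreviation (input) "null_coset x \<equiv> null_tensors V W +>\<^bsub>free_pairs\<^esub> x"

lemma tensor_carrier: "carrier (tensor_product V W) = null_coset ` carrier free_pairs"
  unfolding tensor_product_def by (rule quotient_space_carrier[OF vspace_free_space submodule_null_tensors])

lemma linear_map_null_coset: "linear_map free_pairs (tensor_product V W) (\<lambda>x. null_coset x)"
  unfolding tensor_product_def by (rule linear_map_quotient[OF vspace_free_space submodule_null_tensors])

lemma null_coset_eqI:
  assumes "x \<in> carrier free_pairs" "y \<in> carrier free_pairs" "x - y \<in> null_tensors V W"
  shows "null_coset x = null_coset y"
proof -
  have "x \<in> null_coset y"
    using assms(3) unfolding a_r_coset_def' by (auto intro!: bexI[OF _ assms(3)])
  then show ?thesis by (rule coset_repr(2)[OF vspace_free_space submodule_null_tensors assms(2)])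
qed

text \<open>A coset contains the element that defines it, so the choice made in
  \<open>lift_bilinear\<close> does return a representative of \<open>t\<close>.\<close>

lemma tensor_repr:
  assumes "t \<in> carrier (tensor_product V W)"
  shows "(SOME x. x \<in> t) \<in> carrier free_pairs" "null_coset (SOME x. x \<in> t) = t"
proof -
  obtain x where x: "x \<in> carrier free_pairs" "t = null_coset x" using assms tensor_carrier by auto
  have "x \<in> t" using coset_refl[OF vspace_free_space submodule_null_tensors x(1)] x by simp
  then have "(SOME x. x \<in> t) \<in> t" by (rule someI)
  then show "(SOME x. x \<in> t) \<in> carrier free_pairs" "null_coset (SOME x. x \<in> t) = t"
    using coset_repr[OF vspace_free_space submodule_null_tensors x(1)] x by auto
qed

lemma lift_bilinear_closed:
  assumes "vspace T" "\<And>a b. \<lbrakk>a \<in> carrier V; b \<in> carrier W\<rbrakk> \<Longrightarrow> f a b \<in> carrier T"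
    and "t \<in> carrier (tensor_product V W)"
  shows "lift_bilinear T f t \<in> carrier T"
  unfolding lift_bilinear_linear_ext
  using linear_map_linear_ext[OF assms(1)] tensor_repr(1)[OF assms(3)]
  by (rule linear_map_closed) (use assms in auto)

lemma lift_bilinear_cong:
  assumes "\<And>a b. \<lbrakk>a \<in> carrier V; b \<in> carrier W\<rbrakk> \<Longrightarrow> f a b = g a b"
    and "vspace T" "\<And>a b. \<lbrakk>a \<in> carrier V; b \<in> carrier W\<rbrakk> \<Longrightarrow> g a b \<in> carrier T"
    and "t \<in> carrier (tensor_product V W)"
  shows "lift_bilinear T f t = lift_bilinear T g t"
proof -
  interpret T': module scalars T by fact
  have "Poly_Mapping.keys (SOME x. x \<in> t) \<subseteq> carrier V \<times> carrier W"
    using tensor_repr(1)[OF assms(4)] by simp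
  then show ?thesis unfolding lift_bilinear_def Let_def
    by (intro T'.finsum_cong') (use assms(1,3) in \<open>auto intro!: T'.smult_closed\<close>)
qed

text \<open>Only one representative of \<open>t\<close> is involved, so this is linearity of
  \<open>L\<close> on a finite sum and \<open>f\<close> may be any function into \<open>T\<close>.
  This is how functionals enter nested lifts before bilinearity of the integrand has been
  established.\<close>

lemma linear_map_lift:
  assumes "vspace T" "vspace U" "linear_map T U L"
    and "\<And>a b. \<lbrakk>a \<in> carrier V; b \<in> carrier W\<rbrakk> \<Longrightarrow> f a b \<in> carrier T"
    and "t \<in> carrier (tensor_product V W)"
  shows "L (lift_bilinear T f t) = lift_bilinear U (\<lambda>a b. L (f a b)) t"
proof -
  interpret T': module scalars T by fact
  interpret U': module scalars U by fact
  have k: "Poly_Mapping.keys (SOME x. x \<in> t) \<subseteq> carrier V \<times> carrier W"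
    using tensor_repr(1)[OF assms(5)] by simp
  have "L (lift_bilinear T f t) = (\<Oplus>\<^bsub>U\<^esub>p\<in>Poly_Mapping.keys (SOME x. x \<in> t).
      L (Poly_Mapping.lookup (SOME x. x \<in> t) p \<odot>\<^bsub>T\<^esub> f (fst p) (snd p)))"
    unfolding lift_bilinear_def Let_def
    by (rule linear_map_finsum[OF assms(1-3)]) (use k assms(4) in \<open>auto intro!: T'.smult_closed\<close>)
  also have "\<dots> = lift_bilinear U (\<lambda>a b. L (f a b)) t"
    unfolding lift_bilinear_def Let_def
    by (rule U'.finsum_cong')
       (use k assms(4) in \<open>auto intro!: U'.smult_closed linear_map_closed[OF assms(3)] linear_map_smult[OF assms(3)]\<close>)
  finally show ?thesis .
qed

lemma pure_tensor_closed [intro, simp]: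
  "\<lbrakk>a \<in> carrier V; b \<in> carrier W\<rbrakk> \<Longrightarrow> pure_tensor V W a b \<in> carrier (tensor_product V W)"
  unfolding pure_tensor_def tensor_carrier by (rule imageI) auto

lemma bilinear_map_pure_tensor: "bilinear_map V W (tensor_product V W) (pure_tensor V W)"
proof (rule bilinear_mapI)
  let ?e = "\<lambda>a b. Poly_Mapping.single (a, b) (1 :: 'k)"
  have add: "null_coset x \<oplus>\<^bsub>tensor_product V W\<^esub> null_coset y = null_coset (x + y)"
    if "x \<in> carrier free_pairs" "y \<in> carrier free_pairs" for x y
    using linear_map_add[OF linear_map_null_coset that] by simp
  have smult: "c \<odot>\<^bsub>tensor_product V W\<^esub> null_coset x = null_coset (Poly_Mapping.map ((*) c) x)"
    if "x \<in> carrier free_pairs" for c x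
    using linear_map_smult[OF linear_map_null_coset that] by simp
  have e: "Poly_Mapping.single (a, b) c \<in> carrier free_pairs"
    if "a \<in> carrier V" "b \<in> carrier W" for a b and c :: 'k
    using that by simp
  have e2: "x + y \<in> carrier free_pairs" if "x \<in> carrier free_pairs" "y \<in> carrier free_pairs" for x y
    using F.a_closed[OF that] by simp
  \<comment> \<open>The generating relations carry the scalar inside \<open>single (a, b) c\<close>,
    not as a multiple of the basis element.\<close>
  have sm: "Poly_Mapping.map ((*) c) (?e a b) = Poly_Mapping.single (a, b) c" for a b c
    by (rule poly_mapping_eqI) (simp add: lookup_single when_def)
  note R = subsetD[OF null_tensors_relations]
  fix a b c assume ab: "a \<in> carrier V" "b \<in> carrier W"
  show "pure_tensor V W a b \<in> carrier (tensor_product V W)" using ab by simp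
  show "pure_tensor V W a (b \<oplus>\<^bsub>W\<^esub> b') =
      pure_tensor V W a b \<oplus>\<^bsub>tensor_product V W\<^esub> pure_tensor V W a b'" if b': "b' \<in> carrier W" for b'
    unfolding pure_tensor_def add[OF e[OF ab] e[OF ab(1) b']]
  proof (rule null_coset_eqI[OF e e2[OF e e]])
    show "?e a (b \<oplus>\<^bsub>W\<^esub> b') - (?e a b + ?e a b') \<in> null_tensors V W"
      unfolding diff_diff_eq[symmetric]
      by (rule R) (use ab b' in \<open>auto simp: bilinearity_relations_def Let_def\<close>)
  qed (use ab b' in auto)
  show "pure_tensor V W a (c \<odot>\<^bsub>W\<^esub> b) = c \<odot>\<^bsub>tensor_product V W\<^esub> pure_tensor V W a b"
    unfolding pure_tensor_def smult[OF e[OF ab]] sm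
  proof (rule null_coset_eqI[OF e e])
    show "?e a (c \<odot>\<^bsub>W\<^esub> b) - Poly_Mapping.single (a, b) c \<in> null_tensors V W"
      by (rule R) (use ab in \<open>auto simp: bilinearity_relations_def Let_def\<close>)
  qed (use ab in auto)
  show "pure_tensor V W (c \<odot>\<^bsub>V\<^esub> a) b = c \<odot>\<^bsub>tensor_product V W\<^esub> pure_tensor V W a b"
    unfolding pure_tensor_def smult[OF e[OF ab]] sm
  proof (rule null_coset_eqI[OF e e])
    show "?e (c \<odot>\<^bsub>V\<^esub> a) b - Poly_Mapping.single (a, b) c \<in> null_tensors V W"
      by (rule R) (use ab in \<open>auto simp: bilinearity_relations_def Let_def\<close>)
  qed (use ab in auto)
  show "pure_tensor V W (a \<oplus>\<^bsub>V\<^esub> a') b =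
      pure_tensor V W a b \<oplus>\<^bsub>tensor_product V W\<^esub> pure_tensor V W a' b" if a': "a' \<in> carrier V" for a'
    unfolding pure_tensor_def add[OF e[OF ab] e[OF a' ab(2)]]
  proof (rule null_coset_eqI[OF e e2[OF e e]])
    show "?e (a \<oplus>\<^bsub>V\<^esub> a') b - (?e a b + ?e a' b) \<in> null_tensors V W"
      unfolding diff_diff_eq[symmetric]
      by (rule R) (use ab a' in \<open>auto simp: bilinearity_relations_def Let_def\<close>)
  qed (use ab a' in auto)
qed

text \<open>Well-definedness of the lift. Bilinearity puts the generating relations into the kernel
  of the linear extension, hence all null tensors too, and the chosen representative differs from
  \<open>x\<close> by a null tensor.\<close>

lemma lift_bilinear_null_coset:
  assumes T: "vspace T" and f: "bilinear_map V W T f" and x: "x \<in> carrier free_pairs"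
  shows "lift_bilinear T f (null_coset x) = linear_ext T (\<lambda>p. f (fst p) (snd p)) x"
proof -
  let ?E = "linear_ext T (\<lambda>p. f (fst p) (snd p)) :: ('a \<times> 'b \<Rightarrow>\<^sub>0 'k) \<Rightarrow> _"
  interpret T': module scalars T by fact
  have cl: "f a b \<in> carrier T" if "a \<in> carrier V" "b \<in> carrier W" for a b
    using bilinear_mapD(1)[OF f that] .
  have E: "linear_map free_pairs T ?E"
    by (rule linear_map_linear_ext[OF T]) (auto intro: cl)
  let ?K = "{x \<in> carrier free_pairs. ?E x = \<zero>\<^bsub>T\<^esub>}"
  have K: "submodule ?K scalars free_pairs"
    by (rule submodule_kernel[OF vspace_free_space T E])
  have single: "?E (Poly_Mapping.single (a, b) c) = c \<odot>\<^bsub>T\<^esub> f a b"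
    if "a \<in> carrier V" "b \<in> carrier W" for a b c
    using linear_ext_single[OF T, of "\<lambda>p. f (fst p) (snd p)" "(a, b)" c] that cl by simp
  have diff: "?E (x - y) = ?E x \<ominus>\<^bsub>T\<^esub> ?E y" if "x \<in> carrier free_pairs" "y \<in> carrier free_pairs" for x y
  proof -
    have xy: "x - y \<in> carrier free_pairs" using that keys_diff[of x y] by auto
    have "?E x = ?E ((x - y) + y)" by simp
    also have "\<dots> = ?E (x - y) \<oplus>\<^bsub>T\<^esub> ?E y"
      using linear_map_add[OF E xy that(2)] by simp
    finally show ?thesis
      using linear_map_closed[OF E xy] linear_map_closed[OF E that(2)]
      by (simp add: T'.minus_eq T'.a_assoc T'.r_neg)
  qed
  have sgl: "Poly_Mapping.single (a, b) c \<in> carrier free_pairs"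
    if "a \<in> carrier V" "b \<in> carrier W" for a b and c :: 'k using that by simp
  have dcl: "x - y \<in> carrier free_pairs" if "x \<in> carrier free_pairs" "y \<in> carrier free_pairs" for x y
    using that keys_diff[of x y] by auto
  have "bilinearity_relations V W \<subseteq> ?K"
  proof
    fix r assume r: "r \<in> bilinearity_relations V W"
    have cancel: "u \<oplus>\<^bsub>T\<^esub> v \<ominus>\<^bsub>T\<^esub> u \<ominus>\<^bsub>T\<^esub> v = \<zero>\<^bsub>T\<^esub>"
      if "u \<in> carrier T" "v \<in> carrier T" for u v
      using that T'.r_neg[of "u \<oplus>\<^bsub>T\<^esub> v"] by (auto simp: T'.minus_eq T'.minus_add T'.a_assoc T'.r_neg)
    have cancel': "u \<ominus>\<^bsub>T\<^esub> u = \<zero>\<^bsub>T\<^esub>" if "u \<in> carrier T" for u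
      using that by (simp add: T'.minus_eq T'.r_neg)
    have "?E r = \<zero>\<^bsub>T\<^esub>"
      using r unfolding bilinearity_relations_def Let_def
      by (auto simp: diff single sgl dcl cl cancel cancel' T'.smult_one[simplified]
          bilinear_mapD[OF f] simp del: free_space_simps)
    then show "r \<in> ?K" using r bilinearity_relations_subset by auto
  qed
  then have null: "null_tensors V W \<subseteq> ?K"
    unfolding null_tensors_def by (intro generated_subspace_least K)
  have px: "null_coset x \<in> carrier (tensor_product V W)" using x tensor_carrier by auto
  let ?y = "SOME y. y \<in> null_coset x"
  have "?y \<in> null_coset x"
    using coset_refl[OF vspace_free_space submodule_null_tensors x] by (rule someI)
  then obtain n where n: "n \<in> null_tensors V W" "?y = n + x" by (auto simp: a_r_coset_def')
  then have n': "n \<in> carrier free_pairs" "?E n = \<zero>\<^bsub>T\<^esub>" using null by auto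
  have "?E ?y = ?E x"
    using linear_map_add[OF E n'(1) x] n(2) n'(2) linear_map_closed[OF E x] by simp
  then show ?thesis unfolding lift_bilinear_linear_ext .
qed

lemma lift_bilinear_pure:
  assumes T: "vspace T" and f: "bilinear_map V W T f" and "a \<in> carrier V" "b \<in> carrier W"
  shows "lift_bilinear T f (pure_tensor V W a b) = f a b"
proof -
  interpret T': module scalars T by fact
  show ?thesis
    unfolding pure_tensor_def
    using assms bilinear_mapD(1)[OF f] T'.smult_one[simplified]
    by (subst lift_bilinear_null_coset) (auto simp: linear_ext_single[OF T])
qed

lemma linear_map_lift_bilinear:
  assumes T: "vspace T" and f: "bilinear_map V W T f"
  shows "linear_map (tensor_product V W) T (lift_bilinear T f)"
proof -
  let ?E = "linear_ext T (\<lambda>p. f (fst p) (snd p)) :: ('a \<times> 'b \<Rightarrow>\<^sub>0 'k) \<Rightarrow> _"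
  have E: "linear_map free_pairs T ?E"
    by (rule linear_map_linear_ext[OF T]) (auto intro: bilinear_mapD(1)[OF f])
  have cl: "x + y \<in> carrier free_pairs" "Poly_Mapping.map ((*) c) x \<in> carrier free_pairs"
    if "x \<in> carrier free_pairs" "y \<in> carrier free_pairs" for x y c
    using F.a_closed[OF that] F.smult_closed[of c x] that by auto
  have P: "null_coset x \<oplus>\<^bsub>tensor_product V W\<^esub> null_coset y = null_coset (x + y)" "?E (x + y) = ?E x \<oplus>\<^bsub>T\<^esub> ?E y"
    if "x \<in> carrier free_pairs" "y \<in> carrier free_pairs" for x y
    using linear_map_add[OF linear_map_null_coset that] linear_map_add[OF E that] by simp_all
  have Q: "c \<odot>\<^bsub>tensor_product V W\<^esub> null_coset x = null_coset (Poly_Mapping.map ((*) c) x)"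
    "?E (Poly_Mapping.map ((*) c) x) = c \<odot>\<^bsub>T\<^esub> ?E x"
    if "x \<in> carrier free_pairs" for x c
    using linear_map_smult[OF linear_map_null_coset that] linear_map_smult[OF E that] by simp_all
  show ?thesis
    unfolding linear_map_def tensor_carrier
    by (auto simp: P Q lift_bilinear_null_coset[OF T f] cl linear_map_closed[OF E]
        simp del: free_space_simps(1))
qed

text \<open>Pure tensors span: a representative is built from multiples of single pairs by addition,
  and both maps respect these operations.\<close>

lemma tensor_linear_eqI:
  assumes T: "vspace T" and f: "linear_map (tensor_product V W) T f" and g: "linear_map (tensor_product V W) T g"
    and eq: "\<And>a b. \<lbrakk>a \<in> carrier V; b \<in> carrier W\<rbrakk> \<Longrightarrow> f (pure_tensor V W a b) = g (pure_tensor V W a b)"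
    and t: "t \<in> carrier (tensor_product V W)"
  shows "f t = g t"
proof -
  obtain x where x: "x \<in> carrier free_pairs" "t = null_coset x" using t tensor_carrier by auto
  have P: "linear_map free_pairs T (\<lambda>x. h (null_coset x))" if "linear_map (tensor_product V W) T h" for h
    using that linear_map_null_coset by (rule linear_map_compose)
  note Pf = P[OF f] and Pg = P[OF g]
  have "f (null_coset x) = g (null_coset x)" if "Poly_Mapping.keys x \<subseteq> carrier V \<times> carrier W" for x
    using that
  proof (induction rule: free_space_induct)
    case zero
    then show ?case
      using linear_map_zero[OF vspace_free_space T Pf] linear_map_zero[OF vspace_free_space T Pg] by simp
  next
    case (single c p)
    obtain a b where p: "p = (a, b)" "a \<in> carrier V" "b \<in> carrier W" using single by auto
    have "Poly_Mapping.single p c = c \<odot>\<^bsub>free_pairs\<^esub> Poly_Mapping.single (a, b) 1"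
      by (auto intro!: poly_mapping_eqI simp: p lookup_single when_def)
    moreover have "Poly_Mapping.single (a, b) (1::'k) \<in> carrier free_pairs" using p by simp
    ultimately show ?case
      using linear_map_smult[OF Pf, of "Poly_Mapping.single (a, b) 1" c] eq[OF p(2,3)]
        linear_map_smult[OF Pg, of "Poly_Mapping.single (a, b) 1" c]
      by (simp add: pure_tensor_def)
  next
    case (add x y)
    then show ?case
      using linear_map_add[OF Pf, of x y] linear_map_add[OF Pg, of x y] by simp
  qed
  then show ?thesis using x by simp
qed

end

subsection \<open>Bases\<close>

text \<open>The coordinates are carried along as linear functionals, that is, as the dual basis; the
  first argument of \<open>coord\<close> is the basis vector.\<close>

locale basis = module scalars V for V :: "('k::field, 'a, 'm) module_scheme" (structure) +
  fixes B :: "'a set" and coord :: "'a \<Rightarrow> 'a \<Rightarrow> 'k"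
  assumes finite_basis [simp]: "finite B"
    and basis_subset: "B \<subseteq> carrier V"
    and coord_linear: "b \<in> B \<Longrightarrow> functional V (coord b)"
    and basis_expand: "v \<in> carrier V \<Longrightarrow> v = (\<Oplus>b\<in>B. coord b v \<odot> b)"
    and coord_basis: "\<lbrakk>b \<in> B; b' \<in> B\<rbrakk> \<Longrightarrow> coord b b' = (if b = b' then 1 else 0)"

text \<open>A spanning set of least cardinality is independent: a relation with a nonzero
  coefficient at \<open>b0\<close> would allow \<open>b0\<close> to be dropped. Uniqueness of
  expansions then makes the coordinates linear.\<close>

lemma finite_dimensional_basis:
  fixes V :: "('k::field, 'a, 'm) module_scheme" (structure)
  assumes V: "vspace V" and fd: "finite_dimensional V"
  obtains B coord where "basis V B coord"
proof -
  interpret V: module scalars V by fact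
  define spanning where "spanning B \<longleftrightarrow> finite B \<and> B \<subseteq> carrier V \<and>
     (\<forall>v\<in>carrier V. \<exists>c. v = (\<Oplus>b\<in>B. c b \<odot> b))" for B
  obtain B where B: "spanning B" and min: "\<And>B'. spanning B' \<Longrightarrow> card B \<le> card B'"
    using fd exists_least_iff[of "\<lambda>n. \<exists>B. spanning B \<and> card B = n"]
    unfolding finite_dimensional_def spanning_def[symmetric] by (metis not_le)
  have fin: "finite B" and sub: "B \<subseteq> carrier V"
    and span: "\<And>v. v \<in> carrier V \<Longrightarrow> \<exists>c. v = (\<Oplus>b\<in>B. c b \<odot> b)"
    using B unfolding spanning_def by blast+
  have cl: "(\<lambda>b. c b \<odot> b) \<in> B \<rightarrow> carrier V" for c :: "'a \<Rightarrow> 'k"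
    using sub by auto
  have comb_add: "(\<Oplus>b\<in>B. (c b + d b) \<odot> b) = (\<Oplus>b\<in>B. c b \<odot> b) \<oplus> (\<Oplus>b\<in>B. d b \<odot> b)" for c d :: "'a \<Rightarrow> 'k"
  proof -
    have "(\<Oplus>b\<in>B. (c b + d b) \<odot> b) = (\<Oplus>b\<in>B. c b \<odot> b \<oplus> d b \<odot> b)"
      by (rule V.finsum_cong') (use sub V.smult_l_distr[simplified] in auto)
    then show ?thesis using V.finsum_addf[OF cl cl] by simp
  qed
  have comb_smult: "(\<Oplus>b\<in>B. (x * c b) \<odot> b) = x \<odot> (\<Oplus>b\<in>B. c b \<odot> b)" for c :: "'a \<Rightarrow> 'k" and x
  proof -
    have "(\<Oplus>b\<in>B. (x * c b) \<odot> b) = (\<Oplus>b\<in>B. x \<odot> (c b \<odot> b))"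
      by (rule V.finsum_cong') (use sub V.smult_assoc1[simplified] in auto)
    then show ?thesis using V.finsum_smult_ldistr[OF fin _ cl] by simp
  qed
  have indep: "e b0 = 0" if e: "(\<Oplus>b\<in>B. e b \<odot> b) = \<zero>" and b0: "b0 \<in> B" for e b0
  proof (rule ccontr)
    assume ne: "e b0 \<noteq> 0"
    have "spanning (B - {b0})"
      unfolding spanning_def
    proof (intro conjI ballI)
      fix v assume "v \<in> carrier V"
      then obtain x where x: "v = (\<Oplus>b\<in>B. x b \<odot> b)" using span by blast
      \<comment> \<open>The multiple of the relation is chosen so that the coefficient at
        \<open>b0\<close> cancels while the sum is unchanged.\<close>
      define y where "y b = x b + (- (x b0 / e b0)) * e b" for b
      have "(\<Oplus>b\<in>B. y b \<odot> b) = v"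
        unfolding y_def comb_add comb_smult e using cl by (simp add: x)
      moreover have "(\<Oplus>b\<in>B - {b0}. y b \<odot> b) = (\<Oplus>b\<in>B. y b \<odot> b)"
      proof (rule V.add.finprod_mono_neutral_cong_left)
        have "y b0 = 0" using ne by (simp add: y_def)
        then show "\<And>i. i \<in> B - (B - {b0}) \<Longrightarrow> y i \<odot> i = \<zero>"
          using b0 sub V.smult_l_null[simplified] by auto
      qed (use fin sub in auto)
      ultimately show "\<exists>c. v = (\<Oplus>b\<in>B - {b0}. c b \<odot> b)" by metis
    qed (use fin sub in auto)
    then have "card B \<le> card (B - {b0})" by (rule min)
    then show False using card_Diff1_less[OF fin b0] by simp
  qed
  have unique: "c b = d b" if "(\<Oplus>b\<in>B. c b \<odot> b) = (\<Oplus>b\<in>B. d b \<odot> b)" "b \<in> B" for c d b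
  proof -
    have "(\<Oplus>b\<in>B. (c b + (-1) * d b) \<odot> b) = (\<Oplus>b\<in>B. d b \<odot> b) \<oplus> (-1) \<odot> (\<Oplus>b\<in>B. d b \<odot> b)"
      unfolding comb_add comb_smult that(1) ..
    also have "\<dots> = (1 + (-1)) \<odot> (\<Oplus>b\<in>B. d b \<odot> b)"
      using V.smult_l_distr[of 1 "-1" "\<Oplus>b\<in>B. d b \<odot> b"] V.smult_one cl by simp
    also have "\<dots> = \<zero>"
      using V.smult_l_null[of "\<Oplus>b\<in>B. d b \<odot> b"] cl by simp
    finally show ?thesis using indep[OF _ that(2), of "\<lambda>b. c b + (-1) * d b"] by simp
  qed
  \<comment> \<open>The coefficients are chosen separately for each \<open>v\<close>;
    \<open>eq\<close> below identifies them with any other expansion, and linearity follows from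
    that.\<close>
  define coord where "coord b v = (SOME c. v = (\<Oplus>b\<in>B. c b \<odot> b)) b" for b v
  have expand: "v = (\<Oplus>b\<in>B. coord b v \<odot> b)" if "v \<in> carrier V" for v
    using someI_ex[OF span[OF that]] unfolding coord_def .
  have eq: "coord b v = c b" if "v \<in> carrier V" "v = (\<Oplus>b\<in>B. c b \<odot> b)" "b \<in> B" for c v b
    using expand[OF that(1)] that(2) by (intro unique[OF _ that(3)]) simp
  have "basis V B coord"
  proof
    fix b assume b: "b \<in> B"
    show "functional V (coord b)"
      unfolding linear_map_def
    proof (intro conjI ballI allI funcsetI)
      fix x y c assume x: "x \<in> carrier V"
      show "coord b (c \<odot> x) = c \<odot>\<^bsub>scalar_space\<^esub> coord b x"
        using x expand[OF x] by (intro eq[OF _ _ b, THEN trans]) (auto simp: comb_smult)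
      assume y: "y \<in> carrier V"
      show "coord b (x \<oplus> y) = coord b x \<oplus>\<^bsub>scalar_space\<^esub> coord b y"
        using x y expand[OF x] expand[OF y] by (intro eq[OF _ _ b, THEN trans]) (auto simp: comb_add)
    qed simp
    fix b' assume b': "b' \<in> B"
    have "b' = (\<Oplus>b\<in>B. (if b = b' then 1 else 0) \<odot> b)"
    proof -
      have "(\<Oplus>b\<in>{b'}. (if b = b' then 1 else 0) \<odot> b) = (\<Oplus>b\<in>B. (if b = b' then 1 else 0) \<odot> b)"
        by (rule V.add.finprod_mono_neutral_cong_left)
           (use fin sub b' V.smult_l_null[simplified] in auto)
      then show ?thesis using b' sub V.smult_one[simplified] by auto
    qed
    then show "coord b b' = (if b = b' then 1 else 0)"
      using eq[OF _ _ b, of b' "\<lambda>b. if b = b' then 1 else 0"] b' sub by auto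
  qed (use fin sub expand in auto)
  then show thesis by (rule that)
qed

lemma (in basis) functional_expand:
  assumes "functional V f" "v \<in> carrier V"
  shows "f v = (\<Sum>b\<in>B. coord b v * f b)"
proof -
  have "f v = f (\<Oplus>b\<in>B. coord b v \<odot> b)" using basis_expand[OF assms(2)] by simp
  also have "\<dots> = (\<Sum>b\<in>B. f (coord b v \<odot> b))"
    using basis_subset by (intro functional_sum[OF _ assms(1)]) (auto intro: module_axioms)
  also have "\<dots> = (\<Sum>b\<in>B. coord b v * f b)"
    using basis_subset linear_map_smult[OF assms(1)] by (intro sum.cong) auto
  finally show ?thesis .
qed

lemma (in basis) coord_eqI:
  assumes "v \<in> carrier V" "w \<in> carrier V" "\<And>b. b \<in> B \<Longrightarrow> coord b v = coord b w"
  shows "v = w"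
proof -
  have "(\<Oplus>b\<in>B. coord b v \<odot> b) = (\<Oplus>b\<in>B. coord b w \<odot> b)"
    by (rule finsum_cong') (use assms(3) basis_subset in auto)
  then show ?thesis using basis_expand[OF assms(1)] basis_expand[OF assms(2)] by simp
qed

section \<open>Functionals, bilinear forms and reconstruction of tensors\<close>

lemma sum_pairs: "(\<Sum>p\<in>I \<times> J. g (fst p) (snd p)) = (\<Sum>i\<in>I. \<Sum>j\<in>J. g i j)"
  by (simp add: sum.cartesian_product case_prod_beta)

lemma functional_mult:
  "functional V f \<Longrightarrow> functional V (\<lambda>x. c * f x)"
  "functional V f \<Longrightarrow> functional V (\<lambda>x. f x * c)"
  by (auto simp: linear_map_def algebra_simps)

lemma functional_sum_fun:
  "(\<And>i. i \<in> I \<Longrightarrow> functional V (f i)) \<Longrightarrow> functional V (\<lambda>x. \<Sum>i\<in>I. f i x)"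
  by (simp add: linear_map_def sum.distrib sum_distrib_left cong: sum.cong)

abbreviation bilinear_form where "bilinear_form V W \<equiv> bilinear_map V W scalar_space"

lemma bilinear_map_mult_functionals:
  "\<lbrakk>functional V f; functional W g\<rbrakk> \<Longrightarrow> bilinear_form V W (\<lambda>a b. f a * g b)"
  by (auto simp: bilinear_map_def functional_mult)

lemma functional_cong:
  assumes V: "vspace V" and eq: "\<And>x. x \<in> carrier V \<Longrightarrow> f x = g x" and g: "functional V g"
  shows "functional V f"
proof -
  interpret V: module scalars V by fact
  show ?thesis using g by (auto simp: linear_map_def eq)
qed

lemma linear_map_finsum_fun:
  assumes V: "vspace V" and W: "vspace W" and f: "\<And>i. i \<in> I \<Longrightarrow> linear_map V W (f i)"
    and fin: "finite I"
  shows "linear_map V W (\<lambda>x. finsum W (\<lambda>i. f i x) I)"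
proof -
  interpret V: module scalars V by fact
  interpret W: module scalars W by fact
  have cl: "f i x \<in> carrier W" if "i \<in> I" "x \<in> carrier V" for i x
    using linear_map_closed[OF f] that .
  show ?thesis
    unfolding linear_map_def
  proof (intro conjI ballI allI funcsetI)
    fix x y assume xy: "x \<in> carrier V" "y \<in> carrier V"
    have "finsum W (\<lambda>i. f i (x \<oplus>\<^bsub>V\<^esub> y)) I = finsum W (\<lambda>i. f i x \<oplus>\<^bsub>W\<^esub> f i y) I"
      by (rule W.finsum_cong') (use xy linear_map_add[OF f] in \<open>auto simp: cl\<close>)
    also have "\<dots> = finsum W (\<lambda>i. f i x) I \<oplus>\<^bsub>W\<^esub> finsum W (\<lambda>i. f i y) I"
      by (rule W.finsum_addf) (use xy in \<open>auto simp: cl\<close>)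
    finally show "finsum W (\<lambda>i. f i (x \<oplus>\<^bsub>V\<^esub> y)) I = finsum W (\<lambda>i. f i x) I \<oplus>\<^bsub>W\<^esub> finsum W (\<lambda>i. f i y) I" .
  next
    fix c x assume x: "x \<in> carrier V"
    have "finsum W (\<lambda>i. f i (c \<odot>\<^bsub>V\<^esub> x)) I = finsum W (\<lambda>i. c \<odot>\<^bsub>W\<^esub> f i x) I"
      by (rule W.finsum_cong') (use x linear_map_smult[OF f] in \<open>auto simp: cl\<close>)
    also have "\<dots> = c \<odot>\<^bsub>W\<^esub> finsum W (\<lambda>i. f i x) I"
      by (rule W.finsum_smult_ldistr[symmetric]) (use x fin in \<open>auto simp: cl\<close>)
    finally show "finsum W (\<lambda>i. f i (c \<odot>\<^bsub>V\<^esub> x)) I = c \<odot>\<^bsub>W\<^esub> finsum W (\<lambda>i. f i x) I" .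
  qed (auto simp: cl)
qed

lemma functional_smult_vector:
  assumes W: "vspace W" and "functional V f" "w \<in> carrier W"
  shows "linear_map V W (\<lambda>x. f x \<odot>\<^bsub>W\<^esub> w)"
proof -
  interpret W: module scalars W by fact
  show ?thesis
    using assms(2,3) W.smult_l_distr[of _ _ w] W.smult_assoc1[of _ _ w] by (auto simp: linear_map_def)
qed

lemma functional_lift_arg:
  assumes V: "vspace V" and W: "vspace W" and U: "vspace U"
    and t: "t \<in> carrier (tensor_product V W)"
    and F: "\<And>a b. \<lbrakk>a \<in> carrier V; b \<in> carrier W\<rbrakk> \<Longrightarrow> functional U (\<lambda>x. F x a b)"
  shows "functional U (\<lambda>x. lift_bilinear scalar_space (F x) t)"
proof -
  interpret U: module scalars U by fact
  note cong = lift_bilinear_cong[OF V W _ vspace_scalar_space _ t]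
  show ?thesis
    unfolding linear_map_def
  proof (intro conjI ballI allI funcsetI)
    fix x y assume xy: "x \<in> carrier U" "y \<in> carrier U"
    have "lift_bilinear scalar_space (F (x \<oplus>\<^bsub>U\<^esub> y)) t =
        lift_bilinear scalar_space (\<lambda>a b. F x a b + F y a b) t"
      by (rule cong) (use xy linear_map_add[OF F] in auto)
    then show "lift_bilinear scalar_space (F (x \<oplus>\<^bsub>U\<^esub> y)) t =
      lift_bilinear scalar_space (F x) t \<oplus>\<^bsub>scalar_space\<^esub> lift_bilinear scalar_space (F y) t"
      by (simp add: lift_scalar_add)
  next
    fix c x assume x: "x \<in> carrier U"
    have "lift_bilinear scalar_space (F (c \<odot>\<^bsub>U\<^esub> x)) t = lift_bilinear scalar_space (\<lambda>a b. c * F x a b) t"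
      by (rule cong) (use x linear_map_smult[OF F] in auto)
    then show "lift_bilinear scalar_space (F (c \<odot>\<^bsub>U\<^esub> x)) t =
      c \<odot>\<^bsub>scalar_space\<^esub> lift_bilinear scalar_space (F x) t"
      by (simp add: lift_scalar_mult)
  qed simp
qed

text \<open>Both sides are linear in \<open>t\<close>, so pure tensors suffice. The families are
  left abstract because the lemma serves twice: for the dual tensored with itself, where the
  coordinates are evaluations at basis vectors, and for the dual tensored with
  \<open>H\<close>.\<close>

lemma tensor_expand:
  assumes V: "vspace V" and W: "vspace W" and fin: "finite I" "finite J"
    and v: "\<And>i. i \<in> I \<Longrightarrow> v i \<in> carrier V" and w: "\<And>j. j \<in> J \<Longrightarrow> w j \<in> carrier W"
    and \<phi>: "\<And>i. i \<in> I \<Longrightarrow> functional V (\<phi> i)" and \<psi>: "\<And>j. j \<in> J \<Longrightarrow> functional W (\<psi> j)"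
    and ev: "\<And>a. a \<in> carrier V \<Longrightarrow> a = (\<Oplus>\<^bsub>V\<^esub>i\<in>I. \<phi> i a \<odot>\<^bsub>V\<^esub> v i)"
    and ew: "\<And>b. b \<in> carrier W \<Longrightarrow> b = (\<Oplus>\<^bsub>W\<^esub>j\<in>J. \<psi> j b \<odot>\<^bsub>W\<^esub> w j)"
    and t: "t \<in> carrier (tensor_product V W)"
  shows "t = (\<Oplus>\<^bsub>tensor_product V W\<^esub>i\<in>I. \<Oplus>\<^bsub>tensor_product V W\<^esub>j\<in>J.
      lift_bilinear scalar_space (\<lambda>a b. \<phi> i a * \<psi> j b) t \<odot>\<^bsub>tensor_product V W\<^esub> pure_tensor V W (v i) (w j))"
proof -
  let ?T = "tensor_product V W"
  let ?p = "pure_tensor V W"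
  have T: "vspace ?T" by (rule vspace_tensor_product[OF V W])
  interpret V: module scalars V by fact
  interpret W: module scalars W by fact
  interpret T: module scalars ?T by fact
  have b: "bilinear_form V W (\<lambda>a b. \<phi> i a * \<psi> j b)" if "i \<in> I" "j \<in> J" for i j
    by (intro bilinear_map_mult_functionals \<phi> \<psi> that)
  have p: "?p a b \<in> carrier ?T" if "a \<in> carrier V" "b \<in> carrier W" for a b
    using pure_tensor_closed[OF V W that] .
  note pl = bilinear_map_linear[OF bilinear_map_pure_tensor[OF V W]]
  define L where "L t = (\<Oplus>\<^bsub>?T\<^esub>i\<in>I. \<Oplus>\<^bsub>?T\<^esub>j\<in>J.
      lift_bilinear scalar_space (\<lambda>a b. \<phi> i a * \<psi> j b) t \<odot>\<^bsub>?T\<^esub> ?p (v i) (w j))" for t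
  have L: "linear_map ?T ?T L"
    unfolding L_def
    by (intro linear_map_finsum_fun functional_smult_vector T fin p v w
        linear_map_lift_bilinear V W vspace_scalar_space b)
  have "L t = t"
  proof (rule tensor_linear_eqI[OF V W T L _ _ t])
    show "linear_map ?T ?T (\<lambda>t. t)" by (auto simp: linear_map_def)
    fix a b assume ab: "a \<in> carrier V" "b \<in> carrier W"
    have "L (?p a b) = (\<Oplus>\<^bsub>?T\<^esub>i\<in>I. \<Oplus>\<^bsub>?T\<^esub>j\<in>J. (\<phi> i a * \<psi> j b) \<odot>\<^bsub>?T\<^esub> ?p (v i) (w j))"
      unfolding L_def
      by (intro T.finsum_cong' refl funcsetI T.finsum_closed T.smult_closed p v w)
         (use ab lift_bilinear_pure[OF V W vspace_scalar_space b] in auto)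
    also have "\<dots> = (\<Oplus>\<^bsub>?T\<^esub>i\<in>I. \<phi> i a \<odot>\<^bsub>?T\<^esub> ?p (v i) b)"
    proof (rule T.finsum_cong'[OF refl])
      fix i assume i: "i \<in> I"
      have "(\<Oplus>\<^bsub>?T\<^esub>j\<in>J. (\<phi> i a * \<psi> j b) \<odot>\<^bsub>?T\<^esub> ?p (v i) (w j)) =
          (\<Oplus>\<^bsub>?T\<^esub>j\<in>J. \<phi> i a \<odot>\<^bsub>?T\<^esub> ?p (v i) (\<psi> j b \<odot>\<^bsub>W\<^esub> w j))"
        by (intro T.finsum_cong' refl funcsetI T.smult_closed p v w W.smult_closed i)
           (use i T.smult_assoc1[simplified] linear_map_smult[OF pl(1)[OF v[OF i]]] w p v in auto)
      also have "\<dots> = \<phi> i a \<odot>\<^bsub>?T\<^esub> (\<Oplus>\<^bsub>?T\<^esub>j\<in>J. ?p (v i) (\<psi> j b \<odot>\<^bsub>W\<^esub> w j))"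
        by (rule T.finsum_smult_ldistr[symmetric]) (use fin i p v w in auto)
      also have "(\<Oplus>\<^bsub>?T\<^esub>j\<in>J. ?p (v i) (\<psi> j b \<odot>\<^bsub>W\<^esub> w j)) = ?p (v i) (\<Oplus>\<^bsub>W\<^esub>j\<in>J. \<psi> j b \<odot>\<^bsub>W\<^esub> w j)"
        by (rule linear_map_finsum[OF W T pl(1), symmetric]) (use i v w in auto)
      finally show "(\<Oplus>\<^bsub>?T\<^esub>j\<in>J. (\<phi> i a * \<psi> j b) \<odot>\<^bsub>?T\<^esub> ?p (v i) (w j)) = \<phi> i a \<odot>\<^bsub>?T\<^esub> ?p (v i) b"
        using ew[OF ab(2)] by simp
    qed (use p v ab in auto)
    also have "\<dots> = (\<Oplus>\<^bsub>?T\<^esub>i\<in>I. ?p (\<phi> i a \<odot>\<^bsub>V\<^esub> v i) b)"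
      by (intro T.finsum_cong' refl funcsetI p V.smult_closed v)
         (use ab v linear_map_smult[OF pl(2)[OF ab(2)]] in auto)
    also have "\<dots> = ?p (\<Oplus>\<^bsub>V\<^esub>i\<in>I. \<phi> i a \<odot>\<^bsub>V\<^esub> v i) b"
      by (rule linear_map_finsum[OF V T pl(2), symmetric]) (use ab v in auto)
    finally show "L (?p a b) = ?p a b" using ev[OF ab(1)] by simp
  qed
  then show ?thesis by (simp add: L_def)
qed

text \<open>\<open>comult_right\<close> is a lift of pure tensors. Linearity of \<open>K\<close> in
  all three slots makes the two-stage lift a functional on the triple tensor product, which can be
  pushed inside and evaluated on those pure tensors.\<close>

lemma lift_trilinear_comult_right:
  assumes A: "vspace A" and c: "\<And>a. a \<in> carrier A \<Longrightarrow> comult A a \<in> carrier (tensor_product A A)"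
    and K: "\<And>a. a \<in> carrier A \<Longrightarrow> bilinear_form A A (K a)"
    and K1: "\<And>b c. \<lbrakk>b \<in> carrier A; c \<in> carrier A\<rbrakk> \<Longrightarrow> functional A (\<lambda>a. K a b c)"
    and h: "h \<in> carrier A"
  shows "lift_trilinear scalar_space K (comult_right A h) =
    lift_bilinear scalar_space (\<lambda>a b. lift_bilinear scalar_space (K a) (comult A b)) (comult A h)"
proof -
  let ?AA = "tensor_product A A" and ?T = "tensor_product A (tensor_product A A)"
  have AA: "vspace ?AA" by (rule vspace_tensor_product[OF A A])
  have T: "vspace ?T" by (rule vspace_tensor_product[OF A AA])
  define Q where "Q a = lift_bilinear scalar_space (K a)" for a
  have Q: "bilinear_form A ?AA Q"
    unfolding bilinear_map_def Q_def
    using A K K1 by (auto intro!: linear_map_lift_bilinear functional_lift_arg)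
  have p: "pure_tensor A ?AA a s \<in> carrier ?T" if "a \<in> carrier A" "s \<in> carrier ?AA" for a s
    by (rule pure_tensor_closed[OF A AA that])
  have "lift_trilinear scalar_space K (comult_right A h) = lift_bilinear scalar_space Q (comult_right A h)"
    by (simp add: lift_trilinear_def Q_def[abs_def])
  also have "\<dots> = lift_bilinear scalar_space
      (\<lambda>a b. lift_bilinear scalar_space Q (pure_tensor A ?AA a (comult A b))) (comult A h)"
    unfolding comult_right_def Let_def
    by (rule linear_map_lift[OF A A T vspace_scalar_space])
       (use linear_map_lift_bilinear[OF A AA vspace_scalar_space Q] c h p in auto)
  also have "\<dots> = lift_bilinear scalar_space (\<lambda>a b. Q a (comult A b)) (comult A h)"
    by (rule lift_bilinear_cong[OF A A])
       (use lift_bilinear_pure[OF A AA vspace_scalar_space Q] c h in auto)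
  finally show ?thesis by (simp add: Q_def)
qed

lemma comult_right_closed:
  assumes A: "vspace A" and c: "\<And>a. a \<in> carrier A \<Longrightarrow> comult A a \<in> carrier (tensor_product A A)"
    and h: "h \<in> carrier A"
  shows "comult_right A h \<in> carrier (tensor_product A (tensor_product A A))"
proof -
  have AA: "vspace (tensor_product A A)" by (rule vspace_tensor_product[OF A A])
  show ?thesis
    unfolding comult_right_def Let_def
    by (rule lift_bilinear_closed[OF A A vspace_tensor_product[OF A AA]])
       (use c h pure_tensor_closed[OF A AA] in auto)
qed

lemma lift_trilinear_closed:
  assumes U: "vspace U" and V: "vspace V" and W: "vspace W" and T: "vspace T"
    and G: "\<And>a b c. \<lbrakk>a \<in> carrier U; b \<in> carrier V; c \<in> carrier W\<rbrakk> \<Longrightarrow> G a b c \<in> carrier T"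
    and t: "t \<in> carrier (tensor_product U (tensor_product V W))"
  shows "lift_trilinear T G t \<in> carrier T"
  unfolding lift_trilinear_def
  by (intro lift_bilinear_closed[OF U vspace_tensor_product[OF V W] T _ t]
      lift_bilinear_closed[OF V W T] G)

lemma functional_lift_trilinear:
  assumes U: "vspace U" and V: "vspace V" and W: "vspace W" and T: "vspace T"
    and G: "\<And>a b c. \<lbrakk>a \<in> carrier U; b \<in> carrier V; c \<in> carrier W\<rbrakk> \<Longrightarrow> G a b c \<in> carrier T"
    and t: "t \<in> carrier (tensor_product U (tensor_product V W))"
    and L: "functional T L"
    and GK: "\<And>a b c. \<lbrakk>a \<in> carrier U; b \<in> carrier V; c \<in> carrier W\<rbrakk> \<Longrightarrow> L (G a b c) = K a b c"
  shows "L (lift_trilinear T G t) = lift_trilinear scalar_space K t"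
proof -
  note VW = vspace_tensor_product[OF V W]
  have "L (lift_trilinear T G t) = lift_bilinear scalar_space (\<lambda>a s. L (lift_bilinear T (G a) s)) t"
    unfolding lift_trilinear_def
    by (rule linear_map_lift[OF U VW T vspace_scalar_space L lift_bilinear_closed[OF V W T] t]) (rule G)
  also have "\<dots> = lift_bilinear scalar_space (\<lambda>a s. lift_bilinear scalar_space (K a) s) t"
  proof (rule lift_bilinear_cong[OF U VW _ vspace_scalar_space _ t])
    fix a s assume as: "a \<in> carrier U" "s \<in> carrier (tensor_product V W)"
    have "L (lift_bilinear T (G a) s) = lift_bilinear scalar_space (\<lambda>b c. L (G a b c)) s"
      by (rule linear_map_lift[OF V W T vspace_scalar_space L G as(2)]) (rule as)
    also have "\<dots> = lift_bilinear scalar_space (K a) s"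
      by (rule lift_bilinear_cong[OF V W GK vspace_scalar_space _ as(2)]) (use as in auto)
    finally show "L (lift_bilinear T (G a) s) = lift_bilinear scalar_space (K a) s" .
  qed simp
  finally show ?thesis by (simp add: lift_trilinear_def)
qed

lemma dual_hopf_simps:
  "carrier (dual_hopf H) = {f \<in> extensional (carrier H). functional H f}"
  "f \<otimes>\<^bsub>dual_hopf H\<^esub> g = (\<lambda>h\<in>carrier H. lift_bilinear scalar_space (\<lambda>a b. f a * g b) (comult H h))"
  "\<one>\<^bsub>dual_hopf H\<^esub> = restrict (counit H) (carrier H)"
  "\<zero>\<^bsub>dual_hopf H\<^esub> = (\<lambda>h\<in>carrier H. 0)"
  "f \<oplus>\<^bsub>dual_hopf H\<^esub> g = (\<lambda>h\<in>carrier H. f h + g h)"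
  "c \<odot>\<^bsub>dual_hopf H\<^esub> f = (\<lambda>h\<in>carrier H. c * f h)"
  "comult (dual_hopf H) = dual_comult H"
  by (simp_all add: dual_hopf_def dual_algebra_def module.defs)

text \<open>\<open>dual_comult\<close> is defined over the plain record \<open>dual_algebra\<close>,
  while everything else uses its extension. A tensor product depends only on carrier, addition and
  scaling, which the two share.\<close>

lemma tensor_product_dual:
  "tensor_product (dual_algebra H) (dual_algebra H) = tensor_product (dual_hopf H) (dual_hopf H)"
  by (simp add: tensor_product_def null_tensors_def bilinearity_relations_def dual_hopf_def module.defs)

subsection \<open>Finite-dimensional Hopf algebras\<close>

text \<open>The basis is fixed once and for all so that Sweedler sums become finite sums over it;
  the final theorem obtains it from finite dimension.\<close>

locale fd_hopf = hopf_algebra H + basis H B coord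
  for H :: "('k::field, 'a) hopf_structure" (structure) and B coord +
  assumes antipode_bij: "bij_betw (antipode H) (carrier H) (carrier H)"
begin

abbreviation "C \<equiv> carrier H"
abbreviation "HH \<equiv> tensor_product H H"
abbreviation "S \<equiv> antipode H"
abbreviation "Si \<equiv> antipode_inv H"
abbreviation "\<epsilon> \<equiv> counit H"
abbreviation "lin \<equiv> functional H"
abbreviation "endo \<equiv> linear_map H H"
abbreviation "bil \<equiv> bilinear_form H H"

lemma vspace_H [simp]: "vspace H" by (rule module_axioms)
lemma vspace_HH [simp]: "vspace HH" by (rule vspace_tensor_product) simp_all

lemma comult_closed [simp, intro]: "h \<in> C \<Longrightarrow> comult H h \<in> carrier HH"
  by (rule linear_map_closed[OF comult_linear])

lemma antipode_closed [simp, intro]: "h \<in> C \<Longrightarrow> S h \<in> C"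
  by (rule linear_map_closed[OF antipode_linear])

lemma basis_carrier [simp, intro]: "b \<in> B \<Longrightarrow> b \<in> C"
  using basis_subset by auto

lemma endo_mult: "endo g \<Longrightarrow> a \<in> C \<Longrightarrow> endo (\<lambda>x. a \<otimes> g x)"
  "endo g \<Longrightarrow> a \<in> C \<Longrightarrow> endo (\<lambda>x. g x \<otimes> a)"
  by (auto simp: linear_map_def Pi_iff r_distr l_distr smult_mult_left smult_mult_right)

lemma endo_id: "endo (\<lambda>x. x)"
  by (auto simp: linear_map_def)

lemma endo_antipode: "endo g \<Longrightarrow> endo (\<lambda>x. S (g x))"
  by (rule linear_map_compose[OF antipode_linear])

section \<open>Sweedler sums in coordinates\<close>

definition comult_coeff :: "'a \<Rightarrow> 'a \<Rightarrow> 'a \<Rightarrow> 'k" where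
  "comult_coeff h i j = lift_bilinear scalar_space (\<lambda>a b. coord i a * coord j b) (comult H h)"

text \<open>
  \<open>Sw h F\<close> is the Sweedler sum \<open>F h\<^sub>1 h\<^sub>2\<close>, provided that \<open>F\<close> is bilinear.  As \<open>F\<close> is only evaluated at
  basis vectors, coassociativity and exchange of sums hold for \<open>Sw\<close> without any linearity
  assumption.
\<close>

definition Sw :: "'a \<Rightarrow> ('a \<Rightarrow> 'a \<Rightarrow> 'k) \<Rightarrow> 'k" where
  "Sw h F = (\<Sum>i\<in>B. \<Sum>j\<in>B. comult_coeff h i j * F i j)"

lemma lin_comult_coeff: "i \<in> B \<Longrightarrow> j \<in> B \<Longrightarrow> lin (\<lambda>h. comult_coeff h i j)"
  unfolding comult_coeff_def
  by (rule linear_map_compose[OF linear_map_lift_bilinear comult_linear])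
     (auto intro: bilinear_map_mult_functionals coord_linear)

lemma bil_expand:
  assumes F: "bil F" and "a \<in> C" "b \<in> C"
  shows "F a b = (\<Sum>i\<in>B. \<Sum>j\<in>B. F i j * (coord i a * coord j b))"
proof -
  have "F a b = (\<Sum>i\<in>B. coord i a * F i b)"
    using functional_expand[OF bilinear_map_linear(2)[OF F assms(3)] assms(2)] .
  also have "\<dots> = (\<Sum>i\<in>B. coord i a * (\<Sum>j\<in>B. coord j b * F i j))"
    using functional_expand[OF bilinear_map_linear(1)[OF F] assms(3)] by (intro sum.cong) auto
  finally show ?thesis by (simp add: sum_distrib_left mult_ac)
qed

text \<open>The bridge from the lifts in the definitions to \<open>Sw\<close>. Bilinearity enters
  here, through the expansion of \<open>F\<close> in its values at pairs of basis vectors.\<close>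

lemma lift_comult:
  assumes F: "bil F" and h: "h \<in> C"
  shows "lift_bilinear scalar_space F (comult H h) = Sw h F"
proof -
  have "lift_bilinear scalar_space F (comult H h) =
      lift_bilinear scalar_space (\<lambda>a b. \<Sum>i\<in>B. \<Sum>j\<in>B. F i j * (coord i a * coord j b)) (comult H h)"
    by (rule lift_bilinear_cong[of H H]) (use h bil_expand[OF F] in auto)
  also have "\<dots> = Sw h F"
    by (simp add: lift_scalar_sum lift_scalar_mult Sw_def comult_coeff_def mult.commute)
  finally show ?thesis .
qed

lemma Sw_cong:
  "(\<And>a b. \<lbrakk>a \<in> C; b \<in> C\<rbrakk> \<Longrightarrow> F a b = G a b) \<Longrightarrow> Sw h F = Sw h G"
  unfolding Sw_def by (intro sum.cong refl) auto

lemma Sw_mult: "Sw h (\<lambda>a b. c * F a b) = c * Sw h F" "Sw h (\<lambda>a b. F a b * c) = Sw h F * c"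
  by (simp_all add: Sw_def sum_distrib_left sum_distrib_right mult_ac)

lemma Sw_pairs: "Sw h F = (\<Sum>p\<in>B \<times> B. comult_coeff h (fst p) (snd p) * F (fst p) (snd p))"
  by (simp add: Sw_def sum.cartesian_product case_prod_beta)

lemma Sw_swap:
  "Sw h (\<lambda>a b. Sw g (\<lambda>c d. F a b c d)) = Sw g (\<lambda>c d. Sw h (\<lambda>a b. F a b c d))"
  by (simp add: Sw_pairs sum_distrib_left mult.left_commute)
     (rule sum.swap)

text \<open>Only the structure constants depend on \<open>h\<close>, so linearity in
  \<open>h\<close> holds for an arbitrary integrand.\<close>

lemma lin_Sw: "lin (\<lambda>h. Sw h F)"
  unfolding Sw_def by (intro functional_sum_fun functional_mult lin_comult_coeff)

lemma lin_Sw_arg: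
  assumes "\<And>a b. \<lbrakk>a \<in> C; b \<in> C\<rbrakk> \<Longrightarrow> functional V (\<lambda>x. F x a b)"
  shows "functional V (\<lambda>x. Sw h (F x))"
  unfolding Sw_def by (intro functional_sum_fun functional_mult assms) auto

lemma bilI: "\<lbrakk>\<And>a. a \<in> C \<Longrightarrow> lin (F a); \<And>b. b \<in> C \<Longrightarrow> lin (\<lambda>a. F a b)\<rbrakk> \<Longrightarrow> bil F"
  by (simp add: bilinear_map_def)

lemma lin_comp: "\<lbrakk>lin \<xi>; endo g\<rbrakk> \<Longrightarrow> lin (\<lambda>x. \<xi> (g x))"
  by (rule linear_map_compose)

lemma lin_bil: "\<lbrakk>bil F; endo g; y \<in> C\<rbrakk> \<Longrightarrow> lin (\<lambda>x. F (g x) y)"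
  "\<lbrakk>bil F; endo g; y \<in> C\<rbrakk> \<Longrightarrow> lin (\<lambda>x. F y (g x))"
  using linear_map_compose[of H scalar_space "\<lambda>x. F x y"] linear_map_compose[of H scalar_space "F y"]
  by (auto simp: bilinear_map_def)

text \<open>Rules that establish, by the shape of a term alone, that an integrand built from
  products and antipodes is linear in a chosen variable.\<close>

lemmas endo_intros = endo_id endo_mult endo_antipode

text \<open>On basis vectors \<open>coord i\<close> is a Kronecker delta, so one of the two sums
  collapses. This evaluates the coordinate functionals in the coassociativity argument.\<close>

lemma Sw_delta:
  "i \<in> B \<Longrightarrow> Sw h (\<lambda>a b. coord i a * G b) = (\<Sum>b\<in>B. comult_coeff h i b * G b)"
  "i \<in> B \<Longrightarrow> Sw h (\<lambda>a b. G a * coord i b) = (\<Sum>a\<in>B. comult_coeff h a i * G a)"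
proof -
  assume i: "i \<in> B"
  have "(\<Sum>b\<in>B. comult_coeff h a b * (coord i a * G b)) = (if i = a then \<Sum>b\<in>B. comult_coeff h i b * G b else 0)"
    if "a \<in> B" for a
    using that i by (simp add: coord_basis)
  then show "Sw h (\<lambda>a b. coord i a * G b) = (\<Sum>b\<in>B. comult_coeff h i b * G b)"
    using i by (simp add: Sw_def)
  have "(\<Sum>b\<in>B. comult_coeff h a b * (G a * coord i b)) = (\<Sum>b\<in>B. if i = b then comult_coeff h a i * G a else 0)" for a
    using i by (intro sum.cong) (auto simp: coord_basis)
  then show "Sw h (\<lambda>a b. G a * coord i b) = (\<Sum>a\<in>B. comult_coeff h a i * G a)"
    using i by (simp add: Sw_def)
qed

text \<open>Coassociativity read in coordinates: the functional \<open>coord i\<close> tensor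
  \<open>coord j\<close> tensor \<open>coord k\<close> is applied to both iterated coproducts.
  \<open>\<Phi>\<close> is this functional for right bracketing, \<open>\<Psi>\<close> for left
  bracketing.\<close>

lemma coassoc_coeff:
  assumes h: "h \<in> C" and ijk: "i \<in> B" "j \<in> B" "k \<in> B"
  shows "(\<Sum>a\<in>B. comult_coeff h a k * comult_coeff a i j) = (\<Sum>b\<in>B. comult_coeff h i b * comult_coeff b j k)"
proof -
  let ?K = "scalar_space :: ('k, 'k) module"
  let ?T = "tensor_product H HH"
  define q where "q = lift_bilinear ?K (\<lambda>y z. coord j y * coord k z)"
  define \<Phi> where "\<Phi> = lift_bilinear ?K (\<lambda>x s. coord i x * q s)"
  have jk: "bil (\<lambda>y z. coord j y * coord k z)"
    by (intro bilinear_map_mult_functionals coord_linear ijk)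
  have q: "functional HH q" unfolding q_def by (rule linear_map_lift_bilinear) (simp_all add: jk)
  have iq: "bilinear_form H HH (\<lambda>x s. coord i x * q s)"
    by (intro bilinear_map_mult_functionals coord_linear ijk q)
  have T: "vspace ?T" by (rule vspace_tensor_product) simp_all
  have \<Phi>: "functional ?T \<Phi>" unfolding \<Phi>_def by (rule linear_map_lift_bilinear) (simp_all add: iq)
  have \<Phi>_pure: "\<Phi> (pure_tensor H HH a s) = coord i a * q s" if "a \<in> C" "s \<in> carrier HH" for a s
    unfolding \<Phi>_def by (rule lift_bilinear_pure[OF _ _ _ iq]) (use that in simp_all)
  have q_pure: "q (pure_tensor H H a b) = coord j a * coord k b" if "a \<in> C" "b \<in> C" for a b
    unfolding q_def by (rule lift_bilinear_pure[OF _ _ _ jk]) (use that in simp_all)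
  have q_comult: "q (comult H b) = comult_coeff b j k" for b unfolding q_def comult_coeff_def ..
  have pT: "pure_tensor H HH a s \<in> carrier ?T" if "a \<in> C" "s \<in> carrier HH" for a s
    using that by simp
  have "\<Phi> (comult_right H h) = lift_bilinear ?K (\<lambda>a b. \<Phi> (pure_tensor H HH a (comult H b))) (comult H h)"
    unfolding comult_right_def Let_def
    by (rule linear_map_lift[of H H]) (use h in \<open>auto simp: \<Phi> T intro: pT\<close>)
  also have "\<dots> = lift_bilinear ?K (\<lambda>a b. coord i a * comult_coeff b j k) (comult H h)"
    by (rule lift_bilinear_cong[of H H]) (use h in \<open>auto simp: \<Phi>_pure q_comult\<close>)
  also have "\<dots> = (\<Sum>b\<in>B. comult_coeff h i b * comult_coeff b j k)"
    by (subst lift_comult) (auto simp: h ijk Sw_delta intro!: bilinear_map_mult_functionals coord_linear lin_comult_coeff)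
  finally have R: "\<Phi> (comult_right H h) = (\<Sum>b\<in>B. comult_coeff h i b * comult_coeff b j k)" .
  let ?U = "tensor_product HH H"
  have U: "vspace ?U" by (rule vspace_tensor_product) simp_all
  define p where "p = lift_bilinear ?K (\<lambda>u v. coord i u * coord j v)"
  have ij: "bil (\<lambda>y z. coord i y * coord j z)"
    by (intro bilinear_map_mult_functionals coord_linear ijk)
  have p: "functional HH p" unfolding p_def by (rule linear_map_lift_bilinear) (simp_all add: ij)
  have pk: "bilinear_form HH H (\<lambda>s w. p s * coord k w)"
    by (intro bilinear_map_mult_functionals coord_linear ijk p)
  define \<Psi> where "\<Psi> = lift_bilinear ?K (\<lambda>s w. p s * coord k w)"
  have \<Psi>: "functional ?U \<Psi>" unfolding \<Psi>_def by (rule linear_map_lift_bilinear) (simp_all add: pk)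
  have \<Psi>_pure: "\<Psi> (pure_tensor HH H s a) = p s * coord k a" if "a \<in> C" "s \<in> carrier HH" for a s
    unfolding \<Psi>_def by (rule lift_bilinear_pure[OF _ _ _ pk]) (use that in simp_all)
  have p_comult: "p (comult H b) = comult_coeff b i j" for b unfolding p_def comult_coeff_def ..
  have pU: "pure_tensor HH H s a \<in> carrier ?U" if "a \<in> C" "s \<in> carrier HH" for a s
    using that by simp
  have l: "comult_left H h \<in> carrier ?U"
    unfolding comult_left_def Let_def
    by (rule lift_bilinear_closed[of H H]) (use h in \<open>auto simp: U intro: pU\<close>)
  have inner: "lift_bilinear ?T (\<lambda>u v. pure_tensor H HH u (pure_tensor H H v w)) s \<in> carrier ?T"
    if "s \<in> carrier HH" "w \<in> C" for s w
    by (rule lift_bilinear_closed[of H H]) (use that in \<open>auto simp: T intro: pT\<close>)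
  \<comment> \<open>Pulling \<open>\<Phi>\<close> back along the reassociation map gives
    \<open>\<Psi>\<close>; both lifts inside \<open>tensor_assoc\<close> must be crossed.\<close>
  have "\<Phi> (tensor_assoc H H H (comult_left H h)) = lift_bilinear ?K (\<lambda>s w.
      \<Phi> (lift_bilinear ?T (\<lambda>u v. pure_tensor H HH u (pure_tensor H H v w)) s)) (comult_left H h)"
    unfolding tensor_assoc_def Let_def
    by (rule linear_map_lift[of HH H]) (use h l in \<open>auto simp: \<Phi> T intro: inner\<close>)
  also have "\<dots> = lift_bilinear ?K (\<lambda>s w. p s * coord k w) (comult_left H h)"
  proof (rule lift_bilinear_cong[of HH H])
    fix s w assume sw: "s \<in> carrier HH" "w \<in> C"
    have "\<Phi> (lift_bilinear ?T (\<lambda>u v. pure_tensor H HH u (pure_tensor H H v w)) s) =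
      lift_bilinear ?K (\<lambda>u v. \<Phi> (pure_tensor H HH u (pure_tensor H H v w))) s"
      by (rule linear_map_lift[of H H]) (use sw in \<open>auto simp: \<Phi> T intro: pT\<close>)
    also have "\<dots> = lift_bilinear ?K (\<lambda>u v. coord k w * (coord i u * coord j v)) s"
      by (rule lift_bilinear_cong[of H H]) (use sw in \<open>auto simp: \<Phi>_pure q_pure mult_ac\<close>)
    finally show "\<Phi> (lift_bilinear ?T (\<lambda>u v. pure_tensor H HH u (pure_tensor H H v w)) s) = p s * coord k w"
      unfolding lift_scalar_mult p_def by (simp only: mult.commute)
  qed (use l in auto)
  also have "\<dots> = \<Psi> (comult_left H h)" by (simp add: \<Psi>_def)
  also have "\<dots> = lift_bilinear ?K (\<lambda>a b. \<Psi> (pure_tensor HH H (comult H a) b)) (comult H h)"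
    unfolding comult_left_def Let_def
    by (rule linear_map_lift[of H H]) (use h in \<open>auto simp: \<Psi> U intro: pU\<close>)
  also have "\<dots> = lift_bilinear ?K (\<lambda>a b. comult_coeff a i j * coord k b) (comult H h)"
    by (rule lift_bilinear_cong[of H H]) (use h in \<open>auto simp: \<Psi>_pure p_comult\<close>)
  also have "\<dots> = (\<Sum>a\<in>B. comult_coeff h a k * comult_coeff a i j)"
    by (subst lift_comult) (auto simp: h ijk Sw_delta intro!: bilinear_map_mult_functionals coord_linear lin_comult_coeff)
  finally show ?thesis using R coassoc[OF h] by simp
qed

lemma Sw_coassoc:
  assumes h: "h \<in> C"
  shows "Sw h (\<lambda>a b. Sw a (\<lambda>c d. F c d b)) = Sw h (\<lambda>a b. Sw b (\<lambda>c d. F a c d))"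
proof -
  have "Sw h (\<lambda>a b. Sw a (\<lambda>c d. F c d b)) =
      (\<Sum>a\<in>B. \<Sum>k\<in>B. \<Sum>p\<in>B \<times> B. comult_coeff h a k * comult_coeff a (fst p) (snd p) * F (fst p) (snd p) k)"
    unfolding Sw_pairs[of _ "\<lambda>c d. F c d _"] by (simp add: Sw_def sum_distrib_left mult.assoc)
  also have "\<dots> = (\<Sum>k\<in>B. \<Sum>a\<in>B. \<Sum>p\<in>B \<times> B. comult_coeff h a k * comult_coeff a (fst p) (snd p) * F (fst p) (snd p) k)"
    by (rule sum.swap)
  also have "\<dots> = (\<Sum>k\<in>B. \<Sum>p\<in>B \<times> B. (\<Sum>a\<in>B. comult_coeff h a k * comult_coeff a (fst p) (snd p)) * F (fst p) (snd p) k)"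
    unfolding sum_distrib_right by (intro sum.cong refl sum.swap)
  also have "\<dots> = (\<Sum>p\<in>B \<times> B. \<Sum>k\<in>B. (\<Sum>a\<in>B. comult_coeff h a k * comult_coeff a (fst p) (snd p)) * F (fst p) (snd p) k)"
    by (rule sum.swap)
  also have "\<dots> = (\<Sum>i\<in>B. \<Sum>j\<in>B. \<Sum>k\<in>B. (\<Sum>a\<in>B. comult_coeff h a k * comult_coeff a i j) * F i j k)"
    by (rule sum_pairs)
  \<comment> \<open>With the sums exchanged, the values of \<open>F\<close> at basis triples are
    isolated and the intermediate index occurs only in the structure constants.\<close>
  also have "\<dots> = (\<Sum>i\<in>B. \<Sum>j\<in>B. \<Sum>k\<in>B. (\<Sum>b\<in>B. comult_coeff h i b * comult_coeff b j k) * F i j k)"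
    using coassoc_coeff[OF h] by (intro sum.cong refl) simp
  also have "\<dots> = (\<Sum>i\<in>B. \<Sum>q\<in>B \<times> B. \<Sum>b\<in>B. comult_coeff h i b * comult_coeff b (fst q) (snd q) * F i (fst q) (snd q))"
    unfolding sum_distrib_right by (intro sum.cong refl sum_pairs[symmetric])
  also have "\<dots> = (\<Sum>i\<in>B. \<Sum>b\<in>B. \<Sum>q\<in>B \<times> B. comult_coeff h i b * comult_coeff b (fst q) (snd q) * F i (fst q) (snd q))"
    by (intro sum.cong refl sum.swap)
  also have "\<dots> = Sw h (\<lambda>a b. Sw b (\<lambda>c d. F a c d))"
    unfolding Sw_pairs[of _ "\<lambda>c d. F _ c d"] by (simp add: Sw_def sum_distrib_left mult.assoc)
  finally show ?thesis .
qed

section \<open>The remaining Hopf axioms as identities of Sweedler sums\<close>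

lemma Sw_counit_left:
  assumes "lin \<xi>" "h \<in> C"
  shows "Sw h (\<lambda>a b. \<epsilon> a * \<xi> b) = \<xi> h"
proof -
  have b: "bil (\<lambda>a b. \<epsilon> a * \<xi> b)" by (intro bilinear_map_mult_functionals counit_linear assms)
  have "\<xi> h = \<xi> (lift_bilinear H (\<lambda>a b. \<epsilon> a \<odot> b) (comult H h))" using counit_left[OF assms(2)] by simp
  also have "\<dots> = lift_bilinear scalar_space (\<lambda>a b. \<xi> (\<epsilon> a \<odot> b)) (comult H h)"
    by (rule linear_map_lift[of H H]) (use assms in auto)
  also have "\<dots> = lift_bilinear scalar_space (\<lambda>a b. \<epsilon> a * \<xi> b) (comult H h)"
    by (rule lift_bilinear_cong[of H H]) (use assms linear_map_smult[OF assms(1)] in auto)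
  finally show ?thesis using lift_comult[OF b assms(2)] by simp
qed

lemma Sw_counit_right:
  assumes "lin \<xi>" "h \<in> C"
  shows "Sw h (\<lambda>a b. \<epsilon> b * \<xi> a) = \<xi> h"
proof -
  have b: "bil (\<lambda>a b. \<xi> a * \<epsilon> b)" by (intro bilinear_map_mult_functionals counit_linear assms)
  have "\<xi> h = \<xi> (lift_bilinear H (\<lambda>a b. \<epsilon> b \<odot> a) (comult H h))" using counit_right[OF assms(2)] by simp
  also have "\<dots> = lift_bilinear scalar_space (\<lambda>a b. \<xi> (\<epsilon> b \<odot> a)) (comult H h)"
    by (rule linear_map_lift[of H H]) (use assms in auto)
  also have "\<dots> = lift_bilinear scalar_space (\<lambda>a b. \<xi> a * \<epsilon> b) (comult H h)"
    by (rule lift_bilinear_cong[of H H]) (use assms linear_map_smult[OF assms(1)] in auto)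
  finally show ?thesis using lift_comult[OF b assms(2)] by (simp add: mult.commute)
qed

lemma Sw_antipode_left:
  assumes "lin \<xi>" "h \<in> C"
  shows "Sw h (\<lambda>a b. \<xi> (S a \<otimes> b)) = \<epsilon> h * \<xi> \<one>"
proof -
  have b: "bil (\<lambda>a b. \<xi> (S a \<otimes> b))"
    by (intro bilI lin_comp[OF assms(1)] endo_intros) auto
  have "\<xi> (\<epsilon> h \<odot> \<one>) = \<xi> (lift_bilinear H (\<lambda>a b. S a \<otimes> b) (comult H h))" using antipode_left[OF assms(2)] by simp
  also have "\<dots> = lift_bilinear scalar_space (\<lambda>a b. \<xi> (S a \<otimes> b)) (comult H h)"
    by (rule linear_map_lift[of H H]) (use assms in auto)
  finally show ?thesis using lift_comult[OF b assms(2)] linear_map_smult[OF assms(1), of \<one>] by simp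
qed

lemma Sw_antipode_right:
  assumes "lin \<xi>" "h \<in> C"
  shows "Sw h (\<lambda>a b. \<xi> (a \<otimes> S b)) = \<epsilon> h * \<xi> \<one>"
proof -
  have b: "bil (\<lambda>a b. \<xi> (a \<otimes> S b))"
    by (intro bilI lin_comp[OF assms(1)] endo_intros) auto
  have "\<xi> (\<epsilon> h \<odot> \<one>) = \<xi> (lift_bilinear H (\<lambda>a b. a \<otimes> S b) (comult H h))" using antipode_right[OF assms(2)] by simp
  also have "\<dots> = lift_bilinear scalar_space (\<lambda>a b. \<xi> (a \<otimes> S b)) (comult H h)"
    by (rule linear_map_lift[of H H]) (use assms in auto)
  finally show ?thesis using lift_comult[OF b assms(2)] linear_map_smult[OF assms(1), of \<one>] by simp
qed

lemma Sw_one: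
  assumes "bil F"
  shows "Sw \<one> F = F \<one> \<one>"
  using lift_comult[OF assms, of \<one>] lift_bilinear_pure[OF _ _ _ assms, of \<one> \<one>] comult_one by simp

text \<open>This is \<open>comult_mult\<close> seen through the functional \<open>L\<close> that
  \<open>F\<close> induces on the tensor square; the two lifts in \<open>tensor_mult\<close> give
  the two sums.\<close>

lemma Sw_product:
  assumes F: "bil F" and g: "g \<in> C" and h: "h \<in> C"
  shows "Sw (g \<otimes> h) F = Sw g (\<lambda>a b. Sw h (\<lambda>c d. F (a \<otimes> c) (b \<otimes> d)))"
proof -
  let ?K = "scalar_space :: ('k, 'k) module"
  define L where "L = lift_bilinear ?K F"
  have L: "functional HH L" unfolding L_def by (rule linear_map_lift_bilinear) (simp_all add: F)
  have Lp: "L (pure_tensor H H a b) = F a b" if "a \<in> C" "b \<in> C" for a b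
    unfolding L_def by (rule lift_bilinear_pure[OF _ _ _ F]) (use that in simp_all)
  have cl: "lift_bilinear HH (\<lambda>a' b'. pure_tensor H H (a \<otimes> a') (b \<otimes> b')) (comult H h) \<in> carrier HH"
    if "a \<in> C" "b \<in> C" for a b
    by (rule lift_bilinear_closed[of H H]) (use that h in auto)
  have Fb: "bil (\<lambda>c d. F (a \<otimes> c) (b \<otimes> d))" if "a \<in> C" "b \<in> C" for a b
    by (intro bilI lin_bil[OF F] endo_intros) (use that in auto)
  have Fa: "bil (\<lambda>a b. Sw h (\<lambda>c d. F (a \<otimes> c) (b \<otimes> d)))"
    by (intro bilI lin_Sw_arg lin_bil[OF F] endo_intros) auto
  have "Sw (g \<otimes> h) F = L (comult H (g \<otimes> h))"
    using lift_comult[OF F, of "g \<otimes> h"] g h by (simp add: L_def)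
  also have "\<dots> = L (tensor_mult H H (comult H g) (comult H h))"
    using comult_mult[OF g h] by simp
  also have "\<dots> = lift_bilinear ?K (\<lambda>a b. L (lift_bilinear HH
        (\<lambda>a' b'. pure_tensor H H (a \<otimes> a') (b \<otimes> b')) (comult H h))) (comult H g)"
    unfolding tensor_mult_def Let_def
    by (rule linear_map_lift[of H H]) (use g in \<open>auto simp: L intro: cl\<close>)
  also have "\<dots> = lift_bilinear ?K (\<lambda>a b. Sw h (\<lambda>c d. F (a \<otimes> c) (b \<otimes> d))) (comult H g)"
  proof (rule lift_bilinear_cong[of H H])
    fix a b assume ab: "a \<in> C" "b \<in> C"
    have "L (lift_bilinear HH (\<lambda>a' b'. pure_tensor H H (a \<otimes> a') (b \<otimes> b')) (comult H h)) =
      lift_bilinear ?K (\<lambda>a' b'. L (pure_tensor H H (a \<otimes> a') (b \<otimes> b'))) (comult H h)"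
      by (rule linear_map_lift[of H H]) (use ab h in \<open>auto simp: L\<close>)
    also have "\<dots> = lift_bilinear ?K (\<lambda>a' b'. F (a \<otimes> a') (b \<otimes> b')) (comult H h)"
      by (rule lift_bilinear_cong[of H H]) (use ab h in \<open>auto simp: Lp\<close>)
    also have "\<dots> = Sw h (\<lambda>c d. F (a \<otimes> c) (b \<otimes> d))"
      by (rule lift_comult[OF Fb[OF ab] h])
    finally show "L (lift_bilinear HH (\<lambda>a' b'. pure_tensor H H (a \<otimes> a') (b \<otimes> b')) (comult H h)) =
      Sw h (\<lambda>c d. F (a \<otimes> c) (b \<otimes> d))" .
  qed (use g in auto)
  also have "\<dots> = Sw g (\<lambda>a b. Sw h (\<lambda>c d. F (a \<otimes> c) (b \<otimes> d)))"
    by (rule lift_comult[OF Fa g])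
  finally show ?thesis .
qed


lemma functionals_separate:
  assumes "v \<in> C" "w \<in> C" "\<And>\<xi>. lin \<xi> \<Longrightarrow> \<xi> v = \<xi> w"
  shows "v = w"
  using assms by (intro coord_eqI assms(3) coord_linear)

subsection \<open>The antipode\<close>

text \<open>
  Evaluate \<open>S(g\<^sub>1 h\<^sub>1) g\<^sub>2 h\<^sub>2 S(h\<^sub>3) S(g\<^sub>3)\<close> in two ways: contracting the left half leaves
  \<open>S(h) S(g)\<close>, contracting the right half leaves \<open>S(g h)\<close>.
\<close>

lemma antipode_mult:
  assumes g: "g \<in> C" and h: "h \<in> C"
  shows "S (g \<otimes> h) = S h \<otimes> S g"
proof (rule functionals_separate)
  fix \<xi> assume \<xi>: "lin \<xi>"
  define M where "M g1 g2 g3 h1 h2 h3 = \<xi> ((S (g1 \<otimes> h1) \<otimes> (g2 \<otimes> h2)) \<otimes> (S h3 \<otimes> S g3))"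
    for g1 g2 g3 h1 h2 h3
  define E where "E = Sw g (\<lambda>g1 g'. Sw g' (\<lambda>g2 g3. Sw h (\<lambda>h1 h'. Sw h' (\<lambda>h2 h3. M g1 g2 g3 h1 h2 h3))))"
  have "E = \<xi> (S (g \<otimes> h))"
  proof -
    have 1: "Sw h' (\<lambda>h2 h3. M g1 g2 g3 h1 h2 h3) = \<epsilon> h' * \<xi> (S (g1 \<otimes> h1) \<otimes> (g2 \<otimes> S g3))"
      if c: "g1 \<in> C" "g2 \<in> C" "g3 \<in> C" "h1 \<in> C" "h' \<in> C" for g1 g2 g3 h1 h'
    proof -
      let ?f = "\<lambda>x. \<xi> ((S (g1 \<otimes> h1) \<otimes> g2) \<otimes> (x \<otimes> S g3))"
      have "Sw h' (\<lambda>h2 h3. M g1 g2 g3 h1 h2 h3) = Sw h' (\<lambda>h2 h3. ?f (h2 \<otimes> S h3))"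
        by (rule Sw_cong) (use c in \<open>simp add: M_def m_assoc\<close>)
      also have "\<dots> = \<epsilon> h' * ?f \<one>"
        by (intro Sw_antipode_right lin_comp[OF \<xi>] endo_intros) (use c in auto)
      finally show ?thesis using c by (simp add: m_assoc)
    qed
    have 2: "Sw h (\<lambda>h1 h'. \<epsilon> h' * \<xi> (S (g1 \<otimes> h1) \<otimes> (g2 \<otimes> S g3))) = \<xi> (S (g1 \<otimes> h) \<otimes> (g2 \<otimes> S g3))"
      if c: "g1 \<in> C" "g2 \<in> C" "g3 \<in> C" for g1 g2 g3
      by (rule Sw_counit_right, intro lin_comp[OF \<xi>] endo_intros) (use c h in auto)
    have 3: "Sw g' (\<lambda>g2 g3. \<xi> (S (g1 \<otimes> h) \<otimes> (g2 \<otimes> S g3))) = \<epsilon> g' * \<xi> (S (g1 \<otimes> h) \<otimes> \<one>)"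
      if c: "g1 \<in> C" "g' \<in> C" for g1 g'
      by (rule Sw_antipode_right, intro lin_comp[OF \<xi>] endo_intros) (use c h in auto)
    have 4: "Sw g (\<lambda>g1 g'. \<epsilon> g' * \<xi> (S (g1 \<otimes> h) \<otimes> \<one>)) = \<xi> (S (g \<otimes> h) \<otimes> \<one>)"
      by (rule Sw_counit_right, intro lin_comp[OF \<xi>] endo_intros) (use h g in auto)
    have "E = Sw g (\<lambda>g1 g'. Sw g' (\<lambda>g2 g3. Sw h (\<lambda>h1 h'.
        \<epsilon> h' * \<xi> (S (g1 \<otimes> h1) \<otimes> (g2 \<otimes> S g3)))))"
      unfolding E_def by (intro Sw_cong 1)
    also have "\<dots> = Sw g (\<lambda>g1 g'. Sw g' (\<lambda>g2 g3. \<xi> (S (g1 \<otimes> h) \<otimes> (g2 \<otimes> S g3))))"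
      by (intro Sw_cong 2)
    also have "\<dots> = Sw g (\<lambda>g1 g'. \<epsilon> g' * \<xi> (S (g1 \<otimes> h) \<otimes> \<one>))"
      by (intro Sw_cong 3)
    finally show ?thesis using 4 g h by simp
  qed
  moreover have "E = \<xi> (S h \<otimes> S g)"
  proof -
    have 1: "Sw g' (\<lambda>g1 g2. Sw h' (\<lambda>h1 h2. M g1 g2 g3 h1 h2 h3)) = \<epsilon> g' * (\<epsilon> h' * \<xi> (S h3 \<otimes> S g3))"
      if c: "g' \<in> C" "g3 \<in> C" "h' \<in> C" "h3 \<in> C" for g' g3 h' h3
    proof -
      let ?f = "\<lambda>x. \<xi> (x \<otimes> (S h3 \<otimes> S g3))"
      have b: "bil (\<lambda>p q. ?f (S p \<otimes> q))"
        by (intro bilI lin_comp[OF \<xi>] endo_intros) (use c in auto)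
      \<comment> \<open>The antipode equation is used for the product as a whole;
        \<open>Sw_product\<close> then splits its coproduct into the legs of both factors.\<close>
      have "Sw (g' \<otimes> h') (\<lambda>p q. ?f (S p \<otimes> q)) = \<epsilon> (g' \<otimes> h') * ?f \<one>"
        by (intro Sw_antipode_left lin_comp[OF \<xi>] endo_intros) (use c in auto)
      then show ?thesis
        using Sw_product[OF b c(1,3)] c by (simp add: M_def counit_mult mult.assoc)
    qed
    \<comment> \<open>The sum \<open>E\<close> groups the last two legs of \<open>g\<close> and of
      \<open>h\<close>; here the first two are grouped instead, which is the bracketing that the
      left contraction requires.\<close>
    have "E = Sw g (\<lambda>g' g3. Sw g' (\<lambda>g1 g2. Sw h (\<lambda>h1 h'. Sw h' (\<lambda>h2 h3. M g1 g2 g3 h1 h2 h3))))"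
      unfolding E_def by (rule Sw_coassoc[OF g, symmetric])
    also have "\<dots> = Sw g (\<lambda>g' g3. Sw g' (\<lambda>g1 g2. Sw h (\<lambda>h' h3. Sw h' (\<lambda>h1 h2. M g1 g2 g3 h1 h2 h3))))"
      by (intro Sw_cong Sw_coassoc[OF h, symmetric])
    also have "\<dots> = Sw g (\<lambda>g' g3. Sw h (\<lambda>h' h3. Sw g' (\<lambda>g1 g2. Sw h' (\<lambda>h1 h2. M g1 g2 g3 h1 h2 h3))))"
      by (intro Sw_cong Sw_swap)
    also have "\<dots> = Sw g (\<lambda>g' g3. Sw h (\<lambda>h' h3. \<epsilon> g' * (\<epsilon> h' * \<xi> (S h3 \<otimes> S g3))))"
      by (intro Sw_cong 1)
    also have "\<dots> = Sw g (\<lambda>g' g3. \<epsilon> g' * \<xi> (S h \<otimes> S g3))"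
    proof (rule Sw_cong)
      fix g' g3 assume c: "g' \<in> C" "g3 \<in> C"
      have "Sw h (\<lambda>h' h3. \<epsilon> h' * \<xi> (S h3 \<otimes> S g3)) = \<xi> (S h \<otimes> S g3)"
        by (rule Sw_counit_left, intro lin_comp[OF \<xi>] endo_intros) (use c h in auto)
      then show "Sw h (\<lambda>h' h3. \<epsilon> g' * (\<epsilon> h' * \<xi> (S h3 \<otimes> S g3))) = \<epsilon> g' * \<xi> (S h \<otimes> S g3)"
        by (simp add: Sw_mult)
    qed
    also have "\<dots> = \<xi> (S h \<otimes> S g)"
      by (rule Sw_counit_left, intro lin_comp[OF \<xi>] endo_intros) (use g h in auto)
    finally show ?thesis .
  qed
  ultimately show "\<xi> (S (g \<otimes> h)) = \<xi> (S h \<otimes> S g)" by simp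
qed (use g h in auto)

text \<open>Evaluate \<open>\<Delta>(S(h\<^sub>1)) \<Delta>(h\<^sub>2) (S(h\<^sub>4) \<otimes> S(h\<^sub>3))\<close> in two ways.\<close>

lemma Sw_antipode:
  assumes F: "bil F" and h: "h \<in> C"
  shows "Sw (S h) F = Sw h (\<lambda>a b. F (S b) (S a))"
proof -
  define K where "K p q r s h3 h4 = F (p \<otimes> (r \<otimes> S h4)) (q \<otimes> (s \<otimes> S h3))" for p q r s h3 h4
  define E where "E = Sw h (\<lambda>h1 h'. Sw h' (\<lambda>h2 h''. Sw h'' (\<lambda>h3 h4.
      Sw h2 (\<lambda>r s. Sw (S h1) (\<lambda>p q. K p q r s h3 h4)))))"
  have Flin: "lin (\<lambda>x. F (f x) b)" if "endo f" "b \<in> C" for f b using lin_bil(1)[OF F that] .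
  have Flin': "lin (\<lambda>x. F b (f x))" if "endo f" "b \<in> C" for f b using lin_bil(2)[OF F that] .
  have "E = Sw (S h) F"
  proof -
    have 1: "Sw h' (\<lambda>h2 h''. Sw h'' (\<lambda>h3 h4. Sw h2 (\<lambda>r s. K p q r s h3 h4))) = \<epsilon> h' * F p q"
      if c: "p \<in> C" "q \<in> C" "h' \<in> C" for p q h'
    proof -
      \<comment> \<open>The cancellation works from the inside out: the adjacent legs
        \<open>s\<close> and \<open>h3\<close> annihilate in the second slot, the counit absorbs
        what they leave, and afterwards \<open>r\<close> meets the antipode of \<open>x\<close> in
        the first slot.\<close>
      have a: "Sw x (\<lambda>s y. Sw y (\<lambda>h3 h4. K p q r s h3 h4)) = F (p \<otimes> (r \<otimes> S x)) q"
        if r: "r \<in> C" "x \<in> C" for r x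
      proof -
        have i: "Sw z (\<lambda>s h3. K p q r s h3 h4) = \<epsilon> z * F (p \<otimes> (r \<otimes> S h4)) (q \<otimes> \<one>)"
          if "z \<in> C" "h4 \<in> C" for z h4
          unfolding K_def
          by (rule Sw_antipode_right, intro Flin' endo_intros) (use c r that in auto)
        have "Sw x (\<lambda>s y. Sw y (\<lambda>h3 h4. K p q r s h3 h4)) = Sw x (\<lambda>z h4. Sw z (\<lambda>s h3. K p q r s h3 h4))"
          by (rule Sw_coassoc[OF r(2), symmetric])
        also have "\<dots> = Sw x (\<lambda>z h4. \<epsilon> z * F (p \<otimes> (r \<otimes> S h4)) (q \<otimes> \<one>))"
          by (intro Sw_cong i)
        also have "\<dots> = F (p \<otimes> (r \<otimes> S x)) (q \<otimes> \<one>)"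
          by (rule Sw_counit_left, intro Flin endo_intros) (use c r in auto)
        finally show ?thesis using c by simp
      qed
      have "Sw h' (\<lambda>h2 h''. Sw h'' (\<lambda>h3 h4. Sw h2 (\<lambda>r s. K p q r s h3 h4)))
          = Sw h' (\<lambda>h2 h''. Sw h2 (\<lambda>r s. Sw h'' (\<lambda>h3 h4. K p q r s h3 h4)))"
        by (intro Sw_cong Sw_swap)
      also have "\<dots> = Sw h' (\<lambda>r x. Sw x (\<lambda>s h''. Sw h'' (\<lambda>h3 h4. K p q r s h3 h4)))"
        by (rule Sw_coassoc[OF c(3)])
      also have "\<dots> = Sw h' (\<lambda>r x. F (p \<otimes> (r \<otimes> S x)) q)"
        by (intro Sw_cong a)
      also have "\<dots> = \<epsilon> h' * F (p \<otimes> \<one>) q"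
        by (rule Sw_antipode_right, intro Flin endo_intros) (use c in auto)
      finally show ?thesis using c by simp
    qed
    have "E = Sw h (\<lambda>h1 h'. Sw h' (\<lambda>h2 h''. Sw h'' (\<lambda>h3 h4. Sw (S h1) (\<lambda>p q.
        Sw h2 (\<lambda>r s. K p q r s h3 h4)))))"
      unfolding E_def by (intro Sw_cong Sw_swap)
    also have "\<dots> = Sw h (\<lambda>h1 h'. Sw h' (\<lambda>h2 h''. Sw (S h1) (\<lambda>p q. Sw h'' (\<lambda>h3 h4.
        Sw h2 (\<lambda>r s. K p q r s h3 h4)))))"
      by (intro Sw_cong Sw_swap)
    also have "\<dots> = Sw h (\<lambda>h1 h'. Sw (S h1) (\<lambda>p q. Sw h' (\<lambda>h2 h''. Sw h'' (\<lambda>h3 h4.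
        Sw h2 (\<lambda>r s. K p q r s h3 h4)))))"
      by (intro Sw_cong Sw_swap)
    also have "\<dots> = Sw h (\<lambda>h1 h'. Sw (S h1) (\<lambda>p q. \<epsilon> h' * F p q))"
      by (intro Sw_cong 1)
    also have "\<dots> = Sw (S h) F"
      unfolding Sw_mult by (rule Sw_counit_right, intro lin_comp[OF lin_Sw] endo_intros) (use h in auto)
    finally show ?thesis .
  qed
  moreover have "E = Sw h (\<lambda>a b. F (S b) (S a))"
  proof -
    \<comment> \<open>Since the coproduct is multiplicative, the first two factors combine to the
      coproduct of S(h_1) h_2, which contracts to a multiple of the coproduct of the unit.\<close>
    have 1: "Sw z (\<lambda>h1 h2. Sw h2 (\<lambda>r s. Sw (S h1) (\<lambda>p q. K p q r s h3 h4))) = \<epsilon> z * F (S h4) (S h3)"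
      if c: "z \<in> C" "h3 \<in> C" "h4 \<in> C" for z h3 h4
    proof -
      define G where "G u v = F (u \<otimes> S h4) (v \<otimes> S h3)" for u v
      have G: "bil G" unfolding G_def
        by (intro bilI Flin Flin' endo_intros) (use c in auto)
      have "Sw z (\<lambda>h1 h2. Sw h2 (\<lambda>r s. Sw (S h1) (\<lambda>p q. K p q r s h3 h4))) =
          Sw z (\<lambda>h1 h2. Sw (S h1) (\<lambda>p q. Sw h2 (\<lambda>r s. K p q r s h3 h4)))"
        by (intro Sw_cong Sw_swap)
      also have "\<dots> = Sw z (\<lambda>h1 h2. Sw (S h1 \<otimes> h2) G)"
      proof (rule Sw_cong)
        fix h1 h2 assume d: "h1 \<in> C" "h2 \<in> C"
        show "Sw (S h1) (\<lambda>p q. Sw h2 (\<lambda>r s. K p q r s h3 h4)) = Sw (S h1 \<otimes> h2) G"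
          unfolding Sw_product[OF G antipode_closed[OF d(1)] d(2)]
          by (intro Sw_cong) (use c in \<open>simp add: K_def G_def m_assoc\<close>)
      qed
      also have "\<dots> = \<epsilon> z * Sw \<one> G"
        by (rule Sw_antipode_left[OF lin_Sw c(1)])
      finally show ?thesis using Sw_one[OF G] c by (simp add: G_def)
    qed
    have "E = Sw h (\<lambda>z h''. Sw z (\<lambda>h1 h2. Sw h'' (\<lambda>h3 h4. Sw h2 (\<lambda>r s. Sw (S h1) (\<lambda>p q. K p q r s h3 h4)))))"
      unfolding E_def by (rule Sw_coassoc[OF h, symmetric])
    also have "\<dots> = Sw h (\<lambda>z h''. Sw h'' (\<lambda>h3 h4. Sw z (\<lambda>h1 h2. Sw h2 (\<lambda>r s. Sw (S h1) (\<lambda>p q. K p q r s h3 h4)))))"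
      by (intro Sw_cong Sw_swap)
    also have "\<dots> = Sw h (\<lambda>z h''. Sw h'' (\<lambda>h3 h4. \<epsilon> z * F (S h4) (S h3)))"
      by (intro Sw_cong 1)
    also have "\<dots> = Sw h (\<lambda>h3 h4. F (S h4) (S h3))"
      unfolding Sw_mult by (rule Sw_counit_left[OF lin_Sw h])
    finally show ?thesis .
  qed
  ultimately show ?thesis by simp
qed

lemma antipode_one: "S \<one> = \<one>"
proof (rule functionals_separate)
  fix \<xi> assume \<xi>: "lin \<xi>"
  have b: "bil (\<lambda>a b. \<xi> (S a \<otimes> b))" by (intro bilI lin_comp[OF \<xi>] endo_intros) auto
  show "\<xi> (S \<one>) = \<xi> \<one>"
    using Sw_antipode_left[OF \<xi> one_closed] Sw_one[OF b] by (simp add: counit_one)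
qed auto

text \<open>Apply the counit to S(h_1) h_2 and use its multiplicativity; the counit of the second
  leg then absorbs that leg.\<close>

lemma counit_antipode:
  assumes h: "h \<in> C"
  shows "\<epsilon> (S h) = \<epsilon> h"
proof -
  have "\<epsilon> h = Sw h (\<lambda>a b. \<epsilon> (S a \<otimes> b))"
    using Sw_antipode_left[OF counit_linear h] by (simp add: counit_one)
  also have "\<dots> = Sw h (\<lambda>a b. \<epsilon> b * \<epsilon> (S a))"
    by (rule Sw_cong) (simp add: counit_mult)
  also have "\<dots> = \<epsilon> (S h)"
    by (rule Sw_counit_right, intro lin_comp[OF counit_linear] endo_intros) (rule h)
  finally show ?thesis by simp
qed

section \<open>The inverse antipode\<close>

lemma Si_closed [simp, intro]: "h \<in> C \<Longrightarrow> Si h \<in> C"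
  using antipode_bij by (metis bij_betw_imp_surj_on inv_into_into)

lemma antipode_Si [simp]: "h \<in> C \<Longrightarrow> S (Si h) = h"
  using antipode_bij by (metis bij_betw_inv_into_right)

lemma Si_antipode [simp]: "h \<in> C \<Longrightarrow> Si (S h) = h"
  using antipode_bij by (metis bij_betw_inv_into_left)

lemma Si_eqI: "\<lbrakk>x \<in> C; S x = y\<rbrakk> \<Longrightarrow> Si y = x"
  using Si_antipode by auto

lemma endo_Si: "endo g \<Longrightarrow> endo (\<lambda>x. Si (g x))"
proof -
  have "endo Si"
    unfolding linear_map_def
    by (auto intro!: Si_eqI simp: linear_map_add[OF antipode_linear] linear_map_smult[OF antipode_linear])
  then show "endo g \<Longrightarrow> endo (\<lambda>x. Si (g x))" by (rule linear_map_compose)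
qed

lemma Si_mult: "\<lbrakk>g \<in> C; h \<in> C\<rbrakk> \<Longrightarrow> Si (g \<otimes> h) = Si h \<otimes> Si g"
  by (rule Si_eqI) (auto simp: antipode_mult)

lemma Si_one: "Si \<one> = \<one>"
  by (rule Si_eqI) (auto simp: antipode_one)

lemma counit_Si: "h \<in> C \<Longrightarrow> \<epsilon> (Si h) = \<epsilon> h"
  using counit_antipode[of "Si h"] by simp

text \<open>Read \<open>Sw_antipode\<close> backwards: it is applied at \<open>Si h\<close>, to the
  form whose arguments are swapped and preceded by \<open>Si\<close>, so that \<open>S\<close> and
  \<open>Si\<close> cancel in each slot.\<close>

lemma Sw_Si:
  assumes F: "bil F" and h: "h \<in> C"
  shows "Sw (Si h) F = Sw h (\<lambda>a b. F (Si b) (Si a))"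
proof -
  have b: "bil (\<lambda>a b. F (Si b) (Si a))"
    by (intro bilI lin_bil[OF F] endo_Si endo_intros) auto
  have "Sw h (\<lambda>a b. F (Si b) (Si a)) = Sw (S (Si h)) (\<lambda>a b. F (Si b) (Si a))" using h by simp
  also have "\<dots> = Sw (Si h) (\<lambda>a b. F (Si (S a)) (Si (S b)))"
    by (rule Sw_antipode[OF b]) (use h in auto)
  also have "\<dots> = Sw (Si h) F"
    by (rule Sw_cong) simp
  finally show ?thesis by simp
qed

text \<open>Two reversals of the legs cancel.\<close>

lemma Sw_antipode2:
  assumes F: "bil F" and h: "h \<in> C"
  shows "Sw (S (S h)) F = Sw h (\<lambda>a b. F (S (S a)) (S (S b)))"
proof -
  have b: "bil (\<lambda>a b. F (S b) (S a))"
    by (intro bilI lin_bil[OF F] endo_intros) auto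
  show ?thesis using Sw_antipode[OF F, of "S h"] Sw_antipode[OF b h] h by simp
qed


subsection \<open>The dual\<close>

abbreviation "D \<equiv> dual_hopf H"
abbreviation "DD \<equiv> tensor_product D D"

lemma vspace_D [simp]: "vspace D"
proof (rule vspaceI)
  fix f g c assume f: "f \<in> carrier D"
  show "c \<odot>\<^bsub>D\<^esub> f \<in> carrier D"
    using f by (auto simp: dual_hopf_simps linear_map_def algebra_simps)
  assume g: "g \<in> carrier D"
  show "f \<oplus>\<^bsub>D\<^esub> g \<in> carrier D"
    using f g by (auto simp: dual_hopf_simps linear_map_def algebra_simps)
  show "c \<odot>\<^bsub>D\<^esub> (f \<oplus>\<^bsub>D\<^esub> g) = c \<odot>\<^bsub>D\<^esub> f \<oplus>\<^bsub>D\<^esub> c \<odot>\<^bsub>D\<^esub> g"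
    by (auto simp: dual_hopf_simps algebra_simps)
qed (auto simp: dual_hopf_simps linear_map_def algebra_simps extensional_def fun_eq_iff)

lemma vspace_DD [simp]: "vspace DD" by (rule vspace_tensor_product) simp_all

lemma D_lin: "f \<in> carrier D \<Longrightarrow> lin f"
  by (simp add: dual_hopf_simps)

lemma D_restrict: "lin f \<Longrightarrow> restrict f C \<in> carrier D"
  by (auto simp: dual_hopf_simps linear_map_def)

lemma D_eqI: "\<lbrakk>f \<in> carrier D; g \<in> carrier D; \<And>x. x \<in> C \<Longrightarrow> f x = g x\<rbrakk> \<Longrightarrow> f = g"
  by (auto simp: dual_hopf_simps intro: extensionalityI)

lemma functional_eval: "x \<in> C \<Longrightarrow> functional D (\<lambda>f. f x)"
  by (auto simp: linear_map_def dual_hopf_simps)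

text \<open>Elements of the dual are extensional, so equality in \<open>D\<close> is equality at
  every point of \<open>C\<close>, and linearity can be tested by evaluation.\<close>

lemma linear_map_DI:
  assumes V: "vspace V" and "\<And>v. v \<in> carrier V \<Longrightarrow> g v \<in> carrier D"
    and "\<And>x. x \<in> C \<Longrightarrow> functional V (\<lambda>v. g v x)"
  shows "linear_map V D g"
proof -
  interpret V: module scalars V by fact
  interpret D: module scalars D by simp
  show ?thesis
    unfolding linear_map_def
  proof (intro conjI ballI allI funcsetI)
    fix u v assume uv: "u \<in> carrier V" "v \<in> carrier V"
    show "g (u \<oplus>\<^bsub>V\<^esub> v) = g u \<oplus>\<^bsub>D\<^esub> g v"
      by (rule D_eqI)
         (use uv assms(2) linear_map_add[OF assms(3)] linear_map_add[OF functional_eval] in auto)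
  next
    fix c v assume v: "v \<in> carrier V"
    show "g (c \<odot>\<^bsub>V\<^esub> v) = c \<odot>\<^bsub>D\<^esub> g v"
      by (rule D_eqI)
         (use v assms(2) linear_map_smult[OF assms(3)] linear_map_smult[OF functional_eval] in auto)
  qed (use assms(2) in auto)
qed

text \<open>Restriction turns the coordinate functional into an extensional function, as membership
  in \<open>D\<close> demands.\<close>

definition dual_basis :: "'a \<Rightarrow> 'a \<Rightarrow> 'k" where
  "dual_basis b = restrict (coord b) C"

lemma dual_basis_closed [simp]: "b \<in> B \<Longrightarrow> dual_basis b \<in> carrier D"
  unfolding dual_basis_def by (intro D_restrict coord_linear)

lemma dual_expand:
  assumes f: "f \<in> carrier D"
  shows "f = (\<Oplus>\<^bsub>D\<^esub>b\<in>B. f b \<odot>\<^bsub>D\<^esub> dual_basis b)"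
proof -
  interpret D: module scalars D by simp
  show ?thesis
  proof (rule D_eqI[OF f])
    show "(\<Oplus>\<^bsub>D\<^esub>b\<in>B. f b \<odot>\<^bsub>D\<^esub> dual_basis b) \<in> carrier D" by (rule D.finsum_closed) auto
    fix x assume x: "x \<in> C"
    have "(\<Oplus>\<^bsub>D\<^esub>b\<in>B. f b \<odot>\<^bsub>D\<^esub> dual_basis b) x = (\<Sum>b\<in>B. (f b \<odot>\<^bsub>D\<^esub> dual_basis b) x)"
      by (rule functional_sum[OF _ functional_eval[OF x]]) auto
    also have "\<dots> = (\<Sum>b\<in>B. coord b x * f b)"
      using x by (simp add: dual_hopf_simps dual_basis_def mult.commute)
    finally show "f x = (\<Oplus>\<^bsub>D\<^esub>b\<in>B. f b \<odot>\<^bsub>D\<^esub> dual_basis b) x"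
      using functional_expand[OF D_lin[OF f] x] by simp
  qed
qed

lemma functional_D_expand:
  assumes L: "functional D L" and f: "f \<in> carrier D"
  shows "L f = (\<Sum>b\<in>B. f b * L (dual_basis b))"
proof -
  interpret D: module scalars D by simp
  have "L f = L (\<Oplus>\<^bsub>D\<^esub>b\<in>B. f b \<odot>\<^bsub>D\<^esub> dual_basis b)" using dual_expand[OF f] by simp
  also have "\<dots> = (\<Sum>b\<in>B. L (f b \<odot>\<^bsub>D\<^esub> dual_basis b))"
    by (rule functional_sum[OF _ L]) auto
  finally show ?thesis using linear_map_smult[OF L] by simp
qed

text \<open>The definite description is justified here. Its condition fixes the values on pairs of
  basis vectors; these are the coordinates of a tensor with respect to products of dual basis
  elements, so they both construct it and, by \<open>tensor_expand\<close>, determine it.\<close>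

lemma dual_comult:
  assumes f: "f \<in> carrier D"
  shows "dual_comult H f \<in> carrier DD"
    and "\<lbrakk>a \<in> C; b \<in> C\<rbrakk> \<Longrightarrow>
      lift_bilinear scalar_space (\<lambda>f\<^sub>1 f\<^sub>2. f\<^sub>1 a * f\<^sub>2 b) (dual_comult H f) = f (a \<otimes> b)"
proof -
  interpret D: module scalars D by simp
  interpret DD: module scalars DD by simp
  let ?P = "\<lambda>t. t \<in> carrier DD \<and> (\<forall>a\<in>C. \<forall>b\<in>C.
      lift_bilinear scalar_space (\<lambda>f\<^sub>1 f\<^sub>2. f\<^sub>1 a * f\<^sub>2 b) t = f (a \<otimes> b))"
  have p: "pure_tensor D D (dual_basis i) (dual_basis j) \<in> carrier DD" if "i \<in> B" "j \<in> B" for i j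
    by (rule pure_tensor_closed) (use that in auto)
  have bf: "bil (\<lambda>a b. f (a \<otimes> b))"
    by (intro bilI lin_comp[OF D_lin[OF f]] endo_intros)
  have bd: "bilinear_form D D (\<lambda>f\<^sub>1 f\<^sub>2. f\<^sub>1 a * f\<^sub>2 b)" if "a \<in> C" "b \<in> C" for a b
    by (intro bilinear_map_mult_functionals functional_eval that)
  \<comment> \<open>The coordinate at \<open>i\<close> and \<open>j\<close> is the value that the
    description prescribes for the pair of basis vectors \<open>i\<close> and
    \<open>j\<close>.\<close>
  define t where "t = (\<Oplus>\<^bsub>DD\<^esub>i\<in>B. \<Oplus>\<^bsub>DD\<^esub>j\<in>B.
      f (i \<otimes> j) \<odot>\<^bsub>DD\<^esub> pure_tensor D D (dual_basis i) (dual_basis j))"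
  have inner: "(\<Oplus>\<^bsub>DD\<^esub>j\<in>B. f (i \<otimes> j) \<odot>\<^bsub>DD\<^esub> pure_tensor D D (dual_basis i) (dual_basis j)) \<in> carrier DD"
    if "i \<in> B" for i
    by (rule DD.finsum_closed) (use that p in auto)
  have "?P t"
  proof (intro conjI ballI)
    show "t \<in> carrier DD" unfolding t_def by (rule DD.finsum_closed) (use inner in auto)
    fix a b assume ab: "a \<in> C" "b \<in> C"
    define L where "L = lift_bilinear scalar_space (\<lambda>f\<^sub>1 f\<^sub>2. f\<^sub>1 a * f\<^sub>2 b :: 'k)"
    have L: "functional DD L" unfolding L_def by (rule linear_map_lift_bilinear) (use bd ab in auto)
    have Lp: "L (pure_tensor D D f\<^sub>1 f\<^sub>2) = f\<^sub>1 a * f\<^sub>2 b" if "f\<^sub>1 \<in> carrier D" "f\<^sub>2 \<in> carrier D" for f\<^sub>1 f\<^sub>2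
      unfolding L_def by (rule lift_bilinear_pure) (use bd ab that in auto)
    have "L t = (\<Sum>i\<in>B. L (\<Oplus>\<^bsub>DD\<^esub>j\<in>B. f (i \<otimes> j) \<odot>\<^bsub>DD\<^esub> pure_tensor D D (dual_basis i) (dual_basis j)))"
      unfolding t_def by (rule functional_sum[OF _ L]) (use inner in auto)
    also have "\<dots> = (\<Sum>i\<in>B. \<Sum>j\<in>B. L (f (i \<otimes> j) \<odot>\<^bsub>DD\<^esub> pure_tensor D D (dual_basis i) (dual_basis j)))"
      by (intro sum.cong refl functional_sum[OF _ L]) (use p in auto)
    also have "\<dots> = (\<Sum>i\<in>B. \<Sum>j\<in>B. f (i \<otimes> j) * (coord i a * coord j b))"
      by (intro sum.cong refl) (use ab p in \<open>simp add: linear_map_smult[OF L] Lp dual_basis_def[of _ , THEN fun_cong]\<close>)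
    also have "\<dots> = f (a \<otimes> b)" using bil_expand[OF bf ab] by simp
    finally show "lift_bilinear scalar_space (\<lambda>f\<^sub>1 f\<^sub>2. f\<^sub>1 a * f\<^sub>2 b) t = f (a \<otimes> b)"
      by (simp add: L_def)
  qed
  moreover have "s = t" if s: "?P s" for s
  proof -
    have e: "s = (\<Oplus>\<^bsub>DD\<^esub>i\<in>B. \<Oplus>\<^bsub>DD\<^esub>j\<in>B. lift_bilinear scalar_space (\<lambda>f\<^sub>1 f\<^sub>2. f\<^sub>1 i * f\<^sub>2 j) s \<odot>\<^bsub>DD\<^esub>
        pure_tensor D D (dual_basis i) (dual_basis j))" if "s \<in> carrier DD" for s
      by (rule tensor_expand) (use that functional_eval dual_expand in auto)
    have "s = (\<Oplus>\<^bsub>DD\<^esub>i\<in>B. \<Oplus>\<^bsub>DD\<^esub>j\<in>B. lift_bilinear scalar_space (\<lambda>f\<^sub>1 f\<^sub>2. f\<^sub>1 i * f\<^sub>2 j) s \<odot>\<^bsub>DD\<^esub>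
        pure_tensor D D (dual_basis i) (dual_basis j))"
      using s by (intro e) simp
    also have "\<dots> = t"
      unfolding t_def by (intro DD.finsum_cong' refl funcsetI inner DD.smult_closed p) (use s in auto)
    finally show ?thesis .
  qed
  ultimately have "?P (THE t. ?P t)" by (rule theI[of ?P])
  then have "?P (dual_comult H f)" unfolding dual_comult_def tensor_product_dual .
  then show "dual_comult H f \<in> carrier DD"
    and "\<lbrakk>a \<in> C; b \<in> C\<rbrakk> \<Longrightarrow>
      lift_bilinear scalar_space (\<lambda>f\<^sub>1 f\<^sub>2. f\<^sub>1 a * f\<^sub>2 b) (dual_comult H f) = f (a \<otimes> b)"
    by blast+
qed

lemma translate_closed:
  assumes "f \<in> carrier D" "u \<in> C"
  shows "(\<lambda>x\<in>C. f (u \<otimes> x)) \<in> carrier D" "(\<lambda>x\<in>C. f (x \<otimes> u)) \<in> carrier D"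
  using assms by (auto intro!: D_restrict lin_comp[OF D_lin] endo_intros)

text \<open>\<open>dual_comult\<close> covers the case where the remaining leg is evaluated at a
  point. In finite dimension every functional on the dual is a combination of evaluations at basis
  vectors, so the identity extends to all \<open>L\<close>.\<close>

lemma lift_dual_comult:
  assumes L: "functional D L" and f: "f \<in> carrier D" and u: "u \<in> C"
  shows "lift_bilinear scalar_space (\<lambda>f\<^sub>1 f\<^sub>2. f\<^sub>1 u * L f\<^sub>2) (dual_comult H f) = L (\<lambda>x\<in>C. f (u \<otimes> x))"
    and "lift_bilinear scalar_space (\<lambda>f\<^sub>1 f\<^sub>2. f\<^sub>2 u * L f\<^sub>1) (dual_comult H f) = L (\<lambda>x\<in>C. f (x \<otimes> u))"
proof -
  have "lift_bilinear scalar_space (\<lambda>f\<^sub>1 f\<^sub>2. f\<^sub>1 u * L f\<^sub>2) (dual_comult H f) =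
      lift_bilinear scalar_space (\<lambda>f\<^sub>1 f\<^sub>2. \<Sum>b\<in>B. L (dual_basis b) * (f\<^sub>1 u * f\<^sub>2 b)) (dual_comult H f)"
    by (rule lift_bilinear_cong[of D D])
       (use dual_comult(1)[OF f] functional_D_expand[OF L] in \<open>auto simp: sum_distrib_left mult_ac\<close>)
  also have "\<dots> = (\<Sum>b\<in>B. f (u \<otimes> b) * L (dual_basis b))"
    using dual_comult(2)[OF f u] 
    unfolding lift_scalar_sum lift_scalar_mult by (simp add: mult.commute)
  also have "\<dots> = L (\<lambda>x\<in>C. f (u \<otimes> x))"
    using functional_D_expand[OF L translate_closed(1)[OF f u]] by simp
  finally show "lift_bilinear scalar_space (\<lambda>f\<^sub>1 f\<^sub>2. f\<^sub>1 u * L f\<^sub>2) (dual_comult H f) = L (\<lambda>x\<in>C. f (u \<otimes> x))" .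
  have "lift_bilinear scalar_space (\<lambda>f\<^sub>1 f\<^sub>2. f\<^sub>2 u * L f\<^sub>1) (dual_comult H f) =
      lift_bilinear scalar_space (\<lambda>f\<^sub>1 f\<^sub>2. \<Sum>b\<in>B. L (dual_basis b) * (f\<^sub>1 b * f\<^sub>2 u)) (dual_comult H f)"
    by (rule lift_bilinear_cong[of D D])
       (use dual_comult(1)[OF f] functional_D_expand[OF L] in \<open>auto simp: sum_distrib_left mult_ac\<close>)
  also have "\<dots> = (\<Sum>b\<in>B. f (b \<otimes> u) * L (dual_basis b))"
    using dual_comult(2)[OF f _ u] 
    unfolding lift_scalar_sum lift_scalar_mult by (simp add: mult.commute)
  also have "\<dots> = L (\<lambda>x\<in>C. f (x \<otimes> u))"
    using functional_D_expand[OF L translate_closed(2)[OF f u]] by simp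
  finally show "lift_bilinear scalar_space (\<lambda>f\<^sub>1 f\<^sub>2. f\<^sub>2 u * L f\<^sub>1) (dual_comult H f) = L (\<lambda>x\<in>C. f (x \<otimes> u))" .
qed

lemma D_mult_apply:
  assumes "f \<in> carrier D" "g \<in> carrier D" "x \<in> C"
  shows "(f \<otimes>\<^bsub>D\<^esub> g) x = Sw x (\<lambda>a b. f a * g b)"
  using lift_comult[OF bilinear_map_mult_functionals[OF assms(1,2)[THEN D_lin]] assms(3)] assms(3)
  by (simp add: dual_hopf_simps(2))

lemma D_mult_closed [simp]:
  assumes f: "f \<in> carrier D" and g: "g \<in> carrier D"
  shows "f \<otimes>\<^bsub>D\<^esub> g \<in> carrier D"
proof -
  have "f \<otimes>\<^bsub>D\<^esub> g = restrict (\<lambda>x. Sw x (\<lambda>a b. f a * g b)) C"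
    using D_mult_apply[OF f g] by (auto simp: dual_hopf_simps fun_eq_iff)
  then show ?thesis using D_restrict[OF lin_Sw] by simp
qed

lemma bilinear_map_D_mult: "bilinear_map D D D (\<lambda>f g. f \<otimes>\<^bsub>D\<^esub> g)"
  unfolding bilinear_map_def
proof (intro conjI ballI linear_map_DI)
  fix f x assume f: "f \<in> carrier D" and x: "x \<in> C"
  show "functional D (\<lambda>g. (f \<otimes>\<^bsub>D\<^esub> g) x)"
    by (rule functional_cong[OF _ D_mult_apply[OF f _ x]])
       (auto intro!: lin_Sw_arg functional_mult functional_eval)
  show "functional D (\<lambda>g. (g \<otimes>\<^bsub>D\<^esub> f) x)"
    by (rule functional_cong[OF _ D_mult_apply[OF _ f x]])
       (auto intro!: lin_Sw_arg functional_mult functional_eval)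
qed auto


subsection \<open>The formula tested against functionals\<close>

abbreviation "T \<equiv> tensor_product D H"
abbreviation "DH_form \<equiv> bilinear_form D H"

lemma vspace_T [simp]: "vspace T" by (rule vspace_tensor_product) simp_all

lemma comult_D_closed: "f \<in> carrier D \<Longrightarrow> comult D f \<in> carrier DD"
  using dual_comult(1) by (simp add: dual_hopf_simps(7))

text \<open>This is \<open>f[u, v]\<close> of the overview.\<close>

definition translate :: "('a \<Rightarrow> 'k) \<Rightarrow> 'a \<Rightarrow> 'a \<Rightarrow> 'a \<Rightarrow> 'k" where
  "translate f u v = (\<lambda>x\<in>C. f (u \<otimes> (x \<otimes> v)))"

lemma translate_apply: "x \<in> C \<Longrightarrow> translate f u v x = f (u \<otimes> (x \<otimes> v))"
  by (simp add: translate_def)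

lemma translate_in_dual [simp]: "\<lbrakk>f \<in> carrier D; u \<in> C; v \<in> C\<rbrakk> \<Longrightarrow> translate f u v \<in> carrier D"
  unfolding translate_def by (intro D_restrict lin_comp[OF D_lin] endo_intros) auto

text \<open>The inner coproduct is evaluated first and absorbs \<open>v\<close> on the right, then
  the outer one absorbs \<open>u\<close> on the left; what survives for the middle leg is the
  two-sided translate.\<close>

lemma lift_dual_comult_right:
  assumes L: "functional D L" and f: "f \<in> carrier D" and u: "u \<in> C" and v: "v \<in> C"
  shows "lift_bilinear scalar_space (\<lambda>f\<^sub>1 b. lift_bilinear scalar_space (\<lambda>f\<^sub>2 f\<^sub>3.
      f\<^sub>1 u * f\<^sub>3 v * L f\<^sub>2) (comult D b)) (comult D f) = L (translate f u v)"
proof -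
  \<comment> \<open>\<open>M\<close> is \<open>L\<close> after right translation by
    \<open>v\<close>. It must be a functional on \<open>D\<close> for the outer coproduct to be
    evaluated against it.\<close>
  define M where "M b = L (\<lambda>x\<in>C. b (x \<otimes> v))" for b
  have "linear_map D D (\<lambda>b. \<lambda>x\<in>C. b (x \<otimes> v))"
  proof (rule linear_map_DI)
    fix x assume x: "x \<in> C"
    show "functional D (\<lambda>b. (\<lambda>x\<in>C. b (x \<otimes> v)) x)"
      using functional_eval[of "x \<otimes> v"] x v by simp
  qed (use translate_closed(2) v in auto)
  then have M: "functional D M" unfolding M_def by (rule linear_map_compose[OF L])
  have "lift_bilinear scalar_space (\<lambda>f\<^sub>1 b. lift_bilinear scalar_space (\<lambda>f\<^sub>2 f\<^sub>3.
      f\<^sub>1 u * f\<^sub>3 v * L f\<^sub>2) (comult D b)) (comult D f) =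
      lift_bilinear scalar_space (\<lambda>f\<^sub>1 b. f\<^sub>1 u * M b) (comult D f)"
    by (rule lift_bilinear_cong[of D D])
       (use comult_D_closed[OF f] lift_dual_comult(2)[OF L _ v]
         in \<open>auto simp: mult.assoc lift_scalar_mult M_def dual_hopf_simps(7)\<close>)
  also have "\<dots> = M (\<lambda>x\<in>C. f (u \<otimes> x))"
    using lift_dual_comult(1)[OF M f u] by (simp add: dual_hopf_simps(7))
  also have "(\<lambda>x\<in>C. (\<lambda>x\<in>C. f (u \<otimes> x)) (x \<otimes> v)) = translate f u v"
    unfolding translate_def by (rule restrict_ext) (use v in simp)
  then have "M (\<lambda>x\<in>C. f (u \<otimes> x)) = L (translate f u v)" by (simp add: M_def)
  finally show ?thesis .
qed

text \<open>\<open>Sw\<close> is a finite combination with coefficients that do not involve the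
  tensor, so it commutes with any scalar lift. This is how sums over legs of functionals and sums
  over legs of elements are exchanged.\<close>

lemma lift_Sw_swap:
  "lift_bilinear scalar_space (\<lambda>a b. Sw h (F a b)) t = Sw h (\<lambda>x y. lift_bilinear scalar_space (\<lambda>a b. F a b x y) t)"
  by (simp add: Sw_def lift_scalar_sum lift_scalar_mult)

lemma pure_T_closed: "\<lbrakk>f \<in> carrier D; h \<in> C\<rbrakk> \<Longrightarrow> pure_tensor D H f h \<in> carrier T"
  by (rule pure_tensor_closed) simp_all

context
  fixes f h f' h'
  assumes f: "f \<in> carrier D" and h: "h \<in> C" and f': "f' \<in> carrier D" and h': "h' \<in> C"
begin

interpretation T: module scalars T by simp

lemma A_term_closed:
  assumes "f\<^sub>1 \<in> carrier D" "f\<^sub>2 \<in> carrier D" "f\<^sub>3 \<in> carrier D" "h\<^sub>1 \<in> C" "h\<^sub>2 \<in> C" "h\<^sub>3 \<in> C"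
  shows "(f\<^sub>1 (Si h\<^sub>3) * f\<^sub>3 (S (S h\<^sub>1))) \<odot>\<^bsub>T\<^esub> pure_tensor D H (f \<otimes>\<^bsub>D\<^esub> f\<^sub>2) (h\<^sub>2 \<otimes> h') \<in> carrier T"
  by (rule T.smult_closed) (use assms f h' in \<open>auto intro: pure_T_closed\<close>)

lemma comult_right_H_closed: "comult_right H h \<in> carrier (tensor_product H HH)"
  by (rule comult_right_closed) (use h in auto)

lemma comult_right_D_closed: "comult_right D f' \<in> carrier (tensor_product D DD)"
  by (rule comult_right_closed) (use f' comult_D_closed in auto)

lemma A_formula_closed: "A_formula H f h f' h' \<in> carrier T"
  unfolding A_formula_def Let_def
  by (rule lift_trilinear_closed[of D D D] lift_trilinear_closed[of H H H],
      (simp_all)[4], rule lift_trilinear_closed[of H H H])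
     (auto intro: A_term_closed comult_right_H_closed comult_right_D_closed)

text \<open>The central reduction: tested against a form \<open>P\<close>, the four nested lifts
  become a Sweedler sum over \<open>h\<close> alone, the legs of \<open>f'\<close> having been
  consumed by a two-sided translate. \<open>P\<close> stays general because associativity needs
  forms other than pairings.\<close>

lemma lift_A_formula:
  assumes P: "DH_form P"
  shows "lift_bilinear scalar_space P (A_formula H f h f' h') =
    Sw h (\<lambda>h\<^sub>1 w. Sw w (\<lambda>h\<^sub>2 h\<^sub>3. P (f \<otimes>\<^bsub>D\<^esub> translate f' (Si h\<^sub>3) (S (S h\<^sub>1))) (h\<^sub>2 \<otimes> h')))"
proof -
  let ?k = "scalar_space :: ('k, 'k) module"
  define L where "L = lift_bilinear ?k P"
  have L: "functional T L" unfolding L_def by (rule linear_map_lift_bilinear) (use P in auto)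
  have Lp: "L (pure_tensor D H g x) = P g x" if "g \<in> carrier D" "x \<in> C" for g x
    unfolding L_def by (rule lift_bilinear_pure) (use P that in auto)
  define K where "K f\<^sub>1 f\<^sub>2 f\<^sub>3 h\<^sub>1 h\<^sub>2 h\<^sub>3 =
      f\<^sub>1 (Si h\<^sub>3) * f\<^sub>3 (S (S h\<^sub>1)) * P (f \<otimes>\<^bsub>D\<^esub> f\<^sub>2) (h\<^sub>2 \<otimes> h')" for f\<^sub>1 f\<^sub>2 f\<^sub>3 h\<^sub>1 h\<^sub>2 h\<^sub>3
  \<comment> \<open>\<open>R\<close> is the inner lift over the legs of \<open>h\<close> for fixed
    legs of \<open>f'\<close>; \<open>Q\<close> is what the functional \<open>L\<close> makes of
    it.\<close>
  define R where "R f\<^sub>1 f\<^sub>2 f\<^sub>3 = lift_trilinear T (\<lambda>h\<^sub>1 h\<^sub>2 h\<^sub>3.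
      (f\<^sub>1 (Si h\<^sub>3) * f\<^sub>3 (S (S h\<^sub>1))) \<odot>\<^bsub>T\<^esub> pure_tensor D H (f \<otimes>\<^bsub>D\<^esub> f\<^sub>2) (h\<^sub>2 \<otimes> h')) (comult_right H h)"
    for f\<^sub>1 f\<^sub>2 f\<^sub>3
  define Q where "Q = (\<lambda>f\<^sub>1 f\<^sub>2 f\<^sub>3. Sw h (\<lambda>h\<^sub>1 w. Sw w (K f\<^sub>1 f\<^sub>2 f\<^sub>3 h\<^sub>1)))"
  have PH: "lin (\<lambda>x. P g (x \<otimes> h'))" if "g \<in> carrier D" for g
    by (rule lin_comp[OF bilinear_map_linear(1)[OF P that]]) (intro endo_intros h')
  have PD: "functional D (\<lambda>g. P (f \<otimes>\<^bsub>D\<^esub> g) y)" if "y \<in> C" for y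
    by (rule linear_map_compose[OF bilinear_map_linear(2)[OF P that] bilinear_map_linear(1)[OF bilinear_map_D_mult f]])
  have R_closed: "R f\<^sub>1 f\<^sub>2 f\<^sub>3 \<in> carrier T"
    if "f\<^sub>1 \<in> carrier D" "f\<^sub>2 \<in> carrier D" "f\<^sub>3 \<in> carrier D" for f\<^sub>1 f\<^sub>2 f\<^sub>3
    unfolding R_def
    by (rule lift_trilinear_closed[of H H H]) (use that in \<open>auto intro: A_term_closed comult_right_H_closed\<close>)
  have LR: "L (R f\<^sub>1 f\<^sub>2 f\<^sub>3) = Q f\<^sub>1 f\<^sub>2 f\<^sub>3"
    if c: "f\<^sub>1 \<in> carrier D" "f\<^sub>2 \<in> carrier D" "f\<^sub>3 \<in> carrier D" for f\<^sub>1 f\<^sub>2 f\<^sub>3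
  proof -
    have "L (R f\<^sub>1 f\<^sub>2 f\<^sub>3) = lift_trilinear ?k (K f\<^sub>1 f\<^sub>2 f\<^sub>3) (comult_right H h)"
      unfolding R_def
    proof (rule functional_lift_trilinear[of H H H])
      fix a b d assume abd: "a \<in> C" "b \<in> C" "d \<in> C"
      then show "L ((f\<^sub>1 (Si d) * f\<^sub>3 (S (S a))) \<odot>\<^bsub>T\<^esub> pure_tensor D H (f \<otimes>\<^bsub>D\<^esub> f\<^sub>2) (b \<otimes> h')) = K f\<^sub>1 f\<^sub>2 f\<^sub>3 a b d"
        using c f h' by (simp add: linear_map_smult[OF L] pure_T_closed Lp K_def)
    qed (use c L in \<open>auto intro: A_term_closed comult_right_H_closed\<close>)
    also have "\<dots> = lift_bilinear ?k (\<lambda>a b. lift_bilinear ?k (K f\<^sub>1 f\<^sub>2 f\<^sub>3 a) (comult H b)) (comult H h)"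
    proof (rule lift_trilinear_comult_right)
      show "bil (K f\<^sub>1 f\<^sub>2 f\<^sub>3 a)" if "a \<in> C" for a
        unfolding K_def
        by (intro bilI functional_mult PH lin_comp[OF D_lin[OF c(1)]] endo_Si endo_id) (use c f in auto)
      show "lin (\<lambda>a. K f\<^sub>1 f\<^sub>2 f\<^sub>3 a b d)" for b d
        unfolding K_def
        by (intro functional_mult lin_comp[OF D_lin[OF c(3)]] endo_intros)
    qed (use h in auto)
    also have "\<dots> = lift_bilinear ?k (\<lambda>a b. Sw b (K f\<^sub>1 f\<^sub>2 f\<^sub>3 a)) (comult H h)"
    proof (rule lift_bilinear_cong[of H H])
      fix a b assume ab: "a \<in> C" "b \<in> C"
      have "bil (K f\<^sub>1 f\<^sub>2 f\<^sub>3 a)"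
        unfolding K_def
        by (intro bilI functional_mult PH lin_comp[OF D_lin[OF c(1)]] endo_Si endo_id) (use c f in auto)
      then show "lift_bilinear ?k (K f\<^sub>1 f\<^sub>2 f\<^sub>3 a) (comult H b) = Sw b (K f\<^sub>1 f\<^sub>2 f\<^sub>3 a)"
        using ab by (intro lift_comult)
    qed (use h in auto)
    also have "\<dots> = Q f\<^sub>1 f\<^sub>2 f\<^sub>3"
      unfolding Q_def
    proof (rule lift_comult[OF bilI h])
      show "lin (\<lambda>b. Sw b (K f\<^sub>1 f\<^sub>2 f\<^sub>3 a))" for a by (rule lin_Sw)
      show "lin (\<lambda>a. Sw b (K f\<^sub>1 f\<^sub>2 f\<^sub>3 a))" for b
        unfolding K_def
        by (intro lin_Sw_arg functional_mult lin_comp[OF D_lin[OF c(3)]] endo_intros)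
    qed
    finally show ?thesis .
  qed
  have "lift_bilinear ?k P (A_formula H f h f' h') = L (lift_trilinear T R (comult_right D f'))"
    unfolding L_def A_formula_def R_def Let_def ..
  also have "\<dots> = lift_trilinear ?k Q (comult_right D f')"
    by (rule functional_lift_trilinear[of D D D])
       (use L in \<open>auto intro: R_closed comult_right_D_closed LR\<close>)
  also have "\<dots> = lift_bilinear ?k (\<lambda>a b. lift_bilinear ?k (Q a) (comult D b)) (comult D f')"
  proof (rule lift_trilinear_comult_right)
    show "bilinear_form D D (Q a)" for a
      unfolding Q_def K_def bilinear_map_def
      by (intro conjI ballI lin_Sw_arg functional_mult PD functional_eval) (use h' in auto)
    show "functional D (\<lambda>a. Q a b d)" for b d
      unfolding Q_def K_def
      by (intro lin_Sw_arg functional_mult functional_eval) (use h' in auto)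
  qed (use f' comult_D_closed in auto)
  \<comment> \<open>The sum over the legs of \<open>h\<close> is moved outside, so that for fixed
    legs of \<open>h\<close> the lift over the legs of \<open>f'\<close> can be evaluated by
    \<open>lift_dual_comult_right\<close>.\<close>
  also have "\<dots> = Sw h (\<lambda>h\<^sub>1 w. Sw w (\<lambda>h\<^sub>2 h\<^sub>3. lift_bilinear ?k (\<lambda>a b. lift_bilinear ?k (\<lambda>f\<^sub>2 f\<^sub>3.
      K a f\<^sub>2 f\<^sub>3 h\<^sub>1 h\<^sub>2 h\<^sub>3) (comult D b)) (comult D f')))"
    by (simp add: Q_def lift_Sw_swap)
  also have "\<dots> = Sw h (\<lambda>h\<^sub>1 w. Sw w (\<lambda>h\<^sub>2 h\<^sub>3. P (f \<otimes>\<^bsub>D\<^esub> translate f' (Si h\<^sub>3) (S (S h\<^sub>1))) (h\<^sub>2 \<otimes> h')))"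
    unfolding K_def
    by (intro Sw_cong lift_dual_comult_right[OF PD f']) (use h' in auto)
  finally show ?thesis .
qed

end

section \<open>Pairings that separate the elements of the tensor product\<close>

definition pairing :: "'a \<Rightarrow> ('a \<Rightarrow> 'k) \<Rightarrow> ('k, 'a \<Rightarrow> 'k, 'a) tensor \<Rightarrow> 'k" where
  "pairing x \<xi> = lift_bilinear scalar_space (\<lambda>f h. f x * \<xi> h)"

lemma pairing_form: "\<lbrakk>x \<in> C; lin \<xi>\<rbrakk> \<Longrightarrow> DH_form (\<lambda>f h. f x * \<xi> h)"
  by (intro bilinear_map_mult_functionals functional_eval)

lemma functional_pairing: "\<lbrakk>x \<in> C; lin \<xi>\<rbrakk> \<Longrightarrow> functional T (pairing x \<xi>)"
  unfolding pairing_def by (rule linear_map_lift_bilinear) (auto intro: pairing_form)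

lemma pairing_pure: "\<lbrakk>x \<in> C; lin \<xi>; f \<in> carrier D; h \<in> C\<rbrakk> \<Longrightarrow> pairing x \<xi> (pure_tensor D H f h) = f x * \<xi> h"
  unfolding pairing_def by (rule lift_bilinear_pure) (auto intro: pairing_form)

text \<open>Pairings with a basis vector and a coordinate functional are the coordinates in
  \<open>tensor_expand\<close>, so they rebuild the tensor.\<close>

lemma pairing_eqI:
  assumes s: "s \<in> carrier T" and t: "t \<in> carrier T"
    and eq: "\<And>x \<xi>. \<lbrakk>x \<in> C; lin \<xi>\<rbrakk> \<Longrightarrow> pairing x \<xi> s = pairing x \<xi> t"
  shows "s = t"
proof -
  interpret T: module scalars T by simp
  have p: "pure_tensor D H (dual_basis i) j \<in> carrier T" if "i \<in> B" "j \<in> B" for i j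
    by (rule pure_T_closed) (use that in auto)
  have e: "u = (\<Oplus>\<^bsub>T\<^esub>i\<in>B. \<Oplus>\<^bsub>T\<^esub>j\<in>B. pairing i (coord j) u \<odot>\<^bsub>T\<^esub> pure_tensor D H (dual_basis i) j)"
    if "u \<in> carrier T" for u
    unfolding pairing_def
    by (rule tensor_expand) (use that functional_eval dual_expand coord_linear basis_expand in auto)
  have "(\<Oplus>\<^bsub>T\<^esub>i\<in>B. \<Oplus>\<^bsub>T\<^esub>j\<in>B. pairing i (coord j) s \<odot>\<^bsub>T\<^esub> pure_tensor D H (dual_basis i) j) =
      (\<Oplus>\<^bsub>T\<^esub>i\<in>B. \<Oplus>\<^bsub>T\<^esub>j\<in>B. pairing i (coord j) t \<odot>\<^bsub>T\<^esub> pure_tensor D H (dual_basis i) j)"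
    by (intro T.finsum_cong' refl funcsetI T.finsum_closed T.smult_closed p)
       (use eq coord_linear in auto)
  then show ?thesis using e[OF s] e[OF t] by simp
qed

text \<open>Linearity of a map into the tensor product may be checked after pairing, where nested
  lifts have explicit scalar values.\<close>

lemma linear_map_TI:
  assumes V: "vspace V" and cl: "\<And>v. v \<in> carrier V \<Longrightarrow> g v \<in> carrier T"
    and "\<And>x \<xi>. \<lbrakk>x \<in> C; lin \<xi>\<rbrakk> \<Longrightarrow> functional V (\<lambda>v. pairing x \<xi> (g v))"
  shows "linear_map V T g"
proof -
  interpret V: module scalars V by fact
  interpret T: module scalars T by simp
  note fp = linear_map_add[OF functional_pairing] linear_map_smult[OF functional_pairing]
  show ?thesis
    unfolding linear_map_def
  proof (intro conjI ballI allI funcsetI)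
    fix u v assume uv: "u \<in> carrier V" "v \<in> carrier V"
    show "g (u \<oplus>\<^bsub>V\<^esub> v) = g u \<oplus>\<^bsub>T\<^esub> g v"
      by (rule pairing_eqI) (use uv cl linear_map_add[OF assms(3)] in \<open>auto simp: fp\<close>)
  next
    fix c v assume v: "v \<in> carrier V"
    show "g (c \<odot>\<^bsub>V\<^esub> v) = c \<odot>\<^bsub>T\<^esub> g v"
      by (rule pairing_eqI) (use v cl linear_map_smult[OF assms(3)] in \<open>auto simp: fp\<close>)
  qed (use cl in auto)
qed

lemma pairing_A_formula:
  assumes "x \<in> C" "lin \<xi>" and f: "f \<in> carrier D" and h: "h \<in> C" and f': "f' \<in> carrier D" and h': "h' \<in> C"
  shows "pairing x \<xi> (A_formula H f h f' h') =
    Sw h (\<lambda>h\<^sub>1 w. Sw w (\<lambda>h\<^sub>2 h\<^sub>3. Sw x (\<lambda>x\<^sub>1 x\<^sub>2. f x\<^sub>1 * f' (Si h\<^sub>3 \<otimes> (x\<^sub>2 \<otimes> S (S h\<^sub>1)))) * \<xi> (h\<^sub>2 \<otimes> h')))"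
  unfolding pairing_def lift_A_formula[OF f h f' h' pairing_form[OF assms(1,2)]]
proof (intro Sw_cong)
  fix h\<^sub>1 w h\<^sub>2 h\<^sub>3 assume c: "h\<^sub>1 \<in> C" "w \<in> C" "h\<^sub>2 \<in> C" "h\<^sub>3 \<in> C"
  have "(f \<otimes>\<^bsub>D\<^esub> translate f' (Si h\<^sub>3) (S (S h\<^sub>1))) x = Sw x (\<lambda>x\<^sub>1 x\<^sub>2. f x\<^sub>1 * translate f' (Si h\<^sub>3) (S (S h\<^sub>1)) x\<^sub>2)"
    by (rule D_mult_apply) (use assms c in auto)
  also have "\<dots> = Sw x (\<lambda>x\<^sub>1 x\<^sub>2. f x\<^sub>1 * f' (Si h\<^sub>3 \<otimes> (x\<^sub>2 \<otimes> S (S h\<^sub>1))))"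
    by (rule Sw_cong) (simp add: translate_apply)
  finally show "(f \<otimes>\<^bsub>D\<^esub> translate f' (Si h\<^sub>3) (S (S h\<^sub>1))) x * \<xi> (h\<^sub>2 \<otimes> h') =
    Sw x (\<lambda>x\<^sub>1 x\<^sub>2. f x\<^sub>1 * f' (Si h\<^sub>3 \<otimes> (x\<^sub>2 \<otimes> S (S h\<^sub>1)))) * \<xi> (h\<^sub>2 \<otimes> h')" by simp
qed

text \<open>In the explicit sum of \<open>pairing_A_formula\<close> each of \<open>f\<close>,
  \<open>f'\<close> and \<open>h'\<close> occurs once and linearly, while \<open>h\<close> occurs
  only as the element whose legs are summed, where \<open>lin_Sw\<close> applies.\<close>

lemma functional_pairing_A_formula:
  assumes x: "x \<in> C" and \<xi>: "lin \<xi>"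
  shows "\<lbrakk>h \<in> C; f' \<in> carrier D; h' \<in> C\<rbrakk> \<Longrightarrow> functional D (\<lambda>f. pairing x \<xi> (A_formula H f h f' h'))"
    and "\<lbrakk>f \<in> carrier D; f' \<in> carrier D; h' \<in> C\<rbrakk> \<Longrightarrow> functional H (\<lambda>h. pairing x \<xi> (A_formula H f h f' h'))"
    and "\<lbrakk>f \<in> carrier D; h \<in> C; h' \<in> C\<rbrakk> \<Longrightarrow> functional D (\<lambda>f'. pairing x \<xi> (A_formula H f h f' h'))"
    and "\<lbrakk>f \<in> carrier D; h \<in> C; f' \<in> carrier D\<rbrakk> \<Longrightarrow> functional H (\<lambda>h'. pairing x \<xi> (A_formula H f h f' h'))"
proof -
  assume a: "h \<in> C" "f' \<in> carrier D" "h' \<in> C"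
  show "functional D (\<lambda>f. pairing x \<xi> (A_formula H f h f' h'))"
    by (rule functional_cong[OF _ pairing_A_formula[OF x \<xi> _ a]])
       (auto intro!: lin_Sw_arg functional_mult functional_eval)
next
  assume a: "f \<in> carrier D" "f' \<in> carrier D" "h' \<in> C"
  show "functional H (\<lambda>h. pairing x \<xi> (A_formula H f h f' h'))"
    by (rule functional_cong[OF _ pairing_A_formula[OF x \<xi> a(1) _ a(2,3)]])
       (auto intro!: lin_Sw)
next
  assume a: "f \<in> carrier D" "h \<in> C" "h' \<in> C"
  show "functional D (\<lambda>f'. pairing x \<xi> (A_formula H f h f' h'))"
    by (rule functional_cong[OF _ pairing_A_formula[OF x \<xi> a(1,2) _ a(3)]])
       (auto intro!: lin_Sw_arg functional_mult functional_eval)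
next
  assume a: "f \<in> carrier D" "h \<in> C" "f' \<in> carrier D"
  show "functional H (\<lambda>h'. pairing x \<xi> (A_formula H f h f' h'))"
    by (rule functional_cong[OF _ pairing_A_formula[OF x \<xi> a]])
       (auto intro!: lin_Sw_arg functional_mult lin_comp[OF \<xi>] endo_intros)
qed

lemma bilinear_map_A_formula:
  "\<lbrakk>f \<in> carrier D; h \<in> C\<rbrakk> \<Longrightarrow> bilinear_map D H T (A_formula H f h)"
  "\<lbrakk>f' \<in> carrier D; h' \<in> C\<rbrakk> \<Longrightarrow> bilinear_map D H T (\<lambda>f h. A_formula H f h f' h')"
  unfolding bilinear_map_def
  by (auto intro!: linear_map_TI A_formula_closed functional_pairing_A_formula)

section \<open>The multiplication as a bilinear map\<close>

definition A_mult where
  "A_mult s t = lift_bilinear T (\<lambda>f h. lift_bilinear T (A_formula H f h) t) s"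

lemma lift_A_formula_closed:
  "\<lbrakk>f \<in> carrier D; h \<in> C; t \<in> carrier T\<rbrakk> \<Longrightarrow> lift_bilinear T (A_formula H f h) t \<in> carrier T"
  by (rule lift_bilinear_closed[of D H]) (auto intro: A_formula_closed)

lemma A_mult_closed: "\<lbrakk>s \<in> carrier T; t \<in> carrier T\<rbrakk> \<Longrightarrow> A_mult s t \<in> carrier T"
  unfolding A_mult_def by (rule lift_bilinear_closed[of D H]) (auto intro: lift_A_formula_closed)

lemma functional_lift_A_formula:
  assumes L: "functional T L" and "f \<in> carrier D" "h \<in> C" "t \<in> carrier T"
  shows "L (lift_bilinear T (A_formula H f h) t) = lift_bilinear scalar_space (\<lambda>f' h'. L (A_formula H f h f' h')) t"
  by (rule linear_map_lift[of D H]) (use assms A_formula_closed in auto)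

lemma functional_A_mult:
  assumes L: "functional T L" and s: "s \<in> carrier T" and t: "t \<in> carrier T"
  shows "L (A_mult s t) = lift_bilinear scalar_space (\<lambda>f h. L (lift_bilinear T (A_formula H f h) t)) s"
  unfolding A_mult_def
  by (rule linear_map_lift[of D H]) (use assms lift_A_formula_closed in auto)

lemma bilinear_map_lift_A_formula:
  assumes t: "t \<in> carrier T"
  shows "bilinear_map D H T (\<lambda>f h. lift_bilinear T (A_formula H f h) t)"
  unfolding bilinear_map_def
proof (intro conjI ballI linear_map_TI)
  fix f x \<xi> assume a: "f \<in> carrier D" "x \<in> C" "lin \<xi>"
  show "lin (\<lambda>h. pairing x \<xi> (lift_bilinear T (A_formula H f h) t))"
    by (rule functional_cong[OF _ functional_lift_A_formula[OF functional_pairing]])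
       (use a t in \<open>auto intro!: functional_lift_arg[of D H] functional_pairing_A_formula\<close>)
next
  fix h x \<xi> assume a: "h \<in> C" "x \<in> C" "lin \<xi>"
  show "functional D (\<lambda>f. pairing x \<xi> (lift_bilinear T (A_formula H f h) t))"
    by (rule functional_cong[OF _ functional_lift_A_formula[OF functional_pairing]])
       (use a t in \<open>auto intro!: functional_lift_arg[of D H] functional_pairing_A_formula\<close>)
qed (use t lift_A_formula_closed in auto)

text \<open>In the left factor the product is the lift of a bilinear map. The right factor sits
  inside the integrand of that lift, so linearity there is tested with pairings.\<close>

lemma bilinear_map_A_mult: "bilinear_map T T T A_mult"
  unfolding bilinear_map_def
proof (intro conjI ballI)
  fix t assume t: "t \<in> carrier T"
  show "linear_map T T (\<lambda>s. A_mult s t)"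
    unfolding A_mult_def by (rule linear_map_lift_bilinear) (simp_all add: bilinear_map_lift_A_formula t)
next
  fix s assume s: "s \<in> carrier T"
  show "linear_map T T (A_mult s)"
  proof (rule linear_map_TI)
    fix x \<xi> assume a: "x \<in> C" "lin \<xi>"
    show "functional T (\<lambda>t. pairing x \<xi> (A_mult s t))"
    proof (rule functional_cong[OF _ functional_A_mult[OF functional_pairing[OF a] s]])
      show "functional T (\<lambda>t. lift_bilinear scalar_space
          (\<lambda>f h. pairing x \<xi> (lift_bilinear T (A_formula H f h) t)) s)"
        by (rule functional_lift_arg[of D H])
           (use s a in \<open>auto intro!: linear_map_compose[OF functional_pairing]
              linear_map_lift_bilinear bilinear_map_A_formula\<close>)
    qed auto
  qed (use s A_mult_closed in auto)
qed

lemma A_mult_pure: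
  assumes "f \<in> carrier D" "h \<in> C"
  shows "t \<in> carrier T \<Longrightarrow> A_mult (pure_tensor D H f h) t = lift_bilinear T (A_formula H f h) t"
    and "\<lbrakk>f' \<in> carrier D; h' \<in> C\<rbrakk> \<Longrightarrow>
      A_mult (pure_tensor D H f h) (pure_tensor D H f' h') = A_formula H f h f' h'"
proof -
  show 1: "A_mult (pure_tensor D H f h) t = lift_bilinear T (A_formula H f h) t" if "t \<in> carrier T" for t
    unfolding A_mult_def
    by (rule lift_bilinear_pure) (use assms that bilinear_map_lift_A_formula in auto)
  assume a: "f' \<in> carrier D" "h' \<in> C"
  show "A_mult (pure_tensor D H f h) (pure_tensor D H f' h') = A_formula H f h f' h'"
    unfolding 1[OF pure_T_closed[OF a]]
    by (rule lift_bilinear_pure) (use assms a bilinear_map_A_formula in auto)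
qed


subsection \<open>Associativity and unit\<close>

lemma Sw_swap2:
  "Sw g (\<lambda>a b. Sw h (\<lambda>k w. Sw w (\<lambda>l m. F a b k l m))) =
     Sw h (\<lambda>k w. Sw w (\<lambda>l m. Sw g (\<lambda>a b. F a b k l m)))"
proof -
  have "Sw g (\<lambda>a b. Sw h (\<lambda>k w. Sw w (\<lambda>l m. F a b k l m))) =
      Sw h (\<lambda>k w. Sw g (\<lambda>a b. Sw w (\<lambda>l m. F a b k l m)))"
    by (rule Sw_swap)
  also have "\<dots> = Sw h (\<lambda>k w. Sw w (\<lambda>l m. Sw g (\<lambda>a b. F a b k l m)))"
    by (intro Sw_cong Sw_swap)
  finally show ?thesis .
qed

text \<open>The five legs appear in the order a, b, m, c, d on both sides; only the bracketing
  changes, from a((b(mc))d) to (ab)(m(cd)).\<close>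

lemma Sw_regroup:
  assumes h: "h \<in> C"
  shows "Sw h (\<lambda>a w. Sw w (\<lambda>v d. Sw v (\<lambda>b p. Sw p (\<lambda>m c. G a b m c d)))) =
    Sw h (\<lambda>u w. Sw w (\<lambda>m v. Sw v (\<lambda>c d. Sw u (\<lambda>a b. G a b m c d))))"
proof -
  have "Sw h (\<lambda>a w. Sw w (\<lambda>v d. Sw v (\<lambda>b p. Sw p (\<lambda>m c. G a b m c d)))) =
      Sw h (\<lambda>a w. Sw w (\<lambda>b y. Sw y (\<lambda>p d. Sw p (\<lambda>m c. G a b m c d))))"
    by (intro Sw_cong Sw_coassoc)
  also have "\<dots> = Sw h (\<lambda>a w. Sw w (\<lambda>b y. Sw y (\<lambda>m z. Sw z (\<lambda>c d. G a b m c d))))"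
    by (intro Sw_cong Sw_coassoc)
  also have "\<dots> = Sw h (\<lambda>u y. Sw u (\<lambda>a b. Sw y (\<lambda>m z. Sw z (\<lambda>c d. G a b m c d))))"
    by (rule Sw_coassoc[OF h, symmetric])
  also have "\<dots> = Sw h (\<lambda>u w. Sw w (\<lambda>m v. Sw v (\<lambda>c d. Sw u (\<lambda>a b. G a b m c d))))"
    by (intro Sw_cong Sw_swap2)
  finally show ?thesis .
qed

text \<open>Associativity on pure tensors, after one product on each side has been expanded by
  \<open>lift_A_formula\<close>. Both sides are reduced to sums of the same scalar \<open>W\<close>,
  up to the bracketing of the legs of \<open>h\<close>.\<close>

lemma pairing_assoc:
  assumes x: "x \<in> C" and \<xi>: "lin \<xi>"
    and f: "f \<in> carrier D" and h: "h \<in> C" and f': "f' \<in> carrier D" and h': "h' \<in> C"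
    and f'': "f'' \<in> carrier D" and h'': "h'' \<in> C"
  shows "Sw h (\<lambda>h\<^sub>1 w. Sw w (\<lambda>h\<^sub>2 h\<^sub>3. pairing x \<xi>
      (A_formula H (f \<otimes>\<^bsub>D\<^esub> translate f' (Si h\<^sub>3) (S (S h\<^sub>1))) (h\<^sub>2 \<otimes> h') f'' h''))) =
    Sw h' (\<lambda>k\<^sub>1 w. Sw w (\<lambda>k\<^sub>2 k\<^sub>3. pairing x \<xi>
      (A_formula H f h (f' \<otimes>\<^bsub>D\<^esub> translate f'' (Si k\<^sub>3) (S (S k\<^sub>1))) (k\<^sub>2 \<otimes> h''))))"
proof -
  \<comment> \<open>The common summand: \<open>a\<close>, \<open>b\<close>, \<open>m\<close>,
    \<open>c\<close>, \<open>d\<close> stand for h_1 to h_5, the k's for the three legs of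
    \<open>h'\<close>, and \<open>x\<close> is split into three legs for the convolution of three
    functionals.\<close>
  define W where "W k\<^sub>1 k\<^sub>2 k\<^sub>3 a b m c d = Sw x (\<lambda>x\<^sub>1 x\<^sub>2. f x\<^sub>1 * Sw x\<^sub>2 (\<lambda>s t. f' (Si d \<otimes> (s \<otimes> S (S a))) *
      f'' (Si k\<^sub>3 \<otimes> ((Si c \<otimes> (t \<otimes> S (S b))) \<otimes> S (S k\<^sub>1))))) * \<xi> (m \<otimes> (k\<^sub>2 \<otimes> h''))"
    for k\<^sub>1 k\<^sub>2 k\<^sub>3 a b m c d
  note lf = lin_comp[OF D_lin[OF f]] and lf' = lin_comp[OF D_lin[OF f']] and lf'' = lin_comp[OF D_lin[OF f'']]
  have left: "pairing x \<xi> (A_formula H (f \<otimes>\<^bsub>D\<^esub> translate f' (Si d) (S (S a))) (v \<otimes> h') f'' h'') =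
      Sw v (\<lambda>b p. Sw p (\<lambda>m c. Sw h' (\<lambda>k\<^sub>1 w. Sw w (\<lambda>k\<^sub>2 k\<^sub>3. W k\<^sub>1 k\<^sub>2 k\<^sub>3 a b m c d))))"
    if c: "a \<in> C" "v \<in> C" "d \<in> C" for a v d
  proof -
    define g where "g = f \<otimes>\<^bsub>D\<^esub> translate f' (Si d) (S (S a))"
    have g: "g \<in> carrier D" unfolding g_def using f f' c by simp
    define N where "N u\<^sub>1 u\<^sub>2 u\<^sub>3 = Sw x (\<lambda>x\<^sub>1 x\<^sub>2. g x\<^sub>1 * f'' (Si u\<^sub>3 \<otimes> (x\<^sub>2 \<otimes> S (S u\<^sub>1)))) * \<xi> (u\<^sub>2 \<otimes> h'')"
      for u\<^sub>1 u\<^sub>2 u\<^sub>3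
    have N1: "bil (N u)" if "u \<in> C" for u
      unfolding N_def
      by (intro bilI functional_mult lin_Sw_arg lf'' lin_comp[OF \<xi>] endo_Si endo_intros) (use that h'' in auto)
    have N2: "bil (\<lambda>u v. Sw v (N u))"
      unfolding N_def
      by (intro bilI lin_Sw lin_Sw_arg functional_mult lf'' endo_intros) (use h'' in auto)
    \<comment> \<open>The outer legs are now products of a leg of \<open>h\<close> and a leg of
      \<open>h'\<close>. \<open>Si\<close> reverses its product and the squared antipode preserves
      it, so the legs of \<open>h'\<close> end up outermost around \<open>x\<close>.\<close>
    have NW: "N (b \<otimes> k\<^sub>1) (m \<otimes> k\<^sub>2) (e \<otimes> k\<^sub>3) = W k\<^sub>1 k\<^sub>2 k\<^sub>3 a b m e d"
      if k: "b \<in> C" "m \<in> C" "e \<in> C" "k\<^sub>1 \<in> C" "k\<^sub>2 \<in> C" "k\<^sub>3 \<in> C" for b m e k\<^sub>1 k\<^sub>2 k\<^sub>3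
    proof -
      define E where "E t = f'' (Si k\<^sub>3 \<otimes> ((Si e \<otimes> (t \<otimes> S (S b))) \<otimes> S (S k\<^sub>1)))" for t
      have "Sw x (\<lambda>x\<^sub>1 x\<^sub>2. g x\<^sub>1 * f'' (Si (e \<otimes> k\<^sub>3) \<otimes> (x\<^sub>2 \<otimes> S (S (b \<otimes> k\<^sub>1))))) =
          Sw x (\<lambda>x\<^sub>1 x\<^sub>2. Sw x\<^sub>1 (\<lambda>s r. f s * (f' (Si d \<otimes> (r \<otimes> S (S a))) * E x\<^sub>2)))"
      proof (rule Sw_cong)
        fix x\<^sub>1 x\<^sub>2 assume xx: "x\<^sub>1 \<in> C" "x\<^sub>2 \<in> C"
        have "g x\<^sub>1 = Sw x\<^sub>1 (\<lambda>s r. f s * translate f' (Si d) (S (S a)) r)"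
          unfolding g_def by (rule D_mult_apply) (use f f' c xx in auto)
        also have "\<dots> = Sw x\<^sub>1 (\<lambda>s r. f s * f' (Si d \<otimes> (r \<otimes> S (S a))))"
          by (rule Sw_cong) (simp add: translate_apply)
        finally show "g x\<^sub>1 * f'' (Si (e \<otimes> k\<^sub>3) \<otimes> (x\<^sub>2 \<otimes> S (S (b \<otimes> k\<^sub>1)))) =
            Sw x\<^sub>1 (\<lambda>s r. f s * (f' (Si d \<otimes> (r \<otimes> S (S a))) * E x\<^sub>2))"
          using k xx by (simp add: E_def Si_mult antipode_mult m_assoc mult.assoc flip: Sw_mult(2))
      qed
      \<comment> \<open>Here the convolution is bracketed to the left; \<open>W\<close> brackets it
        to the right.\<close>
      also have "\<dots> = Sw x (\<lambda>s y. Sw y (\<lambda>r x\<^sub>2. f s * (f' (Si d \<otimes> (r \<otimes> S (S a))) * E x\<^sub>2)))"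
        by (rule Sw_coassoc[OF x])
      finally show ?thesis
        using k h'' by (simp add: N_def W_def E_def Sw_mult m_assoc)
    qed
    have "pairing x \<xi> (A_formula H g (v \<otimes> h') f'' h'') = Sw (v \<otimes> h') (\<lambda>u w. Sw w (N u))"
      unfolding N_def by (rule pairing_A_formula[OF x \<xi> g _ f'' h'']) (use c h' in auto)
    also have "\<dots> = Sw v (\<lambda>b p. Sw h' (\<lambda>k\<^sub>1 w. Sw (p \<otimes> w) (N (b \<otimes> k\<^sub>1))))"
      by (rule Sw_product[OF N2 c(2) h'])
    also have "\<dots> = Sw v (\<lambda>b p. Sw h' (\<lambda>k\<^sub>1 w. Sw p (\<lambda>m e. Sw w (\<lambda>k\<^sub>2 k\<^sub>3. N (b \<otimes> k\<^sub>1) (m \<otimes> k\<^sub>2) (e \<otimes> k\<^sub>3)))))"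
      by (intro Sw_cong Sw_product N1) auto
    also have "\<dots> = Sw v (\<lambda>b p. Sw h' (\<lambda>k\<^sub>1 w. Sw p (\<lambda>m e. Sw w (\<lambda>k\<^sub>2 k\<^sub>3. W k\<^sub>1 k\<^sub>2 k\<^sub>3 a b m e d))))"
      by (intro Sw_cong NW)
    also have "\<dots> = Sw v (\<lambda>b p. Sw p (\<lambda>m e. Sw h' (\<lambda>k\<^sub>1 w. Sw w (\<lambda>k\<^sub>2 k\<^sub>3. W k\<^sub>1 k\<^sub>2 k\<^sub>3 a b m e d))))"
      by (intro Sw_cong Sw_swap)
    finally show ?thesis by (simp add: g_def)
  qed
  have right: "pairing x \<xi> (A_formula H f h (f' \<otimes>\<^bsub>D\<^esub> translate f'' (Si k\<^sub>3) (S (S k\<^sub>1))) (k\<^sub>2 \<otimes> h'')) =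
      Sw h (\<lambda>u w. Sw w (\<lambda>m v. Sw v (\<lambda>c d. Sw u (\<lambda>a b. W k\<^sub>1 k\<^sub>2 k\<^sub>3 a b m c d))))"
    if k: "k\<^sub>1 \<in> C" "k\<^sub>2 \<in> C" "k\<^sub>3 \<in> C" for k\<^sub>1 k\<^sub>2 k\<^sub>3
  proof -
    define F where "F = f' \<otimes>\<^bsub>D\<^esub> translate f'' (Si k\<^sub>3) (S (S k\<^sub>1))"
    have F: "F \<in> carrier D" unfolding F_def using f' f'' k by simp
    define G where "G p q = f' p * f'' (Si k\<^sub>3 \<otimes> (q \<otimes> S (S k\<^sub>1)))" for p q
    have G: "bil G" unfolding G_def
      by (intro bilI functional_mult D_lin[OF f'] lf'' endo_intros) (use k in auto)
    note lG = lin_bil[OF G]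
    \<comment> \<open>A convolution product evaluated at a product: the coproduct of the threefold
      product is distributed over \<open>f'\<close> and the translate of \<open>f''\<close>.\<close>
    have FG: "F (Si v \<otimes> (x\<^sub>2 \<otimes> S (S u))) = Sw v (\<lambda>c d. Sw u (\<lambda>a b. Sw x\<^sub>2 (\<lambda>s t.
        G (Si d \<otimes> (s \<otimes> S (S a))) (Si c \<otimes> (t \<otimes> S (S b))))))"
      if c: "u \<in> C" "v \<in> C" "x\<^sub>2 \<in> C" for u v x\<^sub>2
    proof -
      have "F (Si v \<otimes> (x\<^sub>2 \<otimes> S (S u))) = Sw (Si v \<otimes> (x\<^sub>2 \<otimes> S (S u))) (\<lambda>p q. f' p * translate f'' (Si k\<^sub>3) (S (S k\<^sub>1)) q)"
        unfolding F_def by (rule D_mult_apply) (use c f' f'' k in auto)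
      also have "\<dots> = Sw (Si v \<otimes> (x\<^sub>2 \<otimes> S (S u))) G"
        by (rule Sw_cong) (simp add: translate_apply G_def)
      also have "\<dots> = Sw (Si v) (\<lambda>c d. Sw (x\<^sub>2 \<otimes> S (S u)) (\<lambda>p q. G (c \<otimes> p) (d \<otimes> q)))"
        by (rule Sw_product[OF G]) (use c in auto)
      \<comment> \<open>Because \<open>Si\<close> reverses the legs, the later leg \<open>d\<close>
        goes to \<open>f'\<close> and the earlier leg \<open>c\<close> to \<open>f''\<close>, which
        is the nesting found on the left-hand side.\<close>
      also have "\<dots> = Sw v (\<lambda>c d. Sw (x\<^sub>2 \<otimes> S (S u)) (\<lambda>p q. G (Si d \<otimes> p) (Si c \<otimes> q)))"
        by (rule Sw_Si, intro bilI lin_Sw_arg lG endo_intros) (use c in auto)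
      also have "\<dots> = Sw v (\<lambda>c d. Sw x\<^sub>2 (\<lambda>s t. Sw (S (S u)) (\<lambda>a b. G (Si d \<otimes> (s \<otimes> a)) (Si c \<otimes> (t \<otimes> b)))))"
        by (intro Sw_cong Sw_product bilI lG endo_intros) (use c in auto)
      also have "\<dots> = Sw v (\<lambda>c d. Sw x\<^sub>2 (\<lambda>s t. Sw u (\<lambda>a b. G (Si d \<otimes> (s \<otimes> S (S a))) (Si c \<otimes> (t \<otimes> S (S b))))))"
        by (intro Sw_cong Sw_antipode2 bilI lG endo_intros) (use c in auto)
      also have "\<dots> = Sw v (\<lambda>c d. Sw u (\<lambda>a b. Sw x\<^sub>2 (\<lambda>s t. G (Si d \<otimes> (s \<otimes> S (S a))) (Si c \<otimes> (t \<otimes> S (S b))))))"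
        by (intro Sw_cong Sw_swap)
      finally show ?thesis .
    qed
    have "pairing x \<xi> (A_formula H f h F (k\<^sub>2 \<otimes> h'')) = Sw h (\<lambda>u w. Sw w (\<lambda>m v.
        Sw x (\<lambda>x\<^sub>1 x\<^sub>2. f x\<^sub>1 * F (Si v \<otimes> (x\<^sub>2 \<otimes> S (S u)))) * \<xi> (m \<otimes> (k\<^sub>2 \<otimes> h''))))"
      by (rule pairing_A_formula[OF x \<xi> f h F]) (use k h'' in auto)
    also have "\<dots> = Sw h (\<lambda>u w. Sw w (\<lambda>m v. Sw v (\<lambda>c d. Sw u (\<lambda>a b. W k\<^sub>1 k\<^sub>2 k\<^sub>3 a b m c d))))"
    proof (intro Sw_cong)
      fix u w m v assume c: "u \<in> C" "w \<in> C" "m \<in> C" "v \<in> C"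
      have "Sw x (\<lambda>x\<^sub>1 x\<^sub>2. f x\<^sub>1 * F (Si v \<otimes> (x\<^sub>2 \<otimes> S (S u)))) =
          Sw x (\<lambda>x\<^sub>1 x\<^sub>2. Sw v (\<lambda>c d. Sw u (\<lambda>a b. f x\<^sub>1 * Sw x\<^sub>2 (\<lambda>s t.
            G (Si d \<otimes> (s \<otimes> S (S a))) (Si c \<otimes> (t \<otimes> S (S b)))))))"
        by (rule Sw_cong) (use c in \<open>simp add: FG Sw_mult\<close>)
      also have "\<dots> = Sw v (\<lambda>c d. Sw x (\<lambda>x\<^sub>1 x\<^sub>2. Sw u (\<lambda>a b. f x\<^sub>1 * Sw x\<^sub>2 (\<lambda>s t.
            G (Si d \<otimes> (s \<otimes> S (S a))) (Si c \<otimes> (t \<otimes> S (S b)))))))"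
        by (rule Sw_swap)
      also have "\<dots> = Sw v (\<lambda>c d. Sw u (\<lambda>a b. Sw x (\<lambda>x\<^sub>1 x\<^sub>2. f x\<^sub>1 * Sw x\<^sub>2 (\<lambda>s t.
            G (Si d \<otimes> (s \<otimes> S (S a))) (Si c \<otimes> (t \<otimes> S (S b)))))))"
        by (intro Sw_cong Sw_swap)
      finally show "Sw x (\<lambda>x\<^sub>1 x\<^sub>2. f x\<^sub>1 * F (Si v \<otimes> (x\<^sub>2 \<otimes> S (S u)))) * \<xi> (m \<otimes> (k\<^sub>2 \<otimes> h'')) =
          Sw v (\<lambda>c d. Sw u (\<lambda>a b. W k\<^sub>1 k\<^sub>2 k\<^sub>3 a b m c d))"
        by (simp add: W_def G_def Sw_mult(2))
    qed
    finally show ?thesis by (simp add: F_def)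
  qed
  have "Sw h (\<lambda>h\<^sub>1 w. Sw w (\<lambda>h\<^sub>2 h\<^sub>3. pairing x \<xi>
      (A_formula H (f \<otimes>\<^bsub>D\<^esub> translate f' (Si h\<^sub>3) (S (S h\<^sub>1))) (h\<^sub>2 \<otimes> h') f'' h''))) =
      Sw h (\<lambda>a w. Sw w (\<lambda>v d. Sw v (\<lambda>b p. Sw p (\<lambda>m c. Sw h' (\<lambda>k\<^sub>1 w. Sw w (\<lambda>k\<^sub>2 k\<^sub>3. W k\<^sub>1 k\<^sub>2 k\<^sub>3 a b m c d))))))"
    by (intro Sw_cong left)
  \<comment> \<open>The legs of \<open>h'\<close> are moved outward step by step, so that in the end
    \<open>Sw_regroup\<close> can act on the legs of \<open>h\<close> with those of
    \<open>h'\<close> fixed.\<close>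
  also have "\<dots> = Sw h (\<lambda>a w. Sw w (\<lambda>v d. Sw v (\<lambda>b p. Sw h' (\<lambda>k\<^sub>1 w. Sw w (\<lambda>k\<^sub>2 k\<^sub>3. Sw p (\<lambda>m c. W k\<^sub>1 k\<^sub>2 k\<^sub>3 a b m c d))))))"
    by (intro Sw_cong Sw_swap2)
  also have "\<dots> = Sw h (\<lambda>a w. Sw w (\<lambda>v d. Sw h' (\<lambda>k\<^sub>1 w. Sw w (\<lambda>k\<^sub>2 k\<^sub>3. Sw v (\<lambda>b p. Sw p (\<lambda>m c. W k\<^sub>1 k\<^sub>2 k\<^sub>3 a b m c d))))))"
    by (intro Sw_cong Sw_swap2)
  also have "\<dots> = Sw h (\<lambda>a w. Sw h' (\<lambda>k\<^sub>1 w'. Sw w' (\<lambda>k\<^sub>2 k\<^sub>3. Sw w (\<lambda>v d. Sw v (\<lambda>b p. Sw p (\<lambda>m c. W k\<^sub>1 k\<^sub>2 k\<^sub>3 a b m c d))))))"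
    by (intro Sw_cong Sw_swap2)
  also have "\<dots> = Sw h' (\<lambda>k\<^sub>1 w'. Sw w' (\<lambda>k\<^sub>2 k\<^sub>3. Sw h (\<lambda>a w. Sw w (\<lambda>v d. Sw v (\<lambda>b p. Sw p (\<lambda>m c. W k\<^sub>1 k\<^sub>2 k\<^sub>3 a b m c d))))))"
    by (rule Sw_swap2)
  also have "\<dots> = Sw h' (\<lambda>k\<^sub>1 w'. Sw w' (\<lambda>k\<^sub>2 k\<^sub>3. Sw h (\<lambda>u w. Sw w (\<lambda>m v. Sw v (\<lambda>c d. Sw u (\<lambda>a b. W k\<^sub>1 k\<^sub>2 k\<^sub>3 a b m c d))))))"
    by (intro Sw_cong Sw_regroup[OF h])
  also have "\<dots> = Sw h' (\<lambda>k\<^sub>1 w. Sw w (\<lambda>k\<^sub>2 k\<^sub>3. pairing x \<xi>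
      (A_formula H f h (f' \<otimes>\<^bsub>D\<^esub> translate f'' (Si k\<^sub>3) (S (S k\<^sub>1))) (k\<^sub>2 \<otimes> h''))))"
    by (intro Sw_cong right[symmetric])
  finally show ?thesis .
qed

text \<open>A pairing is pushed through the lifts over \<open>r\<close>, \<open>s\<close> and
  \<open>t\<close>, which leaves the case of pure tensors. The intermediate product is not pure, so
  \<open>lift_A_formula\<close> is used with forms that already contain the outer
  multiplication.\<close>

lemma A_mult_assoc:
  assumes r: "r \<in> carrier T" and s: "s \<in> carrier T" and t: "t \<in> carrier T"
  shows "A_mult (A_mult r s) t = A_mult r (A_mult s t)"
proof (rule pairing_eqI)
  fix x \<xi> assume x: "x \<in> C" and \<xi>: "lin \<xi>"
  let ?k = "scalar_space :: ('k, 'k) module"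
  let ?L = "pairing x \<xi>"
  note L = functional_pairing[OF x \<xi>]
  \<comment> \<open>\<open>Q g k\<close> is the pairing of the product of the pure tensor of
    \<open>g\<close> and \<open>k\<close> with \<open>t\<close>: right multiplication by
    \<open>t\<close> as a form.\<close>
  define Q where "Q g k = ?L (lift_bilinear T (A_formula H g k) t)" for g k
  have Q: "DH_form Q"
    unfolding bilinear_map_def Q_def
    by (intro conjI ballI linear_map_compose[OF L] bilinear_map_linear[OF bilinear_map_lift_A_formula[OF t]])
  have LQ: "functional T (lift_bilinear ?k Q)"
    by (rule linear_map_lift_bilinear) (simp_all add: Q)
  \<comment> \<open>Correspondingly, \<open>N f h\<close> is left multiplication by the pure tensor
    of \<open>f\<close> and \<open>h\<close>, followed by the pairing.\<close>
  define N where "N f h u = ?L (lift_bilinear T (A_formula H f h) u)" for f h u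
  have N: "functional T (N f h)" if "f \<in> carrier D" "h \<in> C" for f h
    unfolding N_def
    by (intro linear_map_compose[OF L] linear_map_lift_bilinear) (use that bilinear_map_A_formula in auto)
  \<comment> \<open>Associativity for two pure factors and arbitrary \<open>t\<close>: both sides
    are lifts over \<open>t\<close>, and their integrands agree by
    \<open>pairing_assoc\<close>.\<close>
  have key: "lift_bilinear ?k Q (A_formula H f h f' h') = lift_bilinear ?k (\<lambda>f'' h''. N f h (A_formula H f' h' f'' h'')) t"
    if c: "f \<in> carrier D" "h \<in> C" "f' \<in> carrier D" "h' \<in> C" for f h f' h'
  proof -
    have "lift_bilinear ?k Q (A_formula H f h f' h') =
        Sw h (\<lambda>h\<^sub>1 w. Sw w (\<lambda>h\<^sub>2 h\<^sub>3. Q (f \<otimes>\<^bsub>D\<^esub> translate f' (Si h\<^sub>3) (S (S h\<^sub>1))) (h\<^sub>2 \<otimes> h')))"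
      by (rule lift_A_formula[OF c Q])
    also have "\<dots> = Sw h (\<lambda>h\<^sub>1 w. Sw w (\<lambda>h\<^sub>2 h\<^sub>3. lift_bilinear ?k (\<lambda>f'' h''. ?L (A_formula H
        (f \<otimes>\<^bsub>D\<^esub> translate f' (Si h\<^sub>3) (S (S h\<^sub>1))) (h\<^sub>2 \<otimes> h') f'' h'')) t))"
      unfolding Q_def by (intro Sw_cong functional_lift_A_formula L t) (use c in auto)
    also have "\<dots> = lift_bilinear ?k (\<lambda>f'' h''. Sw h (\<lambda>h\<^sub>1 w. Sw w (\<lambda>h\<^sub>2 h\<^sub>3. ?L (A_formula H
        (f \<otimes>\<^bsub>D\<^esub> translate f' (Si h\<^sub>3) (S (S h\<^sub>1))) (h\<^sub>2 \<otimes> h') f'' h'')))) t"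
      by (simp add: lift_Sw_swap)
    also have "\<dots> = lift_bilinear ?k (\<lambda>f'' h''. N f h (A_formula H f' h' f'' h'')) t"
    proof (rule lift_bilinear_cong[of D H])
      fix f'' h'' assume d: "f'' \<in> carrier D" "h'' \<in> C"
      have P: "DH_form (\<lambda>g k. ?L (A_formula H f h g k))"
        unfolding bilinear_map_def by (intro conjI ballI functional_pairing_A_formula x \<xi> c)
      have "N f h (A_formula H f' h' f'' h'') =
          lift_bilinear ?k (\<lambda>g k. ?L (A_formula H f h g k)) (A_formula H f' h' f'' h'')"
        unfolding N_def by (rule functional_lift_A_formula[OF L c(1,2)]) (use A_formula_closed c d in auto)
      also have "\<dots> = Sw h' (\<lambda>k\<^sub>1 w. Sw w (\<lambda>k\<^sub>2 k\<^sub>3.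
          ?L (A_formula H f h (f' \<otimes>\<^bsub>D\<^esub> translate f'' (Si k\<^sub>3) (S (S k\<^sub>1))) (k\<^sub>2 \<otimes> h''))))"
        by (rule lift_A_formula[OF c(3,4) d P])
      finally show "Sw h (\<lambda>h\<^sub>1 w. Sw w (\<lambda>h\<^sub>2 h\<^sub>3. ?L (A_formula H
          (f \<otimes>\<^bsub>D\<^esub> translate f' (Si h\<^sub>3) (S (S h\<^sub>1))) (h\<^sub>2 \<otimes> h') f'' h''))) = N f h (A_formula H f' h' f'' h'')"
        using pairing_assoc[OF x \<xi> c d] by simp
    qed (use t in auto)
    finally show ?thesis .
  qed
  have "?L (A_mult (A_mult r s) t) = lift_bilinear ?k Q (A_mult r s)"
    unfolding Q_def by (rule functional_A_mult[OF L A_mult_closed[OF r s] t])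
  also have "\<dots> = lift_bilinear ?k (\<lambda>f h. lift_bilinear ?k Q (lift_bilinear T (A_formula H f h) s)) r"
    by (rule functional_A_mult[OF LQ r s])
  also have "\<dots> = lift_bilinear ?k (\<lambda>f h. N f h (A_mult s t)) r"
  proof (rule lift_bilinear_cong[of D H])
    fix f h assume c: "f \<in> carrier D" "h \<in> C"
    have "lift_bilinear ?k Q (lift_bilinear T (A_formula H f h) s) =
        lift_bilinear ?k (\<lambda>f' h'. lift_bilinear ?k Q (A_formula H f h f' h')) s"
      by (rule functional_lift_A_formula[OF LQ c s])
    also have "\<dots> = lift_bilinear ?k (\<lambda>f' h'. N f h (lift_bilinear T (A_formula H f' h') t)) s"
      by (rule lift_bilinear_cong[of D H])
         (use s t c key functional_lift_A_formula[OF N[OF c]] in auto)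
    also have "\<dots> = N f h (A_mult s t)"
      by (rule functional_A_mult[OF N[OF c] s t, symmetric])
    finally show "lift_bilinear ?k Q (lift_bilinear T (A_formula H f h) s) = N f h (A_mult s t)" .
  qed (use r in auto)
  also have "\<dots> = ?L (A_mult r (A_mult s t))"
    unfolding N_def by (rule functional_A_mult[OF L r A_mult_closed[OF s t], symmetric])
  finally show "?L (A_mult (A_mult r s) t) = ?L (A_mult r (A_mult s t))" .
qed (use r s t A_mult_closed in auto)

section \<open>The unit\<close>

lemma D_one_closed: "\<one>\<^bsub>D\<^esub> \<in> carrier D"
  unfolding dual_hopf_simps(3) by (rule D_restrict[OF counit_linear])

lemma D_one_apply: "x \<in> C \<Longrightarrow> \<one>\<^bsub>D\<^esub> x = \<epsilon> x"
  by (simp add: dual_hopf_simps(3))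

text \<open>All legs of the unit are the unit, which \<open>S\<close> and \<open>Si\<close> fix, so
  the translate is trivial and the counit axiom in \<open>x\<close> removes the factor on the
  left.\<close>

lemma A_formula_one_left:
  assumes f: "f \<in> carrier D" and h: "h \<in> C"
  shows "A_formula H \<one>\<^bsub>D\<^esub> \<one> f h = pure_tensor D H f h"
proof (rule pairing_eqI)
  fix x \<xi> assume x: "x \<in> C" and \<xi>: "lin \<xi>"
  define K where "K h\<^sub>1 h\<^sub>2 h\<^sub>3 = Sw x (\<lambda>x\<^sub>1 x\<^sub>2. \<one>\<^bsub>D\<^esub> x\<^sub>1 * f (Si h\<^sub>3 \<otimes> (x\<^sub>2 \<otimes> S (S h\<^sub>1)))) * \<xi> (h\<^sub>2 \<otimes> h)"
    for h\<^sub>1 h\<^sub>2 h\<^sub>3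
  note lf = lin_comp[OF D_lin[OF f]]
  have K1: "bil (K u)" if "u \<in> C" for u
    unfolding K_def
    by (intro bilI functional_mult lin_Sw_arg lf lin_comp[OF \<xi>] endo_Si endo_intros) (use that h in auto)
  have K2: "bil (\<lambda>u v. Sw v (K u))"
    unfolding K_def by (intro bilI lin_Sw lin_Sw_arg functional_mult lf endo_intros) (use h in auto)
  have "pairing x \<xi> (A_formula H \<one>\<^bsub>D\<^esub> \<one> f h) = Sw \<one> (\<lambda>u v. Sw v (K u))"
    unfolding K_def by (rule pairing_A_formula[OF x \<xi> D_one_closed one_closed f h])
  also have "\<dots> = K \<one> \<one> \<one>"
    using Sw_one[OF K2] Sw_one[OF K1] by simp
  also have "\<dots> = Sw x (\<lambda>x\<^sub>1 x\<^sub>2. \<epsilon> x\<^sub>1 * f x\<^sub>2) * \<xi> h"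
    unfolding K_def
    by (intro arg_cong2[of _ _ _ _ "(*)"] Sw_cong) (use h in \<open>simp_all add: D_one_apply Si_one antipode_one\<close>)
  also have "\<dots> = pairing x \<xi> (pure_tensor D H f h)"
    using Sw_counit_left[OF D_lin[OF f] x] by (simp add: pairing_pure x \<xi> f h)
  finally show "pairing x \<xi> (A_formula H \<one>\<^bsub>D\<^esub> \<one> f h) = pairing x \<xi> (pure_tensor D H f h)" .
qed (use f h A_formula_closed D_one_closed pure_T_closed in auto)

text \<open>The counit is multiplicative and invariant under \<open>S\<close> and \<open>Si\<close>,
  so translating it only produces the scalar \<epsilon>(h_1) \<epsilon>(h_3), which the counit
  axioms absorb on the outer legs of \<open>h\<close>.\<close>

lemma A_formula_one_right:
  assumes f: "f \<in> carrier D" and h: "h \<in> C"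
  shows "A_formula H f h \<one>\<^bsub>D\<^esub> \<one> = pure_tensor D H f h"
proof (rule pairing_eqI)
  fix x \<xi> assume x: "x \<in> C" and \<xi>: "lin \<xi>"
  have "pairing x \<xi> (A_formula H f h \<one>\<^bsub>D\<^esub> \<one>) = Sw h (\<lambda>h\<^sub>1 w. Sw w (\<lambda>h\<^sub>2 h\<^sub>3.
      Sw x (\<lambda>x\<^sub>1 x\<^sub>2. f x\<^sub>1 * \<one>\<^bsub>D\<^esub> (Si h\<^sub>3 \<otimes> (x\<^sub>2 \<otimes> S (S h\<^sub>1)))) * \<xi> (h\<^sub>2 \<otimes> \<one>)))"
    by (rule pairing_A_formula[OF x \<xi> f h D_one_closed one_closed])
  also have "\<dots> = Sw h (\<lambda>h\<^sub>1 w. Sw w (\<lambda>h\<^sub>2 h\<^sub>3. (\<epsilon> h\<^sub>1 * f x) * (\<epsilon> h\<^sub>3 * \<xi> h\<^sub>2)))"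
  proof (intro Sw_cong)
    fix h\<^sub>1 w h\<^sub>2 h\<^sub>3 assume c: "h\<^sub>1 \<in> C" "w \<in> C" "h\<^sub>2 \<in> C" "h\<^sub>3 \<in> C"
    have "Sw x (\<lambda>x\<^sub>1 x\<^sub>2. f x\<^sub>1 * \<one>\<^bsub>D\<^esub> (Si h\<^sub>3 \<otimes> (x\<^sub>2 \<otimes> S (S h\<^sub>1)))) =
        Sw x (\<lambda>x\<^sub>1 x\<^sub>2. (\<epsilon> h\<^sub>1 * \<epsilon> h\<^sub>3) * (\<epsilon> x\<^sub>2 * f x\<^sub>1))"
      by (rule Sw_cong) (use c in \<open>simp add: D_one_apply counit_mult counit_Si counit_antipode mult_ac\<close>)
    also have "\<dots> = (\<epsilon> h\<^sub>1 * \<epsilon> h\<^sub>3) * f x"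
      by (simp add: Sw_mult Sw_counit_right[OF D_lin[OF f] x])
    finally show "Sw x (\<lambda>x\<^sub>1 x\<^sub>2. f x\<^sub>1 * \<one>\<^bsub>D\<^esub> (Si h\<^sub>3 \<otimes> (x\<^sub>2 \<otimes> S (S h\<^sub>1)))) * \<xi> (h\<^sub>2 \<otimes> \<one>) =
        (\<epsilon> h\<^sub>1 * f x) * (\<epsilon> h\<^sub>3 * \<xi> h\<^sub>2)"
      using c by (simp add: mult_ac)
  qed
  also have "\<dots> = Sw h (\<lambda>h\<^sub>1 w. f x * (\<epsilon> h\<^sub>1 * \<xi> w))"
    by (rule Sw_cong, simp only: Sw_mult(1) Sw_counit_right[OF \<xi>], simp add: mult_ac)
  also have "\<dots> = pairing x \<xi> (pure_tensor D H f h)"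
    by (simp add: Sw_mult Sw_counit_left[OF \<xi> h] pairing_pure x \<xi> f h)
  finally show "pairing x \<xi> (A_formula H f h \<one>\<^bsub>D\<^esub> \<one>) = pairing x \<xi> (pure_tensor D H f h)" .
qed (use f h A_formula_closed D_one_closed pure_T_closed in auto)

lemma A_mult_one:
  assumes t: "t \<in> carrier T"
  shows "A_mult (pure_tensor D H \<one>\<^bsub>D\<^esub> \<one>) t = t" "A_mult t (pure_tensor D H \<one>\<^bsub>D\<^esub> \<one>) = t"
proof -
  have u: "pure_tensor D H \<one>\<^bsub>D\<^esub> \<one> \<in> carrier T" by (rule pure_T_closed[OF D_one_closed one_closed])
  have i: "linear_map T T (\<lambda>t. t)" by (simp add: linear_map_def)
  show "A_mult (pure_tensor D H \<one>\<^bsub>D\<^esub> \<one>) t = t"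
    by (rule tensor_linear_eqI[OF vspace_D vspace_H vspace_T bilinear_map_linear(1)[OF bilinear_map_A_mult u] i _ t])
       (simp add: A_mult_pure(2)[OF D_one_closed one_closed] A_formula_one_left)
  show "A_mult t (pure_tensor D H \<one>\<^bsub>D\<^esub> \<one>) = t"
    by (rule tensor_linear_eqI[OF vspace_D vspace_H vspace_T bilinear_map_linear(2)[OF bilinear_map_A_mult u] i _ t])
       (simp add: A_mult_pure(2)[OF _ _ D_one_closed one_closed] A_formula_one_right)
qed

section \<open>Assembling the algebra\<close>

lemma A_algebra_simps:
  "carrier (A_algebra H) = carrier T" "x \<oplus>\<^bsub>A_algebra H\<^esub> y = x \<oplus>\<^bsub>T\<^esub> y" "\<zero>\<^bsub>A_algebra H\<^esub> = \<zero>\<^bsub>T\<^esub>"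
  "c \<odot>\<^bsub>A_algebra H\<^esub> x = c \<odot>\<^bsub>T\<^esub> x" "x \<otimes>\<^bsub>A_algebra H\<^esub> y = A_mult x y"
  "\<one>\<^bsub>A_algebra H\<^esub> = pure_tensor D H \<one>\<^bsub>D\<^esub> \<one>"
  by (simp_all add: A_algebra_def A_mult_def Let_def)

lemma assoc_algebra_A_algebra: "assoc_algebra scalars (A_algebra H)"
proof -
  interpret T: module scalars T by simp
  note bm = bilinear_mapD[OF bilinear_map_A_mult]
  have V: "vspace (A_algebra H)"
    by (rule vspaceI; unfold A_algebra_simps)
       (auto simp: T.a_ac T.smult_r_distr T.smult_l_distr[simplified] T.smult_assoc1[simplified]
         T.smult_one[simplified] T.smult_l_null[simplified])
  then interpret V: module scalars "A_algebra H" .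
  have "ring (A_algebra H)"
  proof (rule ringI)
    show "monoid (A_algebra H)"
      by (rule monoidI; unfold A_algebra_simps)
         (auto simp: A_mult_closed A_mult_assoc A_mult_one intro: pure_T_closed D_one_closed)
  qed (use V.abelian_group_axioms in \<open>auto simp: A_algebra_simps bm\<close>)
  then show ?thesis
    using V by (auto simp: assoc_algebra_def assoc_algebra_axioms_def A_algebra_simps bm)
qed

end

theorem proposition4p1:
  fixes H :: "('k::field, 'a) hopf_structure"
  assumes "hopf_algebra H"
    and "finite_dimensional H"
    and "bij_betw (antipode H) (carrier H) (carrier H)"
  shows "assoc_algebra scalars (A_algebra H) \<and>
    (\<forall>f \<in> carrier (dual_hopf H). \<forall>h \<in> carrier H. \<forall>f' \<in> carrier (dual_hopf H). \<forall>h' \<in> carrier H.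
       pure_tensor (dual_hopf H) H f h \<otimes>\<^bsub>A_algebra H\<^esub> pure_tensor (dual_hopf H) H f' h'
         = A_formula H f h f' h')"
proof -
  interpret H: hopf_algebra H by fact
  obtain B coord where "basis H B coord"
    using finite_dimensional_basis[OF H.module_axioms assms(2)] .
  then interpret B: basis H B coord .
  interpret fd_hopf H B coord
    by unfold_locales (rule assms(3))
  show ?thesis
    by (simp add: assoc_algebra_A_algebra A_algebra_simps A_mult_pure(2))
qed

end
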